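(* For every integer $n\ge1$, the complete graph $K_n$ on $n$ vertices is opt-in if and only if $n\le 7$.
   Context: Fix an arbitrary orientation of a finite graph $G$, giving a digraph $D$ with arc set $A(D)$ (the notions below do not depend on the orientation). A cycle is a closed walk (at least one arc, arcs pairwise distinct, arcs may be traversed in either direction) with distinct vertices except that the first equals the last; its incidence vector in $\{0,\pm1\}^{A(D)}$ has entry $1$ (resp. $-1$) on arcs traversed forward (resp. backward). The cycle space $\mathcal C_{\mathbb R}(D)$ is the set of $x\in\mathbb R^{A(D)}$ satisfying flow conservation at every vertex. A directed cycle basis is a basis of $\mathcal C_{\mathbb R}(D)$ consisting of incidence vectors of cycles (which may traverse arcs in either direction). It is integral if every cycle is an integer linear combination of its members. For $w:A(D)\to\mathbb R_{\ge0}$, $w(C)=\sum_{e\in C}w(e)$ and $w(\mathcal B)=\sum_{C\in\mathcal B}w(C)$; minimum bases are those of minimum weight in the respective class. A graph is opt-in if for every weight $w\ge 0$ the weight of a minimum directed cycle basis equals the weight of a minimum integral cycle basis; otherwise it is opt-out. *)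

theory Defs
  imports Complex_Main "HOL-Library.Function_Algebras" "Graph_Theory.Digraph"
begin

type_synonym 'v simple_graph = "'v set \<times> 'v set set"

definition complete_graph :: "nat \<Rightarrow> nat simple_graph" where
  "complete_graph n = ({1..n}, {{u, v} | u v. u \<in> {1..n} \<and> v \<in> {1..n} \<and> u \<noteq> v})"

text \<open>An orientation keeps the edges as names of the arcs and only chooses which
  endpoint of each edge is the tail and which one the head.\<close>

definition orientation_of :: "('v, 'v set) pre_digraph \<Rightarrow> 'v simple_graph \<Rightarrow> bool" where
  "orientation_of D G \<longleftrightarrow>
     verts D = fst G \<and> arcs D = snd G \<and> (\<forall>e\<in>snd G. {tail D e, head D e} = e)"

text \<open>A step \<open>(e, True)\<close> of a walk traverses the arc \<open>e\<close> forward, a step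
  \<open>(e, False)\<close> traverses it backward.\<close>

definition step_start :: "('v, 'e) pre_digraph \<Rightarrow> 'e \<times> bool \<Rightarrow> 'v" where
  "step_start D s = (if snd s then tail D (fst s) else head D (fst s))"

definition step_end :: "('v, 'e) pre_digraph \<Rightarrow> 'e \<times> bool \<Rightarrow> 'v" where
  "step_end D s = (if snd s then head D (fst s) else tail D (fst s))"

definition is_cycle :: "('v, 'e) pre_digraph \<Rightarrow> ('e \<times> bool) list \<Rightarrow> bool" where
  "is_cycle D c \<longleftrightarrow>
     c \<noteq> [] \<and> fst ` set c \<subseteq> arcs D \<and> distinct (map fst c) \<and>
     (\<forall>i < length c. step_end D (c ! i) = step_start D (c ! (Suc i mod length c))) \<and>
     distinct (map (step_start D) c)"

definition incidence_vector :: "('e \<times> bool) list \<Rightarrow> 'e \<Rightarrow> real" where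
  "incidence_vector c e =
     (if (e, True) \<in> set c then 1 else if (e, False) \<in> set c then - 1 else 0)"

definition cycle_vectors :: "('v, 'e) pre_digraph \<Rightarrow> ('e \<Rightarrow> real) set" where
  "cycle_vectors D = incidence_vector ` {c. is_cycle D c}"

text \<open>Vectors indexed by the arcs of \<open>D\<close> are functions on the whole type \<open>'e\<close> that
  vanish outside \<open>arcs D\<close>.\<close>

definition cycle_space :: "('v, 'e) pre_digraph \<Rightarrow> ('e \<Rightarrow> real) set" where
  "cycle_space D =
     {x. (\<forall>e. e \<notin> arcs D \<longrightarrow> x e = 0) \<and>
         (\<forall>v \<in> verts D. (\<Sum>e\<in>out_arcs D v. x e) = (\<Sum>e\<in>in_arcs D v. x e))}"

definition vec_scale :: "real \<Rightarrow> ('e \<Rightarrow> real) \<Rightarrow> 'e \<Rightarrow> real" where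
  "vec_scale a x = (\<lambda>e. a * x e)"

lemma vector_space_vec_scale: "vector_space vec_scale"
  by unfold_locales (auto simp: vec_scale_def fun_eq_iff algebra_simps)

definition directed_cycle_basis :: "('v, 'e) pre_digraph \<Rightarrow> ('e \<Rightarrow> real) set \<Rightarrow> bool" where
  "directed_cycle_basis D B \<longleftrightarrow>
     B \<subseteq> cycle_vectors D \<and>
     \<not> module.dependent vec_scale B \<and>
     module.span vec_scale B = cycle_space D"

definition integral_cycle_basis :: "('v, 'e) pre_digraph \<Rightarrow> ('e \<Rightarrow> real) set \<Rightarrow> bool" where
  "integral_cycle_basis D B \<longleftrightarrow>
     directed_cycle_basis D B \<and>
     (\<forall>x \<in> cycle_vectors D. \<exists>k :: ('e \<Rightarrow> real) \<Rightarrow> int.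
        x = (\<Sum>b\<in>B. vec_scale (of_int (k b)) b))"

text \<open>The arcs of a cycle are the support of its incidence vector, so the weight of a
  cycle can be read off from that vector.\<close>

definition cycle_weight :: "('v, 'e) pre_digraph \<Rightarrow> ('e \<Rightarrow> real) \<Rightarrow> ('e \<Rightarrow> real) \<Rightarrow> real" where
  "cycle_weight D w x = (\<Sum>e \<in> {e \<in> arcs D. x e \<noteq> 0}. w e)"

definition basis_weight :: "('v, 'e) pre_digraph \<Rightarrow> ('e \<Rightarrow> real) \<Rightarrow> ('e \<Rightarrow> real) set \<Rightarrow> real" where
  "basis_weight D w B = (\<Sum>x\<in>B. cycle_weight D w x)"

text \<open>Reversing an arc only negates one coordinate, so this is a property of the underlying
  graph of \<open>D\<close>. All minimum bases in one class have the same weight, so it does not matter which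
  ones are compared; the existential form also records that minimum bases exist.\<close>

definition opt_in :: "('v, 'e) pre_digraph \<Rightarrow> bool" where
  "opt_in D \<longleftrightarrow>
     (\<forall>w. (\<forall>e \<in> arcs D. 0 \<le> w e) \<longrightarrow>
        (\<exists>B B'. is_arg_min (basis_weight D w) (directed_cycle_basis D) B \<and>
                is_arg_min (basis_weight D w) (integral_cycle_basis D) B' \<and>
                basis_weight D w B = basis_weight D w B'))"

end

theory Submission
  imports Defs "HOL-Library.Nat_Bijection"
begin

text \<open>Let \<open>n \<le> 7\<close>, perturb the weight so that distinct edge sets have distinct weights, and let \<open>B\<close>
  be the greedy basis. It is integral if the cycles of weight less than \<open>M\<close> generate, for every \<open>M\<close>,
  all integer vectors in their real span. Replacing edges by shortest walks reduces this to triangles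
  of perimeter less than \<open>M\<close> in a metric on the vertices, and there it suffices that every nonempty
  family \<open>S\<close> of triangles from a greedy basis has a pair of vertices that lies in exactly one of them:
  this forces one coefficient of an integer combination after the other to be an integer.

  Suppose \<open>S\<close> has no such pair. A rank count bounds \<open>card S\<close>, which on at most seven
  vertices leaves a vertex \<open>a\<close> all of whose pairs lie in exactly two triangles of \<open>S\<close>. So the link of
  \<open>a\<close> is a hexagon, two triangles or a pentagon, and only finitely many configurations remain. In each,
  either the boundaries are dependent, or \<open>S\<close> contains four triangles \<open>xyz\<close>, \<open>xy'z'\<close>, \<open>x'yz'\<close>, \<open>x'y'z\<close>
  while none of the opposite ones \<open>x'y'z'\<close>, \<open>x'yz\<close>, \<open>xy'z\<close>, \<open>xyz'\<close> is lighter than the heaviest triangle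
  of \<open>S\<close>. Both foursomes cover the same twelve pairs, so their total weights agree, which is absurd
  for distinct weights.

  For \<open>n \<ge> 8\<close>, eight of the vertices carry a weighted graph embedded in the projective plane whose eleven
  faces are the only cycles of weight at most 18. The faces are independent, so up to sign they lie in
  every minimum basis. Oriented suitably they add up to twice a noncontractible cycle, which
  therefore has half-integral coefficients.\<close>

subsection \<open>Integer spans and greedy bases\<close>

text \<open>Integrality follows by induction on the weight: a cycle rejected by the greedy rule lies
  in the real span of lighter cycles, hence in their integer span, and these are already integer
  combinations of the basis. The bound seven comes from the rank count. If \<open>S\<close> lives on
  u vertices, the deviations from "every pair in exactly two triples" add up to at most u(u-1)/2 -
  3(u-1). This is negative for u = 3, 4, 5, zero for u = 6, and 3 for u = 7, too little to touch
  every vertex. Linear dependence alone cannot finish: the triangulated projective planes on six or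
  seven vertices have independent boundaries and no pair in a single triple. Only the comparison of
  weights excludes them. With quadrilateral faces and eight vertices the same surface admits weights
  for which the faces are the only light cycles, and the argument turns into a counterexample. In
  the reduction to triangles the obstacle is that an edge may be longer than the distance of its
  ends. A triangle of small metric perimeter need not be a combination of light cycles; only its
  image under replacing edges by shortest walks is.\<close>

interpretation vec: vector_space vec_scale
  by (rule vector_space_vec_scale)

lemma vec_scale_apply: "vec_scale c x e = c * x e"
  by (simp add: vec_scale_def)

lemma sum_fun_apply: "(\<Sum>i\<in>I. f i) e = (\<Sum>i\<in>I. f i e :: real)"
  by (induction I rule: infinite_finite_induct) auto

text \<open>The subgroup generated by \<open>X\<close>, given by closure rules so that containments
  go by induction; explicit coefficients are extracted only for finite generating sets.\<close>

inductive_set zspan :: "('e \<Rightarrow> real) set \<Rightarrow> ('e \<Rightarrow> real) set" for X where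
  zspan_0: "0 \<in> zspan X"
| zspan_base: "x \<in> X \<Longrightarrow> x \<in> zspan X"
| zspan_add: "x \<in> zspan X \<Longrightarrow> y \<in> zspan X \<Longrightarrow> x + y \<in> zspan X"
| zspan_neg: "x \<in> zspan X \<Longrightarrow> - x \<in> zspan X"

lemma zspan_sum: "(\<And>i. i \<in> I \<Longrightarrow> f i \<in> zspan X) \<Longrightarrow> sum f I \<in> zspan X"
  by (induction I rule: infinite_finite_induct) (auto intro: zspan_0 zspan_add)

lemma zspan_scale_nat: "x \<in> zspan X \<Longrightarrow> vec_scale (of_nat k) x \<in> zspan X"
proof (induction k)
  case 0
  then show ?case using zspan_0 by (simp add: vec_scale_def zero_fun_def)
next
  case (Suc k)
  have "vec_scale (of_nat (Suc k)) x = x + vec_scale (of_nat k) x"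
    by (auto simp: fun_eq_iff vec_scale_apply algebra_simps)
  then show ?case using Suc zspan_add by metis
qed

lemma zspan_scale: assumes "x \<in> zspan X" "c \<in> \<int>" shows "vec_scale c x \<in> zspan X"
proof -
  obtain k :: int where k: "c = of_int k" using assms(2) Ints_cases by blast
  show ?thesis
  proof (cases "k \<ge> 0")
    case True
    then have "c = of_nat (nat k)" using k by simp
    then show ?thesis using zspan_scale_nat[OF assms(1)] by metis
  next
    case False
    then have "vec_scale c x = - vec_scale (of_nat (nat (- k))) x"
      using k by (auto simp: fun_eq_iff vec_scale_apply)
    then show ?thesis using zspan_scale_nat[OF assms(1)] zspan_neg by metis
  qed
qed

lemma zspan_subset_zspan: assumes "X \<subseteq> zspan Y" shows "zspan X \<subseteq> zspan Y"
proof
  fix x assume "x \<in> zspan X"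
  then show "x \<in> zspan Y"
    by induction (use assms in \<open>blast intro: zspan.intros\<close>)+
qed

lemma zspan_mono: "X \<subseteq> Y \<Longrightarrow> zspan X \<subseteq> zspan Y"
  by (intro zspan_subset_zspan) (auto intro: zspan_base)

lemma zspan_finite_coeffs:
  assumes "x \<in> zspan B" "finite B"
  shows "\<exists>k :: ('e \<Rightarrow> real) \<Rightarrow> int. x = (\<Sum>b\<in>B. vec_scale (of_int (k b)) b)"
  using assms(1)
proof induction
  case zspan_0
  show ?case by (intro exI[of _ "\<lambda>_. 0"]) (auto simp: fun_eq_iff sum_fun_apply vec_scale_apply)
next
  case (zspan_base x)
  have "x = (\<Sum>b\<in>B. vec_scale (of_int (if b = x then 1 else 0)) b)"
  proof
    fix e
    have "(\<Sum>b\<in>B. of_int (if b = x then 1 else 0) * b e) = (\<Sum>b\<in>B. if b = x then x e else 0)"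
      by (intro sum.cong) auto
    then show "x e = (\<Sum>b\<in>B. vec_scale (of_int (if b = x then 1 else 0)) b) e"
      using assms(2) zspan_base by (simp add: sum_fun_apply vec_scale_apply)
  qed
  then show ?case by (intro exI[of _ "\<lambda>b. if b = x then 1 else 0"])
next
  case (zspan_add x y)
  then obtain k l where "x = (\<Sum>b\<in>B. vec_scale (of_int (k b)) b)"
    "y = (\<Sum>b\<in>B. vec_scale (of_int (l b)) b)" by blast
  then have "x + y = (\<Sum>b\<in>B. vec_scale (of_int (k b + l b)) b)"
    by (auto simp: fun_eq_iff sum_fun_apply vec_scale_apply sum.distrib algebra_simps)
  then show ?case by (intro exI[of _ "\<lambda>b. k b + l b"])
next
  case (zspan_neg x)
  then obtain k where "x = (\<Sum>b\<in>B. vec_scale (of_int (k b)) b)" by blast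
  then have "- x = (\<Sum>b\<in>B. vec_scale (of_int (- k b)) b)"
    by (auto simp: fun_eq_iff sum_fun_apply vec_scale_apply sum_negf)
  then show ?case by (intro exI[of _ "\<lambda>b. - k b"])
qed

text \<open>A maximal independent subset of \<open>A\<close> stays independent when \<open>x\<close>
  is added, so a linear map may be prescribed to vanish on it and to be 1 at \<open>x\<close>. Later
  it turns triangles outside a span into cochains and reads off a coefficient in a basis.\<close>

lemma separating_functional:
  assumes "x \<notin> vec.span A"
  obtains f :: "('e \<Rightarrow> real) \<Rightarrow> real"
  where "\<And>y z. f (y + z) = f y + f z" "\<And>c y. f (vec_scale c y) = c * f y"
    "\<And>a. a \<in> A \<Longrightarrow> f a = 0" "f x = 1"
proof -
  interpret vp: vector_space_pair vec_scale "(*) :: real \<Rightarrow> real \<Rightarrow> real"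
    by unfold_locales (auto simp: algebra_simps)
  obtain B where B: "B \<subseteq> A" "vec.independent B" "A \<subseteq> vec.span B"
    using vec.maximal_independent_subset by blast
  have xB: "x \<notin> vec.span B" using assms vec.span_mono[OF B(1)] by blast
  then have "vec.independent (insert x B)" using B(2) vec.independent_insertI by blast
  then obtain g where g: "Vector_Spaces.linear vec_scale (*) g"
    "\<forall>y\<in>insert x B. g y = (if y = x then 1 else 0)"
    using vp.linear_independent_extend[of "insert x B" "\<lambda>y. if y = x then 1 else 0"] by blast
  interpret g: Vector_Spaces.linear vec_scale "(*) :: real \<Rightarrow> real \<Rightarrow> real" g by fact
  have "g b = 0" if "b \<in> B" for b using g(2) that xB vec.span_base by auto
  then have "g a = 0" if "a \<in> A" for a
    using g.eq_0_on_span[of B a] B(3) that by blast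
  then show thesis using that[of g] g(2) g.add g.scale by auto
qed

text \<open>Exchange argument: if the expansion of \<open>z\<close> used a basis vector
  \<open>b\<close> heavier than \<open>z\<close>, replacing \<open>b\<close> by \<open>z\<close>
  would give a lighter basis of the same span.\<close>

lemma min_basis_span:
  assumes fin: "finite B" and ZB: "B \<subseteq> Z" "vec.independent B"
    and min: "\<And>B'. B' \<subseteq> Z \<Longrightarrow> vec.independent B' \<Longrightarrow> vec.span B' = vec.span B
      \<Longrightarrow> sum \<omega> B \<le> (sum \<omega> B' :: real)"
    and z: "z \<in> Z" "z \<in> vec.span B"
  shows "z \<in> vec.span {b\<in>B. \<omega> b \<le> \<omega> z}"
proof (rule ccontr)
  assume neg: "\<not> ?thesis"
  let ?r = "vec.representation B z"
  have rep: "z = (\<Sum>b | ?r b \<noteq> 0. vec_scale (?r b) b)"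
    using vec.sum_nonzero_representation_eq[OF ZB(2) z(2)] by simp
  obtain b where b: "?r b \<noteq> 0" "\<omega> b > \<omega> z"
  proof (rule ccontr)
    assume "\<not> thesis"
    then have "\<And>b. ?r b \<noteq> 0 \<Longrightarrow> b \<in> {b\<in>B. \<omega> b \<le> \<omega> z}"
      using that vec.representation_ne_zero by (metis (mono_tags, lifting) mem_Collect_eq not_le)
    then have "(\<Sum>b | ?r b \<noteq> 0. vec_scale (?r b) b) \<in> vec.span {b\<in>B. \<omega> b \<le> \<omega> z}"
      by (intro vec.span_sum vec.span_scale vec.span_base) blast
    then show False using neg rep by metis
  qed
  have bB: "b \<in> B" using b(1) vec.representation_ne_zero by blast
  have zB: "z \<notin> B" using neg vec.span_base by (metis (mono_tags, lifting) mem_Collect_eq order_refl)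
  have zs: "z \<notin> vec.span (B - {b})"
  proof
    assume a: "z \<in> vec.span (B - {b})"
    have "vec.representation B z = vec.representation (B - {b}) z"
      by (rule vec.representation_extend[OF ZB(2) a]) auto
    then have "vec.representation (B - {b}) z b \<noteq> 0" using b(1) by simp
    then show False using vec.representation_ne_zero by fastforce
  qed
  have ind: "vec.independent (insert z (B - {b}))"
    using zs vec.independent_insertI vec.independent_mono[OF ZB(2)] by blast
  have "z \<in> vec.span (insert b (B - {b}))" using z(2) bB by (simp add: insert_absorb)
  then have "b \<in> vec.span (insert z (B - {b}))" using zs vec.in_span_insert by blast
  then have "B \<subseteq> vec.span (insert z (B - {b}))"
    using vec.span_superset[of "insert z (B - {b})"] by blast
  moreover have "insert z (B - {b}) \<subseteq> vec.span B" using z(2) vec.span_base by blast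
  ultimately have "vec.span (insert z (B - {b})) = vec.span B"
    using vec.span_minimal[OF _ vec.subspace_span] by (intro subset_antisym) blast+
  moreover have "insert z (B - {b}) \<subseteq> Z" using z ZB by blast
  ultimately have "sum \<omega> B \<le> sum \<omega> (insert z (B - {b}))" using min ind by blast
  also have "\<dots> = \<omega> z + (sum \<omega> B - \<omega> b)"
    using fin zB bB by (simp add: sum_diff1)
  finally show False using b(2) by simp
qed

lemma ex_max_on:
  fixes f :: "'a \<Rightarrow> real"
  assumes "finite A" "A \<noteq> {}"
  obtains a where "a \<in> A" "\<And>x. x \<in> A \<Longrightarrow> f x \<le> f a"
proof -
  have "Max (f ` A) \<in> f ` A" using assms by (intro Max_in) auto
  then obtain a where "a \<in> A" "f a = Max (f ` A)" by force
  then show thesis using that assms(1) by simp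
qed

text \<open>The counting hypothesis at the largest value of \<open>g\<close> puts all values of
  \<open>f\<close> at or below it. Hence the two maxima compare, and removing them preserves the
  hypothesis.\<close>

lemma sum_le_if_card_le:
  fixes f :: "'a \<Rightarrow> real" and g :: "'b \<Rightarrow> real"
  assumes "finite A" "finite B" "card A = card B"
    "\<And>t. card {b\<in>B. g b \<le> t} \<le> card {a\<in>A. f a \<le> t}"
  shows "sum f A \<le> sum g B"
  using assms
proof (induction "card A" arbitrary: A B)
  case 0
  then show ?case by simp
next
  case (Suc k)
  have ne: "A \<noteq> {}" "B \<noteq> {}" using Suc.hyps(2) Suc.prems by auto
  obtain a where a: "a \<in> A" and fa: "\<And>x. x \<in> A \<Longrightarrow> f x \<le> f a"
    using ex_max_on[OF Suc.prems(1) ne(1)] by blast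
  obtain b where b: "b \<in> B" and gb: "\<And>x. x \<in> B \<Longrightarrow> g x \<le> g b"
    using ex_max_on[OF Suc.prems(2) ne(2)] by blast
  have "card {x\<in>A. f x \<le> g b} = card A"
  proof -
    have "{x\<in>B. g x \<le> g b} = B" using gb by auto
    then have "card A \<le> card {x\<in>A. f x \<le> g b}" using Suc.prems(3) Suc.prems(4)[of "g b"] by simp
    moreover have "card {x\<in>A. f x \<le> g b} \<le> card A" by (rule card_mono[OF Suc.prems(1)]) blast
    ultimately show ?thesis by simp
  qed
  then have "{x\<in>A. f x \<le> g b} = A" by (intro card_subset_eq[OF Suc.prems(1)]) auto
  then have ab: "f a \<le> g b" using a by blast
  have "sum f (A - {a}) \<le> sum g (B - {b})"
  proof (rule Suc.hyps(1))
    show "k = card (A - {a})" "card (A - {a}) = card (B - {b})"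
      using Suc.hyps(2) Suc.prems a b by (auto simp: card_Diff_singleton)
    fix t
    show "card {x \<in> B - {b}. g x \<le> t} \<le> card {x \<in> A - {a}. f x \<le> t}"
    proof (cases "t < f a")
      case True
      then have "{x \<in> A - {a}. f x \<le> t} = {x\<in>A. f x \<le> t}"
        "{x \<in> B - {b}. g x \<le> t} = {x\<in>B. g x \<le> t}" using ab by auto
      then show ?thesis using Suc.prems(4) by simp
    next
      case False
      then have "{x \<in> A - {a}. f x \<le> t} = A - {a}" using fa by force
      moreover have "card {x \<in> B - {b}. g x \<le> t} \<le> card (B - {b})"
        using Suc.prems(2) by (intro card_mono) auto
      ultimately show ?thesis using Suc.prems a b by (simp add: card_Diff_singleton)
    qed
  qed (use Suc.prems in auto)
  then show ?case using ab a b Suc.prems by (simp add: sum.remove)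
qed

text \<open>At every threshold the members of \<open>B'\<close> below it are independent vectors in
  the span of the members of \<open>B\<close> below it, so \<open>B\<close> has at least as many of
  them.\<close>

lemma basis_weight_le:
  fixes \<omega> :: "('e \<Rightarrow> real) \<Rightarrow> real"
  assumes "finite B" "vec.independent B" "finite B'" "vec.independent B'" "vec.span B = vec.span B'"
    and "\<And>z. z \<in> B' \<Longrightarrow> z \<in> vec.span {b\<in>B. \<omega> b \<le> \<omega> z}"
  shows "sum \<omega> B \<le> sum \<omega> B'"
proof (rule sum_le_if_card_le[OF assms(1,3)])
  show "card B = card B'"
    using vec.dim_eq_card[of B B] vec.dim_eq_card[of B' B] assms by simp
  fix t
  have "{b\<in>B'. \<omega> b \<le> t} \<subseteq> vec.span {b\<in>B. \<omega> b \<le> t}"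
  proof
    fix z assume z: "z \<in> {b\<in>B'. \<omega> b \<le> t}"
    have "vec.span {b\<in>B. \<omega> b \<le> \<omega> z} \<subseteq> vec.span {b\<in>B. \<omega> b \<le> t}"
      using z by (intro vec.span_mono) auto
    then show "z \<in> vec.span {b\<in>B. \<omega> b \<le> t}" using assms(6) z by blast
  qed
  moreover have "vec.independent {b\<in>B'. \<omega> b \<le> t}"
    using assms(4) by (rule vec.independent_mono) auto
  ultimately show "card {b\<in>B'. \<omega> b \<le> t} \<le> card {b\<in>B. \<omega> b \<le> t}"
    using vec.independent_span_bound[of "{b\<in>B. \<omega> b \<le> t}"] assms(1) by auto
qed

text \<open>Distinct weights make all other members of a part of \<open>B\<close> strictly lighter
  than its heaviest one, which is therefore outside their span; removing it proves injectivity and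
  independence by induction. Indexing by \<open>I\<close> instead of by vectors lets the lemma serve
  triples as well as cycles.\<close>

lemma greedy_basis:
  fixes v :: "'i \<Rightarrow> 'e \<Rightarrow> real" and W :: "'i \<Rightarrow> real"
  assumes fin: "finite I" and inj: "inj_on W I"
  defines "B \<equiv> {i\<in>I. v i \<notin> vec.span (v ` {j\<in>I. W j < W i})}"
  shows "inj_on v B" "vec.independent (v ` B)"
    "\<And>i. i \<in> I \<Longrightarrow> v i \<in> vec.span (v ` {b\<in>B. W b \<le> W i})"
proof -
  have finB: "finite B" using fin by (simp add: B_def)
  have BI: "B \<subseteq> I" by (auto simp: B_def)
  have *: "inj_on v S \<and> vec.independent (v ` S)" if "S \<subseteq> B" for S
    using finite_subset[OF that finB] that
  proof (induction "card S" arbitrary: S)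
    case 0
    then have "S = {}" by simp
    then show ?case using vec.independent_empty by (metis image_empty inj_on_empty)
  next
    case (Suc k)
    then have "S \<noteq> {}" by auto
    obtain i where i: "i \<in> S" and max: "\<And>j. j \<in> S \<Longrightarrow> W j \<le> W i"
      using ex_max_on[OF Suc.prems(1) \<open>S \<noteq> {}\<close>] by blast
    have lt: "W j < W i" if "j \<in> S - {i}" for j
    proof -
      have "W j \<le> W i" using max that by blast
      moreover have "W j \<noteq> W i"
        using that i inj BI Suc.prems(2) unfolding inj_on_def by blast
      ultimately show ?thesis by simp
    qed
    have "v ` (S - {i}) \<subseteq> v ` {j\<in>I. W j < W i}" using lt BI Suc.prems(2) by blast
    then have ns: "v i \<notin> vec.span (v ` (S - {i}))"
      using i Suc.prems(2) vec.span_mono unfolding B_def by blast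
    have IH: "inj_on v (S - {i}) \<and> vec.independent (v ` (S - {i}))"
    proof (rule Suc.hyps(1))
      show "k = card (S - {i})" using Suc.hyps(2) Suc.prems(1) i by (simp add: card_Diff_singleton)
      show "finite (S - {i})" "S - {i} \<subseteq> B" using Suc.prems by auto
    qed
    have "v i \<notin> v ` (S - {i})" using ns vec.span_superset[of "v ` (S - {i})"] by blast
    moreover have S: "S = insert i (S - {i})" using i by blast
    ultimately have "inj_on v S" using IH inj_on_insert[of v i "S - {i}"] by simp
    moreover have "vec.independent (v ` S)"
      using vec.independent_insertI[OF ns] IH S by (metis image_insert)
    ultimately show ?case by blast
  qed
  then show "inj_on v B" "vec.independent (v ` B)" by auto
  fix i assume "i \<in> I"
  then show "v i \<in> vec.span (v ` {b\<in>B. W b \<le> W i})"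
  proof (induction "card {j\<in>I. W j < W i}" arbitrary: i rule: less_induct)
    case less
    show ?case
    proof (cases "i \<in> B")
      case True
      then show ?thesis by (intro vec.span_base) auto
    next
      case False
      have "v j \<in> vec.span (v ` {b\<in>B. W b \<le> W i})" if j: "j \<in> I" "W j < W i" for j
      proof -
        have "{k\<in>I. W k < W j} \<subset> {k\<in>I. W k < W i}" using j by force
        then have "card {k\<in>I. W k < W j} < card {k\<in>I. W k < W i}"
          using fin by (intro psubset_card_mono) auto
        then have "v j \<in> vec.span (v ` {b\<in>B. W b \<le> W j})" using less.hyps j(1) by blast
        moreover have "v ` {b\<in>B. W b \<le> W j} \<subseteq> v ` {b\<in>B. W b \<le> W i}" using j(2) by auto
        ultimately show ?thesis using vec.span_mono by blast
      qed
      then have "v ` {j\<in>I. W j < W i} \<subseteq> vec.span (v ` {b\<in>B. W b \<le> W i})" by blast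
      then have "vec.span (v ` {j\<in>I. W j < W i}) \<subseteq> vec.span (v ` {b\<in>B. W b \<le> W i})"
        using vec.span_minimal vec.subspace_span by blast
      then show ?thesis using False less.prems unfolding B_def by blast
    qed
  qed
qed

text \<open>The members of \<open>B\<close> with a non-integral coefficient in \<open>y\<close> would need a coordinate seen by
  exactly one of them.\<close>

lemma collapsible_saturated:
  assumes fin: "finite B" and int: "\<And>b e. b \<in> B \<Longrightarrow> b e \<in> \<int>"
    and coll: "\<And>S. S \<subseteq> B \<Longrightarrow> S \<noteq> {} \<Longrightarrow> \<exists>e. \<exists>b\<in>S. \<bar>b e\<bar> = 1 \<and> (\<forall>b'\<in>S - {b}. b' e = 0)"
    and y: "y \<in> vec.span B" "\<And>e. y e \<in> \<int>"
  shows "y \<in> zspan B"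
proof -
  obtain r where r: "y = (\<Sum>b\<in>B. vec_scale (r b) b)"
    using y(1) vec.span_finite[OF fin] by auto
  let ?S = "{b\<in>B. r b \<notin> \<int>}"
  have "?S = {}"
  proof (rule ccontr)
    assume "?S \<noteq> {}"
    then obtain e b where b: "b \<in> ?S" "\<bar>b e\<bar> = 1" "\<forall>b'\<in>?S - {b}. b' e = 0"
      using coll[of ?S] by auto
    have "y e = (\<Sum>b\<in>B. r b * b e)" by (simp add: r sum_fun_apply vec_scale_apply)
    also have "\<dots> = r b * b e + (\<Sum>b\<in>B - {b}. r b * b e)"
      using b(1) fin by (intro sum.remove) auto
    finally have "r b * b e = y e - (\<Sum>b\<in>B - {b}. r b * b e)" by simp
    moreover have "(\<Sum>b\<in>B - {b}. r b * b e) \<in> \<int>"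
    proof (rule Ints_sum)
      fix c assume c: "c \<in> B - {b}"
      show "r c * c e \<in> \<int>"
      proof (cases "r c \<in> \<int>")
        case True
        then show ?thesis using int c by (simp add: Ints_mult)
      next
        case False
        then have "c \<in> ?S - {b}" using c by blast
        then have "c e = 0" by (rule bspec[OF b(3)])
        then show ?thesis by simp
      qed
    qed
    ultimately have "r b * b e \<in> \<int>" using y(2) by (simp add: Ints_diff)
    moreover have "b e = 1 \<or> b e = - 1" using b(2) by (auto simp: abs_if split: if_splits)
    ultimately have "r b \<in> \<int>" using minus_in_Ints_iff by force
    then show False using b(1) by blast
  qed
  then show ?thesis
    unfolding r by (intro zspan_sum zspan_scale zspan_base) auto
qed

text \<open>Adds a small multiple of powers of two, whose subset sums are distinct by uniqueness of
  binary expansions. The multiple is too small to overturn a strict inequality between subset sums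
  of \<open>w\<close>.\<close>

lemma perturbation:
  fixes w :: "'a \<Rightarrow> real"
  assumes fin: "finite E" and w: "\<And>e. e \<in> E \<Longrightarrow> 0 \<le> w e"
  shows "\<exists>w' :: 'a \<Rightarrow> real. (\<forall>e\<in>E. 0 < w' e) \<and>
    (\<forall>A\<subseteq>E. \<forall>B\<subseteq>E. sum w A < sum w B \<longrightarrow> sum w' A < sum w' B) \<and>
    (\<forall>A\<subseteq>E. \<forall>B\<subseteq>E. sum w' A = sum w' B \<longrightarrow> A = B)"
proof -
  obtain h :: "'a \<Rightarrow> nat" where h: "inj_on h E" using finite_imp_inj_to_nat_seg[OF fin] by auto
  define r :: "'a \<Rightarrow> real" where "r e = 2 ^ h e" for e
  have r_sum: "sum r A = real (set_encode (h ` A))" if "A \<subseteq> E" for A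
    using that by (simp add: r_def set_encode_def sum.reindex inj_on_subset[OF h])
  have r_inj: "A = B" if "A \<subseteq> E" "B \<subseteq> E" "sum r A = sum r B" for A B
  proof -
    have "set_encode (h ` A) = set_encode (h ` B)" using that r_sum by simp
    moreover have "finite (h ` A)" "finite (h ` B)"
      using that(1,2) fin by (auto intro: finite_subset)
    ultimately have "h ` A = h ` B" using set_encode_eq[of "h ` A" "h ` B"] by simp
    then show ?thesis using inj_on_image_eq_iff[OF h that(1,2)] by blast
  qed
  define P where "P = {sum w B - sum w A | A B. A \<subseteq> E \<and> B \<subseteq> E \<and> sum w A < sum w B}"
  have "P \<subseteq> (\<lambda>(A, B). sum w B - sum w A) ` (Pow E \<times> Pow E)" by (auto simp: P_def)
  then have finP: "finite P" by (rule finite_subset) (use fin in simp)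
  \<comment> \<open>The inserted 1 keeps the minimum defined when all subset sums of
    \<open>w\<close> agree.\<close>
  define \<delta> where "\<delta> = Min (insert 1 P)"
  have \<delta>: "\<delta> > 0" using finP by (auto simp: \<delta>_def P_def)
  define \<epsilon> where "\<epsilon> = \<delta> / (sum r E + 1)"
  have r0: "r e > 0" for e by (simp add: r_def)
  have R: "sum r E \<ge> 0" using r0 by (intro sum_nonneg) (simp add: less_imp_le)
  have \<epsilon>: "\<epsilon> > 0" using \<delta> R by (simp add: \<epsilon>_def)
  have small: "\<epsilon> * sum r A < \<delta>" if "A \<subseteq> E" for A
  proof -
    have "sum r A \<le> sum r E" using that fin r0 by (intro sum_mono2) (auto simp: less_imp_le)
    then have "\<epsilon> * sum r A \<le> \<epsilon> * sum r E" using \<epsilon> by simp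
    also have "\<dots> < \<delta>" using \<delta> R by (simp add: \<epsilon>_def field_simps)
    finally show ?thesis .
  qed
  define w' where "w' e = w e + \<epsilon> * r e" for e
  have w'_sum: "sum w' A = sum w A + \<epsilon> * sum r A" for A
    by (simp add: w'_def sum.distrib sum_distrib_left)
  have mono: "sum w' A < sum w' B" if "A \<subseteq> E" "B \<subseteq> E" "sum w A < sum w B" for A B
  proof -
    have "sum w B - sum w A \<in> P" using that by (auto simp: P_def)
    then have "\<delta> \<le> sum w B - sum w A" using finP by (auto simp: \<delta>_def)
    moreover have "0 \<le> \<epsilon> * sum r B" using \<epsilon> r0 by (simp add: sum_nonneg less_imp_le)
    ultimately show ?thesis using small[OF that(1)] by (simp add: w'_sum)
  qed
  have pos: "0 < w' e" if "e \<in> E" for e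
    using w[OF that] \<epsilon> r0[of e] by (simp add: w'_def add_nonneg_pos)
  have inj: "A = B" if "A \<subseteq> E" "B \<subseteq> E" "sum w' A = sum w' B" for A B
  proof -
    have "sum w A = sum w B" using mono[of A B] mono[of B A] that by linarith
    then have "sum r A = sum r B" using that(3) \<epsilon> by (simp add: w'_sum)
    then show ?thesis using r_inj that by blast
  qed
  show ?thesis using pos mono inj by (intro exI[of _ w']) simp
qed

subsection \<open>Families of triples\<close>

text \<open>With vector values this is the boundary of the oriented triangle \<open>xyz\<close>;
  with real values and antisymmetric \<open>f\<close> it is a cochain evaluated on that
  boundary.\<close>

definition circ :: "('v \<Rightarrow> 'v \<Rightarrow> 'a :: ab_group_add) \<Rightarrow> 'v \<Rightarrow> 'v \<Rightarrow> 'v \<Rightarrow> 'a" where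
  "circ f x y z = f x y + f y z + f z x"

definition pairs :: "'v set \<Rightarrow> 'v set set" where
  "pairs t = {e. e \<subseteq> t \<and> card e = 2}"

definition pair_weight :: "('v set \<Rightarrow> real) \<Rightarrow> 'v set \<Rightarrow> real" where
  "pair_weight d t = sum d (pairs t)"

lemma sum_list_map_0: "(\<And>x. x \<in> set xs \<Longrightarrow> f x = 0) \<Longrightarrow> sum_list (map f xs) = (0 :: real)"
  by (induction xs) auto

lemma circ_neg: "(\<And>u v. f v u = - f u v) \<Longrightarrow> circ f y x z = - circ f x y z"
proof -
  assume *: "\<And>u v. f v u = - f u v"
  show ?thesis using *[of y x] *[of x z] *[of z y] by (simp add: circ_def)
qed

lemma pairs_triple:
  assumes "x \<noteq> y" "y \<noteq> z" "x \<noteq> z"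
  shows "pairs {x, y, z} = {{x, y}, {y, z}, {x, z}}"
proof -
  have "e \<in> {{x, y}, {y, z}, {x, z}}" if e: "e \<subseteq> {x, y, z}" "card e = 2" for e
  proof -
    obtain u v where "e = {u, v}" "u \<noteq> v" using e(2) by (auto simp: card_2_iff)
    then show ?thesis using e(1) by auto
  qed
  then have "pairs {x, y, z} \<subseteq> {{x, y}, {y, z}, {x, z}}" unfolding pairs_def by blast
  moreover have "{x, y} \<in> pairs {x, y, z}" "{y, z} \<in> pairs {x, y, z}" "{x, z} \<in> pairs {x, y, z}"
    using assms by (simp_all add: pairs_def)
  ultimately show ?thesis by blast
qed

lemma pair_weight_triple:
  assumes "x \<noteq> y" "y \<noteq> z" "x \<noteq> z"
  shows "pair_weight d {x, y, z} = d {x, y} + d {y, z} + d {x, z}"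
proof -
  have "{x, y} \<noteq> {y, z}" "{x, y} \<noteq> {x, z}" "{y, z} \<noteq> {x, z}"
    using assms by (auto simp: doubleton_eq_iff)
  then show ?thesis unfolding pair_weight_def pairs_triple[OF assms] by simp
qed

lemma finite_pairs [simp]: "finite t \<Longrightarrow> finite (pairs t)"
  by (simp add: pairs_def)

lemma card_pairs: "finite t \<Longrightarrow> card (pairs t) = card t choose 2"
  unfolding pairs_def by (rule n_subsets)

lemma card_3E:
  assumes "card t = 3" "x \<in> t" "y \<in> t" "x \<noteq> y"
  obtains z where "t = {x, y, z}" "z \<noteq> x" "z \<noteq> y"
proof -
  have fin: "finite t" using assms(1) by (metis card.infinite zero_neq_numeral)
  then have "card (t - {x, y}) = 1" using assms by (simp add: card_Diff_subset)
  then obtain z where "t - {x, y} = {z}" by (auto simp: card_1_singleton_iff)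
  then show thesis using that assms(2,3) by blast
qed

lemma card_3E1:
  assumes "card t = 3" "x \<in> t"
  obtains y z where "t = {x, y, z}" "x \<noteq> y" "y \<noteq> z" "x \<noteq> z"
proof -
  have "\<exists>y\<in>t. y \<noteq> x"
  proof (rule ccontr)
    assume "\<not> ?thesis"
    then have "t = {x}" using assms(2) by blast
    then show False using assms(1) by simp
  qed
  then obtain y where y: "y \<in> t" "x \<noteq> y" by blast
  then obtain z where "t = {x, y, z}" "z \<noteq> x" "z \<noteq> y" using card_3E[OF assms y] by blast
  then show thesis using that[of y z] y by blast
qed

text \<open>The value of \<open>circ\<close> at the antisymmetrisation of \<open>h\<close>. As
  \<open>h\<close> is arbitrary, relations between boundaries become linear identities without a
  rewrite rule for antisymmetry; \<open>f u v / 2\<close> recovers an antisymmetric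
  \<open>f\<close>.\<close>

definition skew :: "('v \<Rightarrow> 'v \<Rightarrow> real) \<Rightarrow> 'v \<Rightarrow> 'v \<Rightarrow> 'v \<Rightarrow> real" where
  "skew h x y z = h x y - h y x + (h y z - h z y) + (h z x - h x z)"

lemma circ_skew:
  assumes "\<And>u v. f v u = - f u v"
  shows "circ f x y z = skew (\<lambda>u v. f u v / 2) x y z"
  using assms[of x y] assms[of y z] assms[of z x] by (simp add: circ_def skew_def)

text \<open>One-sided on purpose: this already separates the vertex sets, and it unfolds to
  disequalities of vertices.\<close>

definition tri_neq :: "'v \<times> 'v \<times> 'v \<Rightarrow> 'v \<times> 'v \<times> 'v \<Rightarrow> bool" where
  "tri_neq = (\<lambda>(u, v, w) (x, y, z). u \<notin> {x, y, z} \<or> v \<notin> {x, y, z} \<or> w \<notin> {x, y, z})"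

locale edge_vectors =
  fixes V :: "'v set" and ev :: "'v \<Rightarrow> 'v \<Rightarrow> 'v set \<Rightarrow> real"
  assumes finV: "finite V"
    and ev_anti: "ev v u = - ev u v"
    and ev_supp: "e \<noteq> {u, v} \<Longrightarrow> ev u v e = 0"
    and ev_unit: "u \<in> V \<Longrightarrow> v \<in> V \<Longrightarrow> u \<noteq> v \<Longrightarrow> \<bar>ev u v {u, v}\<bar> = 1"
begin

lemma ev_same [simp]: "ev u u = 0"
proof
  fix e show "ev u u e = 0 e" using ev_anti[of u u] by (simp add: fun_eq_iff)
qed

definition triples :: "'v set set" where
  "triples = {t. t \<subseteq> V \<and> card t = 3}"

text \<open>The sign is arbitrary: \<open>SOME\<close> picks one of the two orientations of the triple.\<close>

definition tri :: "'v set \<Rightarrow> 'v set \<Rightarrow> real" where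
  "tri t = (SOME b. \<exists>x y z. t = {x, y, z} \<and> x \<noteq> y \<and> y \<noteq> z \<and> x \<noteq> z \<and> b = circ ev x y z)"

lemma finite_triples: "finite triples"
  using finV by (simp add: triples_def)

lemma tri_cases:
  assumes "x \<noteq> y" "y \<noteq> z" "x \<noteq> z"
  shows "tri {x, y, z} = circ ev x y z \<or> tri {x, y, z} = - circ ev x y z"
proof -
  have "\<exists>x' y' z'. {x, y, z} = {x', y', z'} \<and> x' \<noteq> y' \<and> y' \<noteq> z' \<and> x' \<noteq> z' \<and> tri {x, y, z} = circ ev x' y' z'"
    unfolding tri_def by (rule someI[of _ "circ ev x y z"]) (use assms in blast)
  then obtain x' y' z' where *: "{x, y, z} = {x', y', z'}" "x' \<noteq> y'" "y' \<noteq> z'" "x' \<noteq> z'"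
    "tri {x, y, z} = circ ev x' y' z'" by blast
  have "(x' = x \<or> x' = y \<or> x' = z) \<and> (y' = x \<or> y' = y \<or> y' = z) \<and> (z' = x \<or> z' = y \<or> z' = z)"
    using *(1) by blast
  moreover have "circ ev y x z = - circ ev x y z" by (rule circ_neg) (rule ev_anti)
  moreover have "circ ev y z x = circ ev x y z" "circ ev z x y = circ ev x y z"
    "circ ev z y x = circ ev y x z" "circ ev x z y = circ ev y x z"
    by (simp_all add: circ_def algebra_simps)
  ultimately show ?thesis using *(2-5) by metis
qed

lemma tri_Ints: assumes "t \<in> triples" shows "tri t e \<in> \<int>"
proof -
  obtain x y z where t: "t = {x, y, z}" "x \<noteq> y" "y \<noteq> z" "x \<noteq> z"
    using assms unfolding triples_def card_3_iff by blast
  have "ev u v e \<in> \<int>" if "u \<in> V" "v \<in> V" for u v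
  proof (cases "u \<noteq> v \<and> e = {u, v}")
    case True
    then show ?thesis using ev_unit[OF that] by (metis Ints_1 Ints_minus abs_eq_iff' )
  next
    case False
    then show ?thesis using ev_supp by (cases "u = v") auto
  qed
  then have "circ ev x y z e \<in> \<int>"
    using assms t(1) by (simp add: circ_def triples_def)
  then show ?thesis using tri_cases[OF t(2-4)] t(1) by auto
qed

lemma tri_apply:
  assumes "x \<in> V" "y \<in> V" "z \<in> V" "x \<noteq> y" "y \<noteq> z" "x \<noteq> z"
  shows "\<bar>tri {x, y, z} {x, y}\<bar> = 1"
proof -
  have "circ ev x y z {x, y} = ev x y {x, y}"
    using assms ev_supp[of "{x, y}" y z] ev_supp[of "{x, y}" z x] by (auto simp: circ_def doubleton_eq_iff)
  then have "\<bar>circ ev x y z {x, y}\<bar> = 1" using ev_unit assms by simp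
  then show ?thesis using tri_cases[OF assms(4-6)] by auto
qed

lemma tri_eq_0:
  assumes "t \<in> triples" "\<not> e \<subseteq> t"
  shows "tri t e = 0"
proof -
  obtain x y z where t: "t = {x, y, z}" "x \<noteq> y" "y \<noteq> z" "x \<noteq> z"
    using assms unfolding triples_def card_3_iff by blast
  have "ev u v e = 0" if "u \<in> t" "v \<in> t" for u v
    using ev_supp[of e u v] that assms(2) by blast
  then have "circ ev x y z e = 0" by (simp add: circ_def t(1))
  then show ?thesis using tri_cases[OF t(2-4)] t(1) by auto
qed

end

text \<open>A hypothetical family without a pair that is seen exactly once, cut out of a greedy
  basis. \<open>C_new\<close> records that the greedy rule accepted the heaviest member
  \<open>C\<close> against all lighter triples, not only those of \<open>S\<close>. The purpose of
  the locale is to be shown inconsistent in \<open>core_contradiction\<close>.\<close>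

locale triple_core = edge_vectors V ev
  for V :: "'v set" and ev +
  fixes S :: "'v set set" and wt :: "'v set \<Rightarrow> real" and C :: "'v set"
  assumes card_V: "card V \<le> 7"
    and S_sub: "S \<subseteq> triples"
    and indep: "vec.independent (tri ` S)" and inj_tri: "inj_on tri S"
    and cover: "\<And>x y. x \<noteq> y \<Longrightarrow> card {t\<in>S. {x, y} \<subseteq> t} \<noteq> 1"
    and W_inj: "inj_on (pair_weight wt) triples"
    and C_in: "C \<in> S"
    and C_max: "\<And>s. s \<in> S \<Longrightarrow> pair_weight wt s \<le> pair_weight wt C"
    and C_new: "tri C \<notin> vec.span (tri ` {t\<in>triples. pair_weight wt t < pair_weight wt C})"
begin

lemma S_triple:
  assumes "{x, y, z} \<in> S"
  shows "x \<in> V" "y \<in> V" "z \<in> V" "x \<noteq> y" "y \<noteq> z" "x \<noteq> z"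
proof -
  have "card {x, y, z} = 3" "{x, y, z} \<subseteq> V" using assms S_sub by (auto simp: triples_def)
  then show "x \<in> V" "y \<in> V" "z \<in> V" "x \<noteq> y" "y \<noteq> z" "x \<noteq> z"
    by (auto simp: card_insert_if split: if_splits)
qed

lemma finite_S: "finite S"
  using S_sub finite_triples finite_subset by blast

text \<open>A separating functional matters only through its values on the edge vectors, which form
  an antisymmetric function of two vertices.\<close>

lemma functional_on_pairs:
  assumes "tri t \<notin> vec.span (tri ` T)" "t \<in> triples"
  obtains f :: "'v \<Rightarrow> 'v \<Rightarrow> real" where "\<And>u v. f v u = - f u v"
    "\<And>x y z. {x, y, z} = t \<Longrightarrow> circ f x y z \<noteq> 0"
    "\<And>x y z. {x, y, z} \<in> T \<inter> triples \<Longrightarrow> circ f x y z = 0"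
proof -
  obtain \<phi> :: "('v set \<Rightarrow> real) \<Rightarrow> real" where \<phi>: "\<And>y z. \<phi> (y + z) = \<phi> y + \<phi> z"
    "\<And>c y. \<phi> (vec_scale c y) = c * \<phi> y" "\<And>a. a \<in> tri ` T \<Longrightarrow> \<phi> a = 0" "\<phi> (tri t) = 1"
    using separating_functional[OF assms(1)] by metis
  have neg: "\<phi> (- y) = - \<phi> y" for y
  proof -
    have "- y = vec_scale (- 1) y" by (auto simp: vec_scale_apply fun_eq_iff)
    then show ?thesis using \<phi>(2) by (metis mult_minus1)
  qed
  define f where "f u v = \<phi> (ev u v)" for u v
  have circ_f: "circ f x y z = \<phi> (circ ev x y z)" for x y z
    by (simp add: circ_def f_def \<phi>(1))
  have tri_f: "circ f x y z = \<phi> (tri {x, y, z}) \<or> circ f x y z = - \<phi> (tri {x, y, z})"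
    if "{x, y, z} \<in> triples" for x y z
  proof -
    have "card {x, y, z} = 3" using that by (simp add: triples_def)
    then have "x \<noteq> y" "y \<noteq> z" "x \<noteq> z" by (auto simp: card_insert_if split: if_splits)
    then show ?thesis using tri_cases[of x y z] circ_f neg by auto
  qed
  show thesis
  proof (rule that[of f])
    show "f v u = - f u v" for u v using ev_anti[of v u] neg by (simp add: f_def)
    show "circ f x y z \<noteq> 0" if "{x, y, z} = t" for x y z
      using tri_f[of x y z] that assms(2) \<phi>(4) by auto
    show "circ f x y z = 0" if "{x, y, z} \<in> T \<inter> triples" for x y z
      using tri_f[of x y z] that \<phi>(3)[of "tri {x, y, z}"] by auto
  qed
qed

text \<open>Independence gives each triple of \<open>S\<close> a dual cochain, which vanishes on the
  other triples of \<open>S\<close>.\<close>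

lemma cocycle_at:
  assumes "{x, y, z} \<in> S"
  obtains f :: "'v \<Rightarrow> 'v \<Rightarrow> real" where "\<And>u v. f v u = - f u v" "circ f x y z \<noteq> 0"
    "\<And>u v w. {u, v, w} \<in> S \<Longrightarrow> {u, v, w} \<noteq> {x, y, z} \<Longrightarrow> circ f u v w = 0"
proof -
  let ?t = "{x, y, z}"
  have "tri ` S - {tri ?t} = tri ` (S - {?t})"
    using inj_tri assms by (auto simp: inj_on_def)
  then have nt: "tri ?t \<notin> vec.span (tri ` (S - {?t}))"
    using indep assms unfolding vec.dependent_def by auto
  have tt: "?t \<in> triples" using assms S_sub by blast
  obtain f :: "'v \<Rightarrow> 'v \<Rightarrow> real" where f: "\<And>u v. f v u = - f u v"
    "\<And>u v w. {u, v, w} = ?t \<Longrightarrow> circ f u v w \<noteq> 0"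
    "\<And>u v w. {u, v, w} \<in> (S - {?t}) \<inter> triples \<Longrightarrow> circ f u v w = 0"
    by (rule functional_on_pairs[OF nt tt]) blast
  show thesis
  proof (rule that[of f])
    show "circ f u v w = 0" if "{u, v, w} \<in> S" "{u, v, w} \<noteq> ?t" for u v w
      using f(3)[of u v w] that S_sub by blast
  qed (simp_all add: f(2), rule f(1))
qed

text \<open>For the heaviest triple the dual cochain can be chosen to vanish on every lighter triple
  of \<open>V\<close>. The other members of \<open>S\<close> are strictly lighter because weights
  are distinct.\<close>

lemma cocycle_at_max:
  obtains f :: "'v \<Rightarrow> 'v \<Rightarrow> real" where "\<And>u v. f v u = - f u v"
    "\<And>x y z. {x, y, z} = C \<Longrightarrow> circ f x y z \<noteq> 0"
    "\<And>u v w. {u, v, w} \<in> S \<Longrightarrow> {u, v, w} \<noteq> C \<Longrightarrow> circ f u v w = 0"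
    "\<And>u v w. {u, v, w} \<in> triples \<Longrightarrow> circ f u v w \<noteq> 0 \<Longrightarrow> pair_weight wt C \<le> pair_weight wt {u, v, w}"
proof -
  obtain f :: "'v \<Rightarrow> 'v \<Rightarrow> real" where f: "\<And>u v. f v u = - f u v"
    "\<And>x y z. {x, y, z} = C \<Longrightarrow> circ f x y z \<noteq> 0"
    "\<And>x y z. {x, y, z} \<in> {t\<in>triples. pair_weight wt t < pair_weight wt C} \<inter> triples \<Longrightarrow> circ f x y z = 0"
    using functional_on_pairs[OF C_new] C_in S_sub by blast
  have less: "circ f u v w = 0" if "{u, v, w} \<in> triples" "pair_weight wt {u, v, w} < pair_weight wt C" for u v w
    using f(3)[of u v w] that by blast
  show thesis
  proof (rule that[of f])
    show "circ f u v w = 0" if "{u, v, w} \<in> S" "{u, v, w} \<noteq> C" for u v w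
    proof -
      have "pair_weight wt {u, v, w} \<noteq> pair_weight wt C"
        using W_inj that C_in S_sub by (auto simp: inj_on_def)
      then show ?thesis using less[of u v w] C_max[OF that(1)] that(1) S_sub by force
    qed
    show "pair_weight wt C \<le> pair_weight wt {u, v, w}"
      if "{u, v, w} \<in> triples" "circ f u v w \<noteq> 0" for u v w
      using less that by force
    show "f v u = - f u v" for u v by (rule f(1))
    show "circ f x y z \<noteq> 0" if "{x, y, z} = C" for x y z using f(2) that .
  qed
qed

text \<open>Evaluating the relation on the cochain dual to \<open>t\<close> leaves only the term of
  \<open>t\<close>. The order within a tuple is its orientation, and repetitions in
  \<open>ts\<close> express larger coefficients.\<close>

lemma dependent_triples:
  assumes S: "\<forall>(u, v, w)\<in>set (t # ts). {u, v, w} \<in> S"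
    and ne: "\<forall>s\<in>set ts. tri_neq s t"
    and zero: "\<And>h. (\<Sum>(u, v, w)\<leftarrow>t # ts. skew h u v w) = 0"
  shows False
proof -
  obtain x y z where t: "t = (x, y, z)" by (metis prod_cases3)
  have "{x, y, z} \<in> S" using S by (simp add: t)
  from cocycle_at[OF this] obtain f :: "'v \<Rightarrow> 'v \<Rightarrow> real" where f: "\<And>u v. f v u = - f u v" "circ f x y z \<noteq> 0"
    "\<And>u v w. {u, v, w} \<in> S \<Longrightarrow> {u, v, w} \<noteq> {x, y, z} \<Longrightarrow> circ f u v w = 0" by metis
  have "circ f u v w = 0" if "(u, v, w) \<in> set ts" for u v w
  proof (rule f(3))
    show "{u, v, w} \<in> S" using bspec[OF S, of "(u, v, w)"] that by simp
    show "{u, v, w} \<noteq> {x, y, z}" using bspec[OF ne that] by (auto simp: tri_neq_def t)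
  qed
  then have "(\<Sum>(u, v, w)\<leftarrow>ts. circ f u v w) = 0"
    by (intro sum_list_map_0) auto
  then show False
    using zero[of "\<lambda>u v. f u v / 2"] f(2) by (simp add: t circ_skew[OF f(1), symmetric])
qed

text \<open>The four triples \<open>xyz\<close>, \<open>xy'z'\<close>, \<open>x'yz'\<close>, \<open>x'y'z\<close> cover the same pairs as the four
  opposite ones, so the two total weights agree.\<close>

lemma opposite_triples:
  assumes S: "{x, y, z} \<in> S" "{x, y', z'} \<in> S" "{x', y, z'} \<in> S" "{x', y', z} \<in> S"
    and dist: "distinct [x, x', y, y', z, z']"
    and f: "\<And>u v w. {u, v, w} \<in> triples \<Longrightarrow> circ f u v w \<noteq> 0 \<Longrightarrow> pair_weight wt C \<le> pair_weight wt {u, v, w}"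
    and ne: "circ f x' y' z' \<noteq> 0" "circ f x' y z \<noteq> 0" "circ f x y' z \<noteq> 0" "circ f x y z' \<noteq> 0"
  shows False
proof -
  have in_V: "{x, x', y, y', z, z'} \<subseteq> V" using S_triple[OF S(1)] S_triple[OF S(2)] S_triple[OF S(3)] by blast
  have tr: "{u, v, w} \<in> triples" if "{u, v, w} \<subseteq> V" "u \<noteq> v" "v \<noteq> w" "u \<noteq> w" for u v w
    using that by (simp add: triples_def)
  let ?W = "pair_weight wt"
  have ge: "?W C \<le> ?W {x', y', z'}" "?W C \<le> ?W {x', y, z}" "?W C \<le> ?W {x, y', z}" "?W C \<le> ?W {x, y, z'}"
    by (intro f ne tr; use in_V dist in auto)+
  have le: "?W {x, y, z} \<le> ?W C" "?W {x, y', z'} \<le> ?W C" "?W {x', y, z'} \<le> ?W C" "?W {x', y', z} \<le> ?W C"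
    using C_max S by blast+
  \<comment> \<open>The eight triples are the faces of an octahedron with antipodes
    \<open>x x'\<close>, \<open>y y'\<close>, \<open>z z'\<close>; each side is one class of the
    two-coloured faces and uses all twelve edges once.\<close>
  have "?W {x, y, z} + ?W {x, y', z'} + ?W {x', y, z'} + ?W {x', y', z}
    = ?W {x', y', z'} + ?W {x', y, z} + ?W {x, y', z} + ?W {x, y, z'}"
    using dist by (simp add: pair_weight_triple insert_commute)
  \<comment> \<open>The weights on one side are at most \<open>?W C\<close>, on the other at least
    that, so equal totals make all eight equal.\<close>
  then have "?W {x, y, z} = ?W {x, y', z'}" using ge le by linarith
  then have "{x, y, z} = {x, y', z'}" using W_inj S S_sub by (meson inj_onD subsetD)
  then show False using dist by auto
qed

text \<open>When \<open>eq\<close> is evaluated at \<open>f\<close>, only the term of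
  \<open>C\<close> survives on the left, so twice the value at \<open>xyz\<close> is the value at
  \<open>C\<close> up to sign.\<close>

lemma half_sum_nonzero:
  fixes f :: "'v \<Rightarrow> 'v \<Rightarrow> real"
  assumes C: "C \<in> (\<lambda>(u, v, w). {u, v, w}) ` set ts"
    and S: "\<forall>(u, v, w)\<in>set ts. {u, v, w} \<in> S"
    and dist: "sorted_wrt tri_neq ts"
    and anti: "\<And>u v. f v u = - f u v"
    and f: "\<And>x y z. {x, y, z} = C \<Longrightarrow> circ f x y z \<noteq> 0"
      "\<And>u v w. {u, v, w} \<in> S \<Longrightarrow> {u, v, w} \<noteq> C \<Longrightarrow> circ f u v w = 0"
    and signs: "length ss = length ts" "set ss \<subseteq> {1, - 1}"
    and eq: "\<And>h. (\<Sum>(s, u, v, w)\<leftarrow>zip ss ts. s * skew h u v w) = 2 * skew h x y z"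
  shows "circ f x y z \<noteq> 0"
proof -
  define g where "g = (\<lambda>(u :: 'v, v, w). {u, v, w})"
  define c where "c = (\<lambda>(u, v, w). circ f u v w)"
  have tri_neq_g: "g s \<noteq> g t" if "tri_neq s t" for s t
    using that unfolding g_def tri_neq_def by (cases s; cases t) (simp; blast)
  obtain i where i: "i < length ts" "g (ts ! i) = C"
    using C unfolding g_def by (metis (no_types, lifting) imageE in_set_conv_nth)
  have "g (ts ! j) \<noteq> C" if "j < length ts" "j \<noteq> i" for j
    using dist tri_neq_g i that unfolding sorted_wrt_iff_nth_less by (metis nat_neq_iff)
  then have zero: "c (ts ! j) = 0" if "j < length ts" "j \<noteq> i" for j
    using S f(2) that nth_mem[OF that(1)] unfolding g_def c_def by (cases "ts ! j") force
  have nz: "c (ts ! i) \<noteq> 0"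
    using f(1) i(2) unfolding g_def c_def by (cases "ts ! i") auto
  have sign: "ss ! i \<in> {1, - 1}" using signs i(1) nth_mem[of i ss] by (metis subsetD)
  have "ss ! i * c (ts ! i) = (\<Sum>j<length ts. ss ! j * c (ts ! j))"
  proof -
    have "(\<Sum>j\<in>{..<length ts} - {i}. ss ! j * c (ts ! j)) = 0" using zero by (intro sum.neutral) auto
    then show ?thesis using i(1) by (simp add: sum.remove[of _ i])
  qed
  also have "\<dots> = (\<Sum>(s, t)\<leftarrow>zip ss ts. s * c t)"
    using signs(1) by (simp add: sum_list_sum_nth atLeast0LessThan)
  also have "\<dots> = (\<Sum>(s, u, v, w)\<leftarrow>zip ss ts. s * skew (\<lambda>u v. f u v / 2) u v w)"
    by (intro arg_cong[of _ _ sum_list] map_cong) (auto simp: c_def circ_skew[OF anti])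
  also have "\<dots> = 2 * circ f x y z" unfolding eq by (simp add: circ_skew[OF anti])
  finally show ?thesis using nz sign by auto
qed

text \<open>A functional that vanishes on the family except at its heaviest triple \<open>C\<close> does not vanish on
  a triple whose doubled boundary is a signed sum of boundaries from the family. As lighter triples
  do not see such a functional, none of the four opposite triples is lighter than \<open>C\<close>.\<close>

lemma opposite_sums:
  assumes opp: "{x, y, z} \<in> S" "{x, y', z'} \<in> S" "{x', y, z'} \<in> S" "{x', y', z} \<in> S"
      "distinct [x, x', y, y', z, z']"
    and ts: "C \<in> (\<lambda>(u, v, w). {u, v, w}) ` set ts" "\<forall>(u, v, w)\<in>set ts. {u, v, w} \<in> S" "sorted_wrt tri_neq ts"
    and signs: "\<forall>ss\<in>{s1, s2, s3, s4}. length ss = length ts \<and> set ss \<subseteq> {1, - 1}"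
    and eq: "\<And>h. (\<Sum>(s, u, v, w)\<leftarrow>zip s1 ts. s * skew h u v w) = 2 * skew h x' y' z'"
      "\<And>h. (\<Sum>(s, u, v, w)\<leftarrow>zip s2 ts. s * skew h u v w) = 2 * skew h x' y z"
      "\<And>h. (\<Sum>(s, u, v, w)\<leftarrow>zip s3 ts. s * skew h u v w) = 2 * skew h x y' z"
      "\<And>h. (\<Sum>(s, u, v, w)\<leftarrow>zip s4 ts. s * skew h u v w) = 2 * skew h x y z'"
  shows False
proof -
  obtain f :: "'v \<Rightarrow> 'v \<Rightarrow> real" where f: "\<And>u v. f v u = - f u v"
    "\<And>x y z. {x, y, z} = C \<Longrightarrow> circ f x y z \<noteq> 0"
    "\<And>u v w. {u, v, w} \<in> S \<Longrightarrow> {u, v, w} \<noteq> C \<Longrightarrow> circ f u v w = 0"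
    "\<And>u v w. {u, v, w} \<in> triples \<Longrightarrow> circ f u v w \<noteq> 0 \<Longrightarrow> pair_weight wt C \<le> pair_weight wt {u, v, w}"
    using cocycle_at_max by metis
  show False
  proof (rule opposite_triples[OF opp f(4)])
    show "circ f x' y' z' \<noteq> 0" 
      by (rule half_sum_nonzero[OF ts, of f s1]; (rule f eq | use signs in simp))
    show "circ f x' y z \<noteq> 0" 
      by (rule half_sum_nonzero[OF ts, of f s2]; (rule f eq | use signs in simp))
    show "circ f x y' z \<noteq> 0" 
      by (rule half_sum_nonzero[OF ts, of f s3]; (rule f eq | use signs in simp))
    show "circ f x y z' \<noteq> 0" 
      by (rule half_sum_nonzero[OF ts, of f s4]; (rule f eq | use signs in simp))
  qed
qed

section \<open>Rank bound and double counting of covered pairs\<close>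

definition cnt :: "'v set \<Rightarrow> nat" where
  "cnt e = card {t\<in>S. e \<subseteq> t}"

definition U :: "'v set" where
  "U = \<Union>S"

definition nbrs :: "'v \<Rightarrow> 'v set" where
  "nbrs v = {u. u \<noteq> v \<and> cnt {v, u} \<noteq> 0}"

text \<open>Covered pairs lie in at least two triples, so the subtraction is exact on them. An
  uncovered pair costs 1: it lowers the number of triples allowed by \<open>card_S_bound\<close> by
  one, that is three incidences, while only two are missing at the pair.\<close>

definition defect :: "'v set \<Rightarrow> nat" where
  "defect e = (if cnt e = 0 then 1 else cnt e - 2)"

lemma U_sub: "U \<subseteq> V"
  using S_sub by (auto simp: U_def triples_def)

lemma finite_U: "finite U"
  using U_sub finV finite_subset by blast

lemma cnt_pos: "cnt e \<noteq> 0 \<longleftrightarrow> (\<exists>t\<in>S. e \<subseteq> t)"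
  using finite_S by (auto simp: cnt_def)

lemma S_3: "t \<in> S \<Longrightarrow> card t = 3"
  using S_sub by (auto simp: triples_def)

lemma nbrs_sub: "nbrs v \<subseteq> U - {v}"
  unfolding nbrs_def cnt_pos U_def by blast

lemma cnt_triple: assumes "{x, y, z} \<in> S" shows "cnt {x, y} \<noteq> 0" "cnt {y, z} \<noteq> 0" "cnt {x, z} \<noteq> 0"
  unfolding cnt_pos by (rule bexI[OF _ assms], simp)+

lemma other_triple:
  assumes "t \<in> S" "{x, y} \<subseteq> t" "x \<noteq> y"
  obtains t' where "t' \<in> S" "{x, y} \<subseteq> t'" "t' \<noteq> t"
proof -
  have "{t\<in>S. {x, y} \<subseteq> t} \<noteq> {t}"
  proof
    assume "{t\<in>S. {x, y} \<subseteq> t} = {t}"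
    then have "card {t\<in>S. {x, y} \<subseteq> t} = 1" by simp
    then show False using cover[OF assms(3)] by simp
  qed
  moreover have "t \<in> {t\<in>S. {x, y} \<subseteq> t}" using assms by simp
  ultimately obtain t' where "t' \<in> {t\<in>S. {x, y} \<subseteq> t}" "t' \<noteq> t" by blast
  then show thesis using that by blast
qed

lemma three_nbrs: assumes "v \<in> U" shows "3 \<le> card (nbrs v)"
proof -
  obtain t where t: "t \<in> S" "v \<in> t" using assms by (auto simp: U_def)
  obtain x y where xy: "t = {v, x, y}" "v \<noteq> x" "x \<noteq> y" "v \<noteq> y"
    using card_3E1[OF S_3[OF t(1)] t(2)] by blast
  obtain t' where t': "t' \<in> S" "{v, x} \<subseteq> t'" "t' \<noteq> t"
    using other_triple[of t v x] t xy by blast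
  obtain z where z: "t' = {v, x, z}" "z \<noteq> v" "z \<noteq> x"
    using card_3E[OF S_3[OF t'(1)], of v x] t'(2) xy(2) by blast
  have "z \<noteq> y" using z t'(3) xy(1) by blast
  have "{x, y, z} \<subseteq> nbrs v"
    using cnt_triple[of v x y] cnt_triple[of v x z] t t' xy z by (simp add: nbrs_def)
  moreover have "card {x, y, z} = 3" using xy z \<open>z \<noteq> y\<close> by simp
  moreover have "finite (nbrs v)" using nbrs_sub finite_U by (meson finite_Diff finite_subset)
  ultimately show ?thesis by (metis card_mono)
qed

text \<open>The boundaries of \<open>S\<close> lie in the cycle space of the graph of covered pairs,
  whose dimension for a connected graph is edges minus vertices plus one. Connectedness comes from
  \<open>three_nbrs\<close>: two nonadjacent vertices have at least three neighbours each among at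
  most five others, hence a common one.\<close>

lemma card_S_bound: "card S + card U \<le> card {e\<in>pairs U. cnt e \<noteq> 0} + 1"
proof -
  let ?H = "{e\<in>pairs U. cnt e \<noteq> 0}"
  obtain r where r: "r \<in> U"
    using C_in S_3 by (metis U_def Union_iff card.empty ex_in_conv zero_neq_numeral)
  have common: "\<exists>p. p \<in> nbrs r \<inter> nbrs v" if v: "v \<in> U - {r}" "v \<notin> nbrs r" for v
  proof (rule ccontr)
    assume "\<nexists>p. p \<in> nbrs r \<inter> nbrs v"
    then have "nbrs r \<inter> nbrs v = {}" by blast
    moreover have fin: "finite (nbrs r)" "finite (nbrs v)"
      using nbrs_sub finite_U by (meson finite_Diff finite_subset)+
    ultimately have "card (nbrs r \<union> nbrs v) = card (nbrs r) + card (nbrs v)" by (simp add: card_Un_disjoint)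
    then have "6 \<le> card (nbrs r \<union> nbrs v)" using three_nbrs[OF r] three_nbrs[of v] v(1) by simp
    moreover have "nbrs r \<union> nbrs v \<subseteq> U - {r, v}"
      using nbrs_sub[of r] nbrs_sub[of v] v(2) by (auto simp: nbrs_def insert_commute)
    then have "card (nbrs r \<union> nbrs v) \<le> card (U - {r, v})" using finite_U by (intro card_mono) auto
    moreover have "card (U - {r, v}) = card U - 2" using r v(1) finite_U by (subst card_Diff_subset) auto
    moreover have "card U \<le> 7" using card_mono[OF finV U_sub] card_V by simp
    ultimately show False by simp
  qed
  \<comment> \<open>The parent of \<open>v\<close> in a spanning tree of depth at most two with root
    \<open>r\<close>.\<close>
  define p where "p v = (if v \<in> nbrs r then r else (SOME p. p \<in> nbrs r \<inter> nbrs v))" for v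
  have p: "p v \<in> nbrs v \<and> (p v = r \<or> p v \<in> nbrs r)" if v: "v \<in> U - {r}" for v
  proof (cases "v \<in> nbrs r")
    case True
    then show ?thesis by (auto simp: p_def nbrs_def insert_commute)
  next
    case False
    then have "p v \<in> nbrs r \<inter> nbrs v"
      using someI_ex[OF common[OF v False]] by (simp add: p_def)
    then show ?thesis by simp
  qed
  \<comment> \<open>\<open>\<rho> v\<close> is the tree path from \<open>r\<close> to
    \<open>v\<close>, so \<open>X u v\<close> is the fundamental cycle of the edge
    \<open>uv\<close>. It vanishes on tree edges, and the tree paths cancel around a
    triangle.\<close>
  define \<rho> where "\<rho> v = (if v = r then 0 else if p v = r then ev r v else ev r (p v) + ev (p v) v)" for v
  define X where "X u v = ev u v + \<rho> u - \<rho> v" for u v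
  have X_anti: "X v u = - X u v" for u v
    using ev_anti[of v u] by (simp add: X_def)
  have p_r: "p v = r" if "v \<in> nbrs r" for v using that by (simp add: p_def)
  have r_notin: "r \<notin> nbrs r" by (simp add: nbrs_def)
  have X_tree: "X (p v) v = 0" if v: "v \<in> U - {r}" for v
  proof (cases "p v = r")
    case True
    then show ?thesis using v by (simp add: X_def \<rho>_def)
  next
    case False
    then have "p v \<in> nbrs r" using p[OF v] by blast
    then have "p (p v) = r" "p v \<noteq> r" using p_r r_notin by auto
    then show ?thesis using v False by (simp add: X_def \<rho>_def)
  qed
  let ?T = "(\<lambda>v. {p v, v}) ` (U - {r})"
  have "?T \<subseteq> ?H"
  proof
    fix e assume "e \<in> ?T"
    then obtain v where v: "v \<in> U - {r}" "e = {p v, v}" by blast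
    then have "p v \<in> nbrs v" using p by blast
    moreover from this have "p v \<in> U" "p v \<noteq> v" using nbrs_sub[of v] by blast+
    ultimately show "e \<in> ?H" using v by (simp add: pairs_def nbrs_def insert_commute)
  qed
  have "inj_on (\<lambda>v. {p v, v}) (U - {r})"
  proof (rule inj_onI, rule ccontr)
    fix u v assume uv: "u \<in> U - {r}" "v \<in> U - {r}" "{p u, u} = {p v, v}" "u \<noteq> v"
    then have "p u = v" "p v = u" by (auto simp: doubleton_eq_iff)
    then have "v \<in> nbrs r" using p[OF uv(1)] uv(2) by auto
    then show False using p_r \<open>p v = u\<close> uv(1) by auto
  qed
  then have card_T: "card ?T = card U - 1" using r by (simp add: card_image)
  have finH: "finite ?H" using finite_U by simp
  \<comment> \<open>An arbitrary direction for each pair; the sign does not affect spans.\<close>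
  define Xe where "Xe e = (SOME x. \<exists>u v. e = {u, v} \<and> x = X u v)" for e
  have Xe: "Xe {u, v} = X u v \<or> Xe {u, v} = - X u v" for u v
  proof -
    have "\<exists>u' v'. {u, v} = {u', v'} \<and> Xe {u, v} = X u' v'"
      unfolding Xe_def by (rule someI[of _ "X u v"]) blast
    then obtain u' v' where *: "{u, v} = {u', v'}" "Xe {u, v} = X u' v'" by blast
    then have "u' = u \<and> v' = v \<or> u' = v \<and> v' = u" by (auto simp: doubleton_eq_iff)
    then show ?thesis using *(2) X_anti[of v u] by auto
  qed
  have X_span: "X u v \<in> vec.span (Xe ` (?H - ?T))" if "{u, v} \<in> ?H" for u v
  proof (cases "{u, v} \<in> ?T")
    case True
    then obtain w where "w \<in> U - {r}" "{u, v} = {p w, w}" by blast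
    then have "X u v = X (p w) w \<or> X u v = - X (p w) w" "X (p w) w = 0"
      using X_anti[of "p w" w] X_tree[of w] by (auto simp: doubleton_eq_iff)
    then have "X u v = 0" by auto
    then show ?thesis using vec.span_zero by simp
  next
    case False
    then have "Xe {u, v} \<in> vec.span (Xe ` (?H - ?T))" using that by (intro vec.span_base) blast
    then show ?thesis using Xe[of u v] vec.span_neg[of "Xe {u, v}"] by auto
  qed
  have "tri ` S \<subseteq> vec.span (Xe ` (?H - ?T))"
  proof
    fix b assume "b \<in> tri ` S"
    then obtain t where t: "t \<in> S" "b = tri t" by blast
    obtain x y z where xyz: "t = {x, y, z}" "x \<noteq> y" "y \<noteq> z" "x \<noteq> z"
      using S_3[OF t(1)] unfolding card_3_iff by blast
    have "{u, v} \<in> ?H" if "u \<in> t" "v \<in> t" "u \<noteq> v" for u v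
    proof -
      have "cnt {u, v} \<noteq> 0" unfolding cnt_pos using that t(1) by blast
      then show ?thesis using that t(1) by (auto simp: pairs_def U_def)
    qed
    then have "X x y + X y z + X z x \<in> vec.span (Xe ` (?H - ?T))"
      using xyz by (intro vec.span_add X_span) auto
    moreover have "X x y + X y z + X z x = circ ev x y z"
      by (simp add: X_def circ_def algebra_simps)
    ultimately show "b \<in> vec.span (Xe ` (?H - ?T))"
      using tri_cases[OF xyz(2-4)] vec.span_neg[of "circ ev x y z"] t(2) xyz(1) by auto
  qed
  then have "card (tri ` S) \<le> card (Xe ` (?H - ?T))"
    using vec.independent_span_bound[OF _ indep] finH by simp
  also have "\<dots> \<le> card (?H - ?T)" using finH by (intro card_image_le) simp
  also have "\<dots> = card ?H - card ?T" using finite_subset[OF \<open>?T \<subseteq> ?H\<close> finH] \<open>?T \<subseteq> ?H\<close> by (simp add: card_Diff_subset)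
  finally have "card S \<le> card ?H - (card U - 1)" using card_T inj_tri by (simp add: card_image)
  moreover have "card ?T \<le> card ?H" using \<open>?T \<subseteq> ?H\<close> finH by (rule card_mono[rotated])
  moreover have "card U \<ge> 1" using r finite_U by (metis One_nat_def Suc_leI card_gt_0_iff empty_iff)
  ultimately show ?thesis using card_T by simp
qed

lemma sum_cnt: "(\<Sum>e\<in>pairs U. cnt e) = 3 * card S"
proof -
  have "(\<Sum>e\<in>pairs U. cnt e) = (\<Sum>e\<in>pairs U. \<Sum>t\<in>S. of_bool (e \<subseteq> t))"
    using finite_S by (simp add: cnt_def of_bool_def sum.If_cases Int_def)
  also have "\<dots> = (\<Sum>t\<in>S. \<Sum>e\<in>pairs U. of_bool (e \<subseteq> t))" by (rule sum.swap)
  also have "\<dots> = (\<Sum>t\<in>S. 3)"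
  proof (rule sum.cong[OF refl])
    fix t assume t: "t \<in> S"
    have "(\<Sum>e\<in>pairs U. of_bool (e \<subseteq> t)) = card {e\<in>pairs U. e \<subseteq> t}"
      using finite_U by (simp add: of_bool_def sum.If_cases Int_def)
    also have "{e\<in>pairs U. e \<subseteq> t} = pairs t" using t by (auto simp: pairs_def U_def)
    also have "card (pairs t) = 3"
      using S_3[OF t] card_pairs[of t] by (simp add: card_ge_0_finite choose_two)
    finally show "(\<Sum>e\<in>pairs U. of_bool (e \<subseteq> t)) = (3 :: nat)" .
  qed
  finally show ?thesis by simp
qed

lemma cnt_ge_2: assumes "e \<in> pairs U" "cnt e \<noteq> 0" shows "2 \<le> cnt e"
proof -
  obtain x y where "e = {x, y}" "x \<noteq> y" using assms(1) by (auto simp: pairs_def card_2_iff)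
  then show ?thesis using cover[of x y] assms(2) by (simp add: cnt_def)
qed

text \<open>Three times \<open>card_S_bound\<close> bounds the incidences counted by
  \<open>sum_cnt\<close>; subtracting two for every covered pair and adding one for every uncovered
  pair leaves this inequality.\<close>

lemma sum_defect: "(\<Sum>e\<in>pairs U. defect e) + 3 * (card U - 1) \<le> card (pairs U)"
proof -
  let ?P = "pairs U" and ?H = "{e\<in>pairs U. cnt e \<noteq> 0}"
  have fin: "finite ?P" using finite_U by simp
  have "(\<Sum>e\<in>?P. defect e) = (\<Sum>e\<in>?P - ?H. defect e) + (\<Sum>e\<in>?H. defect e)"
    using fin by (intro sum.subset_diff) auto
  moreover have "(\<Sum>e\<in>?P - ?H. defect e) = card (?P - ?H)" by (simp add: defect_def)
  moreover have "card (?P - ?H) = card ?P - card ?H" using fin by (intro card_Diff_subset) auto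
  moreover have "card ?H \<le> card ?P" using fin by (intro card_mono) auto
  moreover have "(\<Sum>e\<in>?H. defect e) + 2 * card ?H = (\<Sum>e\<in>?H. cnt e)"
  proof -
    have "(\<Sum>e\<in>?H. defect e) + 2 * card ?H = (\<Sum>e\<in>?H. defect e + 2)" by (subst sum.distrib) simp
    also have "\<dots> = (\<Sum>e\<in>?H. cnt e)" using cnt_ge_2 by (intro sum.cong) (force simp: defect_def)+
    finally show ?thesis .
  qed
  moreover have "(\<Sum>e\<in>?H. cnt e) = (\<Sum>e\<in>?P. cnt e)" using fin by (intro sum.mono_neutral_left) auto
  moreover have "card U \<noteq> 0" using card_mono[OF finite_U Union_upper[OF C_in, folded U_def]] S_3[OF C_in] by simp
  ultimately show ?thesis using sum_cnt card_S_bound by arith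
qed

text \<open>For three, four and five vertices there are fewer than 3(u-1) pairs; for six the two
  numbers agree, and for seven they differ by 3.\<close>

lemma card_U_cases:
  "card U = 6 \<and> (\<Sum>e\<in>pairs U. defect e) = 0 \<or> card U = 7 \<and> (\<Sum>e\<in>pairs U. defect e) \<le> 3"
proof -
  have "C \<subseteq> U" using C_in by (auto simp: U_def)
  then have "3 \<le> card U" using card_mono[OF finite_U] S_3[OF C_in] by metis
  moreover have "card U \<le> 7" using card_mono[OF finV U_sub] card_V by simp
  ultimately have "card U \<in> {3, 4, 5, 6, 7}" by auto
  then show ?thesis
    using sum_defect card_pairs[OF finite_U] by (auto simp: choose_two)
qed

text \<open>At most three pairs have positive defect when there are seven vertices, and none when
  there are six, so they miss a vertex.\<close>

lemma regular_vertex: "\<exists>r\<in>U. \<forall>u\<in>U - {r}. cnt {r, u} = 2"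
proof -
  let ?B = "{e\<in>pairs U. defect e \<noteq> 0}"
  have finB: "finite ?B" using finite_U by simp
  have *: "cnt e = 2" if "e \<in> pairs U" "e \<notin> ?B" for e
    using that cnt_ge_2[of e] by (auto simp: defect_def split: if_splits)
  have "card ?B \<le> (\<Sum>e\<in>?B. defect e)"
    using sum_mono[of ?B "\<lambda>_. 1" defect] by simp
  also have "\<dots> \<le> (\<Sum>e\<in>pairs U. defect e)" using finite_U by (intro sum_mono2) auto
  finally have B: "card ?B \<le> (\<Sum>e\<in>pairs U. defect e)" .
  have "card (\<Union>?B) \<le> sum card ?B" using card_Union_le_sum_card by blast
  also have "\<dots> = 2 * card ?B" by (simp add: pairs_def)
  finally have "card (\<Union>?B) < card U" using B card_U_cases by auto
  moreover have "finite (\<Union>?B)" using finB finite_U by (auto simp: pairs_def intro: finite_subset)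
  ultimately have "\<not> U \<subseteq> \<Union>?B" using card_mono[of "\<Union>?B" U] by linarith
  then obtain r where r: "r \<in> U" "r \<notin> \<Union>?B" by blast
  have "cnt {r, u} = 2" if "u \<in> U - {r}" for u
    using that r by (intro *) (auto simp: pairs_def)
  then show ?thesis using r(1) by blast
qed

lemma cnt_card: assumes "x \<noteq> y" shows "cnt {x, y} = card {z. {x, y, z} \<in> S}"
proof -
  have "{t\<in>S. {x, y} \<subseteq> t} = (\<lambda>z. {x, y, z}) ` {z. {x, y, z} \<in> S}"
  proof (intro equalityI subsetI)
    fix t assume "t \<in> {t\<in>S. {x, y} \<subseteq> t}"
    then have t: "t \<in> S" "x \<in> t" "y \<in> t" by auto
    then obtain z where "t = {x, y, z}" using card_3E[OF S_3[OF t(1)] t(2,3) assms] by metis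
    then show "t \<in> (\<lambda>z. {x, y, z}) ` {z. {x, y, z} \<in> S}" using t(1) by blast
  qed auto
  moreover have "inj_on (\<lambda>z. {x, y, z}) {z. {x, y, z} \<in> S}"
  proof (rule inj_onI)
    fix z z' assume *: "z \<in> {z. {x, y, z} \<in> S}" "z' \<in> {z. {x, y, z} \<in> S}" "{x, y, z} = {x, y, z'}"
    then have "z \<noteq> x" "z \<noteq> y" using S_triple[of x y z] by auto
    then show "z = z'" using *(3) by blast
  qed
  ultimately show ?thesis by (simp add: cnt_def card_image)
qed

lemma cnt_sum:
  assumes "x \<noteq> y" "finite Z" "U = insert x (insert y Z)" "x \<notin> Z" "y \<notin> Z"
  shows "cnt {x, y} = (\<Sum>z\<in>Z. of_bool ({x, y, z} \<in> S))"
proof -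
  have "{z. {x, y, z} \<in> S} = {z\<in>Z. {x, y, z} \<in> S}"
  proof -
    have "z \<in> Z" if "{x, y, z} \<in> S" for z
    proof -
      have "z \<in> U" unfolding U_def using that by blast
      then show ?thesis using S_triple[OF that] unfolding assms(3) by auto
    qed
    then show ?thesis by blast
  qed
  then show ?thesis using cnt_card[OF assms(1)] assms(2)
    by (simp add: of_bool_def sum.If_cases Int_def)
qed

end

subsection \<open>Excluded configurations\<close>

context triple_core
begin

definition hexagon :: "'v \<Rightarrow> 'v \<Rightarrow> 'v \<Rightarrow> 'v \<Rightarrow> 'v \<Rightarrow> 'v \<Rightarrow> 'v \<Rightarrow> bool" where
  "hexagon a b c d e f g \<longleftrightarrow> distinct [a, b, c, d, e, f, g] \<and> {a, b, c} \<in> S \<and> {a, c, d} \<in> S \<and>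
    {a, d, e} \<in> S \<and> {a, e, f} \<in> S \<and> {a, f, g} \<in> S \<and> {a, b, g} \<in> S"

definition two_triangles :: "'v \<Rightarrow> 'v \<Rightarrow> 'v \<Rightarrow> 'v \<Rightarrow> 'v \<Rightarrow> 'v \<Rightarrow> 'v \<Rightarrow> bool" where
  "two_triangles a b c d e f g \<longleftrightarrow> distinct [a, b, c, d, e, f, g] \<and> {a, b, c} \<in> S \<and> {a, c, d} \<in> S \<and>
    {a, b, d} \<in> S \<and> {a, e, f} \<in> S \<and> {a, f, g} \<in> S \<and> {a, e, g} \<in> S"

definition pentagon :: "'v \<Rightarrow> 'v \<Rightarrow> 'v \<Rightarrow> 'v \<Rightarrow> 'v \<Rightarrow> 'v \<Rightarrow> bool" where
  "pentagon a b c d e f \<longleftrightarrow> distinct [a, b, c, d, e, f] \<and> {a, b, c} \<in> S \<and> {a, c, d} \<in> S \<and>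
    {a, d, e} \<in> S \<and> {a, e, f} \<in> S \<and> {a, b, f} \<in> S"

text \<open>The configurations excluded below come from an enumeration of the families that satisfy the
  counting constraints, up to the symmetries of the link of \<open>a\<close>.\<close>

lemma hexagon_1:
  assumes hub: "hexagon a b c d e f g"
  shows "\<not> (
    {b, c, d} \<in> S \<and> {b, c, e} \<in> S \<and> {b, c, f} \<in> S \<and>
    {b, d, f} \<in> S \<and> {b, e, g} \<in> S \<and> {c, e, f} \<in> S \<and>
    {d, e, g} \<in> S \<and> {d, f, g} \<in> S \<and> (
    C = {a, b, c} \<or> C = {a, c, d} \<or> C = {a, d, e} \<or> C = {a, e, f} \<or>
    C = {a, f, g} \<or> C = {a, b, g} \<or> C = {b, c, d} \<or> C = {b, c, e} \<or>
    C = {b, c, f} \<or> C = {b, d, f} \<or> C = {b, e, g} \<or> C = {c, e, f} \<or>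
    C = {d, e, g} \<or> C = {d, f, g}))" (is "\<not> ?P")
proof
  assume *: ?P
  show False
  \<comment> \<open>The octahedron has antipodes \<open>ab\<close>, \<open>dg\<close>,
    \<open>ef\<close>, and the sign lists express its faces \<open>bfg\<close>, \<open>bde\<close>,
    \<open>aeg\<close>, \<open>adf\<close>. The family is the projective plane of
    \<open>hexagon_8\<close> with the face \<open>bef\<close> replaced by its cone from
    \<open>c\<close>.\<close>
  proof (rule opposite_sums[of a d e g f b])
    let ?ts = "[
      (a, b, c), (a, c, d), (a, d, e), (a, e, f), (a, f, g), (a, b, g), (b, c, d), (b, c, e),
      (b, c, f), (b, d, f), (b, e, g), (c, e, f), (d, e, g), (d, f, g)]"
    show "C \<in> (\<lambda>(u, v, w). {u, v, w}) ` set ?ts"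
      using * by (simp add: insert_commute) argo
    show "\<forall>(u, v, w)\<in>set ?ts. {u, v, w} \<in> S"
      using * hub by (simp add: hexagon_def)
    show "sorted_wrt tri_neq ?ts"
      using hub by (auto simp: hexagon_def tri_neq_def)
    show "(\<Sum>(s, u, v, w)\<leftarrow>zip [- 1, - 1, - 1, - 1, - 1, 1, 1, - 1, 1, 1, - 1, 1, 1, - 1] ?ts.
      s * skew h u v w) = 2 * skew h b g f" for h by (simp add: skew_def)
    show "(\<Sum>(s, u, v, w)\<leftarrow>zip [1, 1, 1, 1, 1, - 1, - 1, 1, - 1, 1, - 1, - 1, 1, - 1] ?ts.
      s * skew h u v w) = 2 * skew h b d e" for h by (simp add: skew_def)
    show "(\<Sum>(s, u, v, w)\<leftarrow>zip [1, 1, 1, - 1, - 1, - 1, - 1, - 1, 1, - 1, - 1, 1, - 1, 1] ?ts.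
      s * skew h u v w) = 2 * skew h a g e" for h by (simp add: skew_def)
    show "(\<Sum>(s, u, v, w)\<leftarrow>zip [- 1, - 1, 1, 1, - 1, 1, 1, 1, - 1, 1, 1, - 1, - 1, 1] ?ts.
      s * skew h u v w) = 2 * skew h a d f" for h by (simp add: skew_def)
  qed (use * hub in \<open>auto simp: hexagon_def insert_commute\<close>)
qed

text \<open>In the listed orientations every covered pair is traversed equally often in both
  directions, even \<open>bc\<close>, which lies in four triples. Hence the boundaries add up to
  zero.\<close>

lemma hexagon_2:
  assumes hub: "hexagon a b c d e f g"
  shows "\<not> (
    {b, c, d} \<in> S \<and> {b, c, e} \<in> S \<and> {b, c, f} \<in> S \<and>
    {b, d, f} \<in> S \<and> {b, e, g} \<in> S \<and> {c, e, g} \<in> S \<and>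
    {c, f, g} \<in> S \<and> {d, e, f} \<in> S)" (is "\<not> ?P")
proof
  assume S: ?P
  show False
  proof (rule dependent_triples)
    let ?t = "(b, a, c)" and ?ts = "[
      (c, a, d), (d, a, e), (e, a, f), (f, a, g), (a, b, g), (b, c, d), (b, c, e), (c, b, f),
      (b, d, f), (b, e, g), (e, c, g), (c, f, g), (d, e, f)]"
    show "\<forall>(u, v, w)\<in>set (?t # ?ts). {u, v, w} \<in> S"
      using S hub by (simp add: hexagon_def insert_commute)
    show "\<forall>s\<in>set ?ts. tri_neq s ?t"
      using hub by (auto simp: hexagon_def tri_neq_def)
    show "(\<Sum>(u, v, w)\<leftarrow>?t # ?ts. skew h u v w) = 0" for h
      by (simp add: skew_def)
  qed
qed

lemma hexagon_3:
  assumes hub: "hexagon a b c d e f g"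
  shows "\<not> (
    {b, c, d} \<in> S \<and> {b, c, e} \<in> S \<and> {b, c, f} \<in> S \<and>
    {b, d, g} \<in> S \<and> {b, e, f} \<in> S \<and> {c, e, g} \<in> S \<and>
    {c, f, g} \<in> S \<and> {d, e, g} \<in> S)" (is "\<not> ?P")
proof
  assume S: ?P
  show False
  proof (rule dependent_triples)
    let ?t = "(b, a, c)" and ?ts = "[
      (c, a, d), (d, a, e), (e, a, f), (f, a, g), (a, b, g), (b, c, d), (b, c, e), (c, b, f),
      (b, d, g), (b, e, f), (e, c, g), (c, f, g), (d, e, g)]"
    show "\<forall>(u, v, w)\<in>set (?t # ?ts). {u, v, w} \<in> S"
      using S hub by (simp add: hexagon_def insert_commute)
    show "\<forall>s\<in>set ?ts. tri_neq s ?t"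
      using hub by (auto simp: hexagon_def tri_neq_def)
    show "(\<Sum>(u, v, w)\<leftarrow>?t # ?ts. skew h u v w) = 0" for h
      by (simp add: skew_def)
  qed
qed

text \<open>The projective plane of \<open>hexagon_8\<close> with the face \<open>beg\<close>
  replaced by its cone from \<open>c\<close>. As \<open>beg\<close> is a face of the octahedron used
  there, another one is needed, with antipodes \<open>ad\<close>, \<open>be\<close>,
  \<open>fg\<close>.\<close>

lemma hexagon_4:
  assumes hub: "hexagon a b c d e f g"
  shows "\<not> (
    {b, c, d} \<in> S \<and> {b, c, e} \<in> S \<and> {b, c, g} \<in> S \<and>
    {b, d, f} \<in> S \<and> {b, e, f} \<in> S \<and> {c, e, g} \<in> S \<and>
    {d, e, g} \<in> S \<and> {d, f, g} \<in> S \<and> (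
    C = {a, b, c} \<or> C = {a, c, d} \<or> C = {a, d, e} \<or> C = {a, e, f} \<or>
    C = {a, f, g} \<or> C = {a, b, g} \<or> C = {b, c, d} \<or> C = {b, c, e} \<or>
    C = {b, c, g} \<or> C = {b, d, f} \<or> C = {b, e, f} \<or> C = {c, e, g} \<or>
    C = {d, e, g} \<or> C = {d, f, g}))" (is "\<not> ?P")
proof
  assume *: ?P
  show False
  proof (rule opposite_sums[of d b f e g a])
    let ?ts = "[
      (a, b, c), (a, c, d), (a, d, e), (a, e, f), (a, f, g), (a, b, g), (b, c, d), (b, c, e),
      (b, c, g), (b, d, f), (b, e, f), (c, e, g), (d, e, g), (d, f, g)]"
    show "C \<in> (\<lambda>(u, v, w). {u, v, w}) ` set ?ts"
      using * by (simp add: insert_commute) argo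
    show "\<forall>(u, v, w)\<in>set ?ts. {u, v, w} \<in> S"
      using * hub by (simp add: hexagon_def)
    show "sorted_wrt tri_neq ?ts"
      using hub by (auto simp: hexagon_def tri_neq_def)
    show "(\<Sum>(s, u, v, w)\<leftarrow>zip [- 1, - 1, - 1, 1, 1, 1, 1, - 1, 1, 1, - 1, 1, 1, - 1] ?ts.
      s * skew h u v w) = 2 * skew h a e g" for h by (simp add: skew_def)
    show "(\<Sum>(s, u, v, w)\<leftarrow>zip [1, 1, 1, 1, - 1, 1, - 1, - 1, 1, - 1, - 1, 1, - 1, 1] ?ts.
      s * skew h u v w) = 2 * skew h a b f" for h by (simp add: skew_def)
    show "(\<Sum>(s, u, v, w)\<leftarrow>zip [1, 1, 1, 1, 1, - 1, - 1, 1, - 1, - 1, 1, - 1, 1, - 1] ?ts.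
      s * skew h u v w) = 2 * skew h d e f" for h by (simp add: skew_def)
    show "(\<Sum>(s, u, v, w)\<leftarrow>zip [- 1, - 1, - 1, - 1, - 1, 1, 1, 1, - 1, - 1, 1, - 1, 1, 1] ?ts.
      s * skew h u v w) = 2 * skew h d b g" for h by (simp add: skew_def)
  qed (use * hub in \<open>auto simp: hexagon_def insert_commute\<close>)
qed

lemma hexagon_5:
  assumes hub: "hexagon a b c d e f g"
  shows "\<not> (
    {b, c, d} \<in> S \<and> {b, c, e} \<in> S \<and> {b, d, f} \<in> S \<and>
    {b, d, g} \<in> S \<and> {b, e, f} \<in> S \<and> {c, d, f} \<in> S \<and>
    {c, e, g} \<in> S \<and> {c, f, g} \<in> S \<and> {d, e, g} \<in> S)" (is "\<not> ?P")
proof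
  assume S: ?P
  show False
  proof (rule dependent_triples)
    let ?t = "(b, a, c)" and ?ts = "[
      (c, a, d), (d, a, e), (e, a, f), (f, a, g), (a, b, g), (b, c, e), (d, b, f), (b, d, g),
      (b, e, f), (c, d, f), (e, c, g), (c, f, g), (d, e, g)]"
    show "\<forall>(u, v, w)\<in>set (?t # ?ts). {u, v, w} \<in> S"
      using S hub by (simp add: hexagon_def insert_commute)
    show "\<forall>s\<in>set ?ts. tri_neq s ?t"
      using hub by (auto simp: hexagon_def tri_neq_def)
    show "(\<Sum>(u, v, w)\<leftarrow>?t # ?ts. skew h u v w) = 0" for h
      by (simp add: skew_def)
  qed
qed

text \<open>A triangulated sphere with two vertices identified at \<open>c\<close>, whose link
  consists of the triangles \<open>abd\<close> and \<open>efg\<close>. Orientability makes the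
  boundaries cancel.\<close>

lemma hexagon_6:
  assumes hub: "hexagon a b c d e f g"
  shows "\<not> (
    {b, c, d} \<in> S \<and> {b, d, e} \<in> S \<and> {b, e, g} \<in> S \<and>
    {c, e, f} \<in> S \<and> {c, e, g} \<in> S \<and> {c, f, g} \<in> S)" (is "\<not> ?P")
proof
  assume S: ?P
  show False
  proof (rule dependent_triples)
    let ?t = "(b, a, c)" and ?ts = "[
      (c, a, d), (d, a, e), (e, a, f), (f, a, g), (a, b, g), (b, c, d), (b, d, e), (b, e, g),
      (c, e, f), (e, c, g), (c, f, g)]"
    show "\<forall>(u, v, w)\<in>set (?t # ?ts). {u, v, w} \<in> S"
      using S hub by (simp add: hexagon_def insert_commute)
    show "\<forall>s\<in>set ?ts. tri_neq s ?t"
      using hub by (auto simp: hexagon_def tri_neq_def)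
    show "(\<Sum>(u, v, w)\<leftarrow>?t # ?ts. skew h u v w) = 0" for h
      by (simp add: skew_def)
  qed
qed

text \<open>The projective plane of \<open>hexagon_8\<close> together with the cone from
  \<open>c\<close> over \<open>efg\<close>. The triangle \<open>efg\<close> is noncontractible
  there, so twice its boundary is a signed sum of the twelve faces; therefore the three triples of
  the cone enter twice.\<close>

lemma hexagon_7:
  assumes hub: "hexagon a b c d e f g"
  shows "\<not> (
    {b, c, d} \<in> S \<and> {b, d, f} \<in> S \<and> {b, e, f} \<in> S \<and>
    {b, e, g} \<in> S \<and> {c, e, f} \<in> S \<and> {c, e, g} \<in> S \<and>
    {c, f, g} \<in> S \<and> {d, e, g} \<in> S \<and> {d, f, g} \<in> S)" (is "\<not> ?P")
proof
  assume S: ?P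
  show False
  proof (rule dependent_triples)
    let ?t = "(a, b, c)" and ?ts = "[
      (a, c, d), (a, d, e), (a, e, f), (a, f, g), (b, a, g), (c, b, d), (d, b, f), (b, e, f),
      (e, b, g), (e, d, g), (d, f, g), (e, c, f), (e, c, f), (c, e, g), (c, e, g), (f, c, g),
      (f, c, g)]"
    show "\<forall>(u, v, w)\<in>set (?t # ?ts). {u, v, w} \<in> S"
      using S hub by (simp add: hexagon_def insert_commute)
    show "\<forall>s\<in>set ?ts. tri_neq s ?t"
      using hub by (auto simp: hexagon_def tri_neq_def)
    show "(\<Sum>(u, v, w)\<leftarrow>?t # ?ts. skew h u v w) = 0" for h
      by (simp add: skew_def)
  qed
qed

text \<open>A projective plane on seven vertices: the six-vertex triangulation with its face
  \<open>abd\<close> replaced by the cone from \<open>c\<close>. Its boundaries are independent, so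
  weights have to be compared.\<close>

lemma hexagon_8:
  assumes hub: "hexagon a b c d e f g"
  shows "\<not> (
    {b, c, d} \<in> S \<and> {b, d, f} \<in> S \<and> {b, e, f} \<in> S \<and>
    {b, e, g} \<in> S \<and> {d, e, g} \<in> S \<and> {d, f, g} \<in> S \<and> (
    C = {a, b, c} \<or> C = {a, c, d} \<or> C = {a, d, e} \<or> C = {a, e, f} \<or>
    C = {a, f, g} \<or> C = {a, b, g} \<or> C = {b, c, d} \<or> C = {b, d, f} \<or>
    C = {b, e, f} \<or> C = {b, e, g} \<or> C = {d, e, g} \<or> C = {d, f, g}))" (is "\<not> ?P")
proof
  assume *: ?P
  show False
  proof (rule opposite_sums[of a d e g f b])
    let ?ts = "[
      (a, b, c), (a, c, d), (a, d, e), (a, e, f), (a, f, g), (a, b, g), (b, c, d), (b, d, f),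
      (b, e, f), (b, e, g), (d, e, g), (d, f, g)]"
    show "C \<in> (\<lambda>(u, v, w). {u, v, w}) ` set ?ts"
      using * by (simp add: insert_commute) argo
    show "\<forall>(u, v, w)\<in>set ?ts. {u, v, w} \<in> S"
      using * hub by (simp add: hexagon_def)
    show "sorted_wrt tri_neq ?ts"
      using hub by (auto simp: hexagon_def tri_neq_def)
    show "(\<Sum>(s, u, v, w)\<leftarrow>zip [- 1, - 1, - 1, - 1, - 1, 1, 1, 1, 1, - 1, 1, - 1] ?ts.
      s * skew h u v w) = 2 * skew h b g f" for h by (simp add: skew_def)
    show "(\<Sum>(s, u, v, w)\<leftarrow>zip [1, 1, 1, 1, 1, - 1, - 1, 1, - 1, - 1, 1, - 1] ?ts.
      s * skew h u v w) = 2 * skew h b d e" for h by (simp add: skew_def)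
    show "(\<Sum>(s, u, v, w)\<leftarrow>zip [1, 1, 1, - 1, - 1, - 1, - 1, - 1, 1, - 1, - 1, 1] ?ts.
      s * skew h u v w) = 2 * skew h a g e" for h by (simp add: skew_def)
    show "(\<Sum>(s, u, v, w)\<leftarrow>zip [- 1, - 1, 1, 1, - 1, 1, 1, 1, - 1, 1, - 1, 1] ?ts.
      s * skew h u v w) = 2 * skew h a d f" for h by (simp add: skew_def)
  qed (use * hub in \<open>auto simp: hexagon_def insert_commute\<close>)
qed

lemma hexagon_9:
  assumes hub: "hexagon a b c d e f g"
  shows "\<not> (
    {b, c, e} \<in> S \<and> {b, c, f} \<in> S \<and> {b, d, e} \<in> S \<and>
    {b, d, f} \<in> S \<and> {b, e, g} \<in> S \<and> {c, d, g} \<in> S \<and>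
    {c, e, f} \<in> S \<and> {c, e, g} \<in> S \<and> {d, f, g} \<in> S)" (is "\<not> ?P")
proof
  assume S: ?P
  show False
  proof (rule dependent_triples)
    let ?t = "(b, a, c)" and ?ts = "[
      (c, a, d), (d, a, e), (e, a, f), (f, a, g), (a, b, g), (b, c, f), (b, d, e), (d, b, f),
      (b, e, g), (c, d, g), (c, e, f), (e, c, g), (d, f, g)]"
    show "\<forall>(u, v, w)\<in>set (?t # ?ts). {u, v, w} \<in> S"
      using S hub by (simp add: hexagon_def insert_commute)
    show "\<forall>s\<in>set ?ts. tri_neq s ?t"
      using hub by (auto simp: hexagon_def tri_neq_def)
    show "(\<Sum>(u, v, w)\<leftarrow>?t # ?ts. skew h u v w) = 0" for h
      by (simp add: skew_def)
  qed
qed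

lemma hexagon_10:
  assumes hub: "hexagon a b c d e f g"
  shows "\<not> (
    {b, c, e} \<in> S \<and> {b, d, e} \<in> S \<and> {b, d, f} \<in> S \<and>
    {b, e, f} \<in> S \<and> {b, e, g} \<in> S \<and> {c, d, f} \<in> S \<and>
    {c, e, g} \<in> S \<and> {c, f, g} \<in> S)" (is "\<not> ?P")
proof
  assume S: ?P
  show False
  proof (rule dependent_triples)
    let ?t = "(b, a, c)" and ?ts = "[
      (c, a, d), (d, a, e), (e, a, f), (f, a, g), (a, b, g), (b, c, e), (b, d, e), (d, b, f),
      (b, e, f), (b, e, g), (c, d, f), (e, c, g), (c, f, g)]"
    show "\<forall>(u, v, w)\<in>set (?t # ?ts). {u, v, w} \<in> S"
      using S hub by (simp add: hexagon_def insert_commute)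
    show "\<forall>s\<in>set ?ts. tri_neq s ?t"
      using hub by (auto simp: hexagon_def tri_neq_def)
    show "(\<Sum>(u, v, w)\<leftarrow>?t # ?ts. skew h u v w) = 0" for h
      by (simp add: skew_def)
  qed
qed

text \<open>The projective plane of \<open>pentagon_1\<close> with the edge \<open>bf\<close>
  subdivided by \<open>g\<close>. The octahedron has \<open>b\<close> and \<open>f\<close> as
  antipodes and so avoids that edge.\<close>

lemma hexagon_11:
  assumes hub: "hexagon a b c d e f g"
  shows "\<not> (
    {b, c, e} \<in> S \<and> {b, d, e} \<in> S \<and> {b, d, g} \<in> S \<and>
    {c, d, f} \<in> S \<and> {c, e, f} \<in> S \<and> {d, f, g} \<in> S \<and> (
    C = {a, b, c} \<or> C = {a, c, d} \<or> C = {a, d, e} \<or> C = {a, e, f} \<or>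
    C = {a, f, g} \<or> C = {a, b, g} \<or> C = {b, c, e} \<or> C = {b, d, e} \<or>
    C = {b, d, g} \<or> C = {c, d, f} \<or> C = {c, e, f} \<or> C = {d, f, g}))" (is "\<not> ?P")
proof
  assume *: ?P
  show False
  proof (rule opposite_sums[of a b c f e d])
    let ?ts = "[
      (a, b, c), (a, c, d), (a, d, e), (a, e, f), (a, f, g), (a, b, g), (b, c, e), (b, d, e),
      (b, d, g), (c, d, f), (c, e, f), (d, f, g)]"
    show "C \<in> (\<lambda>(u, v, w). {u, v, w}) ` set ?ts"
      using * by (simp add: insert_commute) argo
    show "\<forall>(u, v, w)\<in>set ?ts. {u, v, w} \<in> S"
      using * hub by (simp add: hexagon_def)
    show "sorted_wrt tri_neq ?ts"
      using hub by (auto simp: hexagon_def tri_neq_def)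
    show "(\<Sum>(s, u, v, w)\<leftarrow>zip [- 1, - 1, - 1, - 1, - 1, 1, 1, - 1, 1, 1, - 1, 1] ?ts.
      s * skew h u v w) = 2 * skew h d f e" for h by (simp add: skew_def)
    show "(\<Sum>(s, u, v, w)\<leftarrow>zip [1, 1, 1, 1, 1, - 1, 1, - 1, - 1, 1, - 1, - 1] ?ts.
      s * skew h u v w) = 2 * skew h d b c" for h by (simp add: skew_def)
    show "(\<Sum>(s, u, v, w)\<leftarrow>zip [1, - 1, - 1, - 1, 1, - 1, - 1, 1, - 1, 1, 1, - 1] ?ts.
      s * skew h u v w) = 2 * skew h a f c" for h by (simp add: skew_def)
    show "(\<Sum>(s, u, v, w)\<leftarrow>zip [1, 1, 1, - 1, - 1, 1, - 1, - 1, 1, - 1, 1, 1] ?ts.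
      s * skew h u v w) = 2 * skew h a b e" for h by (simp add: skew_def)
  qed (use * hub in \<open>auto simp: hexagon_def insert_commute\<close>)
qed

lemma hexagon_12:
  assumes hub: "hexagon a b c d e f g"
  shows "\<not> (
    {b, c, e} \<in> S \<and> {b, d, f} \<in> S \<and> {b, d, g} \<in> S \<and>
    {b, e, f} \<in> S \<and> {c, d, f} \<in> S \<and> {c, e, g} \<in> S \<and>
    {c, f, g} \<in> S \<and> {d, e, g} \<in> S)" (is "\<not> ?P")
proof
  assume S: ?P
  show False
  proof (rule dependent_triples)
    let ?t = "(b, a, c)" and ?ts = "[
      (c, a, d), (d, a, e), (e, a, f), (f, a, g), (a, b, g), (b, c, e), (d, b, f), (b, d, g),
      (b, e, f), (c, d, f), (e, c, g), (c, f, g), (d, e, g)]"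
    show "\<forall>(u, v, w)\<in>set (?t # ?ts). {u, v, w} \<in> S"
      using S hub by (simp add: hexagon_def insert_commute)
    show "\<forall>s\<in>set ?ts. tri_neq s ?t"
      using hub by (auto simp: hexagon_def tri_neq_def)
    show "(\<Sum>(u, v, w)\<leftarrow>?t # ?ts. skew h u v w) = 0" for h
      by (simp add: skew_def)
  qed
qed

text \<open>The complete graph on \<open>a\<close>, \<open>c\<close>, \<open>e\<close>,
  \<open>g\<close> embedded in the projective plane with its three 4-cycles as faces, each face
  coned from one of \<open>b\<close>, \<open>d\<close>, \<open>f\<close>.\<close>

lemma hexagon_13:
  assumes hub: "hexagon a b c d e f g"
  shows "\<not> (
    {b, c, e} \<in> S \<and> {b, e, g} \<in> S \<and> {c, d, g} \<in> S \<and>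
    {c, e, f} \<in> S \<and> {c, f, g} \<in> S \<and> {d, e, g} \<in> S \<and> (
    C = {a, b, c} \<or> C = {a, c, d} \<or> C = {a, d, e} \<or> C = {a, e, f} \<or>
    C = {a, f, g} \<or> C = {a, b, g} \<or> C = {b, c, e} \<or> C = {b, e, g} \<or>
    C = {c, d, g} \<or> C = {c, e, f} \<or> C = {c, f, g} \<or> C = {d, e, g}))" (is "\<not> ?P")
proof
  assume *: ?P
  show False
  proof (rule opposite_sums[of c b e d g a])
    let ?ts = "[
      (a, b, c), (a, c, d), (a, d, e), (a, e, f), (a, f, g), (a, b, g), (b, c, e), (b, e, g),
      (c, d, g), (c, e, f), (c, f, g), (d, e, g)]"
    show "C \<in> (\<lambda>(u, v, w). {u, v, w}) ` set ?ts"
      using * by (simp add: insert_commute) argo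
    show "\<forall>(u, v, w)\<in>set ?ts. {u, v, w} \<in> S"
      using * hub by (simp add: hexagon_def)
    show "sorted_wrt tri_neq ?ts"
      using hub by (auto simp: hexagon_def tri_neq_def)
    show "(\<Sum>(s, u, v, w)\<leftarrow>zip [- 1, - 1, 1, 1, 1, 1, 1, 1, 1, - 1, - 1, - 1] ?ts.
      s * skew h u v w) = 2 * skew h a d g" for h by (simp add: skew_def)
    show "(\<Sum>(s, u, v, w)\<leftarrow>zip [1, 1, 1, - 1, - 1, 1, - 1, 1, - 1, 1, 1, - 1] ?ts.
      s * skew h u v w) = 2 * skew h a b e" for h by (simp add: skew_def)
    show "(\<Sum>(s, u, v, w)\<leftarrow>zip [1, 1, 1, 1, 1, - 1, - 1, - 1, 1, - 1, - 1, 1] ?ts.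
      s * skew h u v w) = 2 * skew h c d e" for h by (simp add: skew_def)
    show "(\<Sum>(s, u, v, w)\<leftarrow>zip [- 1, - 1, - 1, - 1, - 1, 1, - 1, - 1, 1, 1, 1, 1] ?ts.
      s * skew h u v w) = 2 * skew h c b g" for h by (simp add: skew_def)
  qed (use * hub in \<open>auto simp: hexagon_def insert_commute\<close>)
qed

lemma two_triangles_1:
  assumes hub: "two_triangles a b c d e f g"
  shows "\<not> (
    {b, c, e} \<in> S \<and> {b, c, f} \<in> S \<and> {b, c, g} \<in> S \<and>
    {b, d, e} \<in> S \<and> {b, f, g} \<in> S \<and> {c, d, f} \<in> S \<and>
    {c, e, g} \<in> S \<and> {d, e, f} \<in> S)" (is "\<not> ?P")
proof
  assume S: ?P
  show False
  proof (rule dependent_triples)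
    let ?t = "(b, a, c)" and ?ts = "[
      (c, a, d), (a, b, d), (e, a, f), (f, a, g), (a, e, g), (b, c, e), (b, c, f), (c, b, g),
      (d, b, e), (b, f, g), (c, d, f), (e, c, g), (d, e, f)]"
    show "\<forall>(u, v, w)\<in>set (?t # ?ts). {u, v, w} \<in> S"
      using S hub by (simp add: two_triangles_def insert_commute)
    show "\<forall>s\<in>set ?ts. tri_neq s ?t"
      using hub by (auto simp: two_triangles_def tri_neq_def)
    show "(\<Sum>(u, v, w)\<leftarrow>?t # ?ts. skew h u v w) = 0" for h
      by (simp add: skew_def)
  qed
qed

text \<open>The vertices other than \<open>a\<close> carry the six-vertex projective plane with its
  face \<open>efg\<close> replaced by the cone from \<open>a\<close>, while \<open>bcd\<close> is
  noncontractible. The cone from \<open>a\<close> over \<open>bcd\<close> therefore enters with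
  coefficient two.\<close>

lemma two_triangles_2:
  assumes hub: "two_triangles a b c d e f g"
  shows "\<not> (
    {b, c, e} \<in> S \<and> {b, c, f} \<in> S \<and> {b, d, e} \<in> S \<and>
    {b, d, g} \<in> S \<and> {b, f, g} \<in> S \<and> {c, d, f} \<in> S \<and>
    {c, d, g} \<in> S \<and> {c, e, g} \<in> S \<and> {d, e, f} \<in> S)" (is "\<not> ?P")
proof
  assume S: ?P
  show False
  proof (rule dependent_triples)
    let ?t = "(e, a, f)" and ?ts = "[
      (f, a, g), (a, e, g), (b, c, e), (b, c, f), (d, b, e), (d, b, g), (b, f, g), (c, d, f),
      (c, d, g), (e, c, g), (d, e, f), (b, a, c), (b, a, c), (c, a, d), (c, a, d), (a, b, d),
      (a, b, d)]"
    show "\<forall>(u, v, w)\<in>set (?t # ?ts). {u, v, w} \<in> S"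
      using S hub by (simp add: two_triangles_def insert_commute)
    show "\<forall>s\<in>set ?ts. tri_neq s ?t"
      using hub by (auto simp: two_triangles_def tri_neq_def)
    show "(\<Sum>(u, v, w)\<leftarrow>?t # ?ts. skew h u v w) = 0" for h
      by (simp add: skew_def)
  qed
qed

text \<open>An annulus between \<open>bcd\<close> and \<open>efg\<close>, closed by two cones with
  the common apex \<open>a\<close>: a pinched sphere, whose coherently oriented boundaries cancel.
  \<open>two_triangles_4\<close> differs only in the annulus.\<close>

lemma two_triangles_3:
  assumes hub: "two_triangles a b c d e f g"
  shows "\<not> (
    {b, c, e} \<in> S \<and> {b, d, e} \<in> S \<and> {c, d, f} \<in> S \<and>
    {c, e, f} \<in> S \<and> {d, e, g} \<in> S \<and> {d, f, g} \<in> S)" (is "\<not> ?P")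
proof
  assume S: ?P
  show False
  proof (rule dependent_triples)
    let ?t = "(a, b, c)" and ?ts = "[
      (a, c, d), (b, a, d), (e, a, f), (f, a, g), (a, e, g), (c, b, e), (b, d, e), (d, c, f),
      (c, e, f), (e, d, g), (d, f, g)]"
    show "\<forall>(u, v, w)\<in>set (?t # ?ts). {u, v, w} \<in> S"
      using S hub by (simp add: two_triangles_def insert_commute)
    show "\<forall>s\<in>set ?ts. tri_neq s ?t"
      using hub by (auto simp: two_triangles_def tri_neq_def)
    show "(\<Sum>(u, v, w)\<leftarrow>?t # ?ts. skew h u v w) = 0" for h
      by (simp add: skew_def)
  qed
qed

lemma two_triangles_4:
  assumes hub: "two_triangles a b c d e f g"
  shows "\<not> (
    {b, c, e} \<in> S \<and> {b, d, f} \<in> S \<and> {b, e, f} \<in> S \<and>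
    {c, d, g} \<in> S \<and> {c, e, g} \<in> S \<and> {d, f, g} \<in> S)" (is "\<not> ?P")
proof
  assume S: ?P
  show False
  proof (rule dependent_triples)
    let ?t = "(b, a, c)" and ?ts = "[
      (c, a, d), (a, b, d), (e, a, f), (f, a, g), (a, e, g), (b, c, e), (d, b, f), (b, e, f),
      (c, d, g), (e, c, g), (d, f, g)]"
    show "\<forall>(u, v, w)\<in>set (?t # ?ts). {u, v, w} \<in> S"
      using S hub by (simp add: two_triangles_def insert_commute)
    show "\<forall>s\<in>set ?ts. tri_neq s ?t"
      using hub by (auto simp: two_triangles_def tri_neq_def)
    show "(\<Sum>(u, v, w)\<leftarrow>?t # ?ts. skew h u v w) = 0" for h
      by (simp add: skew_def)
  qed
qed

text \<open>The ten triples form the six-vertex triangulation of the projective plane. Triangles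
  that are not faces are noncontractible, so their doubled boundaries are signed sums of all faces;
  four of them are the opposite faces of an octahedron.\<close>

lemma pentagon_1:
  assumes hub: "pentagon a b c d e f"
  shows "\<not> (
    {b, c, e} \<in> S \<and> {b, d, e} \<in> S \<and> {b, d, f} \<in> S \<and>
    {c, d, f} \<in> S \<and> {c, e, f} \<in> S \<and> (
    C = {a, b, c} \<or> C = {a, c, d} \<or> C = {a, d, e} \<or> C = {a, e, f} \<or>
    C = {a, b, f} \<or> C = {b, c, e} \<or> C = {b, d, e} \<or> C = {b, d, f} \<or>
    C = {c, d, f} \<or> C = {c, e, f}))" (is "\<not> ?P")
proof
  assume *: ?P
  show False
  proof (rule opposite_sums[of a c d f e b])
    let ?ts = "[
      (a, b, c), (a, c, d), (a, d, e), (a, e, f), (a, b, f), (b, c, e), (b, d, e), (b, d, f),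
      (c, d, f), (c, e, f)]"
    show "C \<in> (\<lambda>(u, v, w). {u, v, w}) ` set ?ts"
      using * by (simp add: insert_commute) argo
    show "\<forall>(u, v, w)\<in>set ?ts. {u, v, w} \<in> S"
      using * hub by (simp add: pentagon_def)
    show "sorted_wrt tri_neq ?ts"
      using hub by (auto simp: pentagon_def tri_neq_def)
    show "(\<Sum>(s, u, v, w)\<leftarrow>zip [- 1, - 1, - 1, - 1, 1, 1, 1, - 1, 1, - 1] ?ts.
      s * skew h u v w) = 2 * skew h b f e" for h by (simp add: skew_def)
    show "(\<Sum>(s, u, v, w)\<leftarrow>zip [1, 1, 1, 1, - 1, 1, - 1, - 1, 1, - 1] ?ts.
      s * skew h u v w) = 2 * skew h b c d" for h by (simp add: skew_def)
    show "(\<Sum>(s, u, v, w)\<leftarrow>zip [1, 1, - 1, - 1, - 1, - 1, 1, - 1, - 1, 1] ?ts.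
      s * skew h u v w) = 2 * skew h a f d" for h by (simp add: skew_def)
    show "(\<Sum>(s, u, v, w)\<leftarrow>zip [- 1, 1, 1, - 1, 1, 1, - 1, 1, - 1, 1] ?ts.
      s * skew h u v w) = 2 * skew h a c e" for h by (simp add: skew_def)
  qed (use * hub in \<open>auto simp: pentagon_def insert_commute\<close>)
qed

end

section \<open>Two-regular graphs on five or six vertices\<close>

lemma two_regular_next:
  assumes "card {v. L u v} = 2" "L u p"
  obtains q where "q \<noteq> p" "\<And>v. L u v \<longleftrightarrow> v = p \<or> v = q"
proof -
  obtain x y where "{v. L u v} = {x, y}" "x \<noteq> y" using assms(1) by (auto simp: card_2_iff)
  then have *: "L u v \<longleftrightarrow> v = x \<or> v = y" for v by blast
  show thesis
  proof (cases "p = x")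
    case True
    then show thesis using that[of y] * \<open>x \<noteq> y\<close> by blast
  next
    case False
    then show thesis using that[of x] * assms(2) by blast
  qed
qed

text \<open>Outside a union of components the graph is again two-regular, so a nonempty rest has at
  least three vertices, and with exactly three it is a triangle.\<close>

lemma two_regular_remainder:
  assumes sub: "\<And>u v. u \<in> X \<Longrightarrow> L u v \<Longrightarrow> v \<in> X \<and> v \<noteq> u" and sym: "\<And>u v. L u v \<Longrightarrow> L v u"
    and two: "\<And>u. u \<in> X \<Longrightarrow> card {v. L u v} = 2" and X: "finite X"
    and closed: "\<And>u v. u \<in> Y \<Longrightarrow> L u v \<Longrightarrow> v \<in> Y" and Y: "Y \<subseteq> X" "X \<noteq> Y"
  shows "3 \<le> card (X - Y)" "card (X - Y) = 3 \<Longrightarrow>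
    \<exists>e f g. X - Y = {e, f, g} \<and> e \<noteq> f \<and> f \<noteq> g \<and> e \<noteq> g \<and> L e f \<and> L f g \<and> L e g"
proof -
  have nb: "{v. L u v} \<subseteq> X - Y - {u}" if "u \<in> X - Y" for u
    using that sub closed sym by blast
  obtain u where u: "u \<in> X - Y" using Y by blast
  have fin: "finite (X - Y - {u})" using X by simp
  have "2 \<le> card (X - Y - {u})" using card_mono[OF fin nb[OF u]] two u by simp
  then show "3 \<le> card (X - Y)" using u X by simp
  assume "card (X - Y) = 3"
  have all: "L u v" if "u \<in> X - Y" "v \<in> X - Y" "u \<noteq> v" for u v
  proof -
    have "card (X - Y - {u}) = 2" using \<open>card (X - Y) = 3\<close> that(1) X by simp
    then have "{v. L u v} = X - Y - {u}"
      using X nb[OF that(1)] two[of u] that(1) by (intro card_subset_eq) auto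
    then show ?thesis using that by blast
  qed
  obtain e f g where efg: "X - Y = {e, f, g}" "e \<noteq> f" "f \<noteq> g" "e \<noteq> g"
    using \<open>card (X - Y) = 3\<close> unfolding card_3_iff by blast
  have "e \<in> X - Y" "f \<in> X - Y" "g \<in> X - Y" using efg(1) by blast+
  then have "L e f" "L f g" "L e g" using all efg by blast+
  then show "\<exists>e f g. X - Y = {e, f, g} \<and> e \<noteq> f \<and> f \<noteq> g \<and> e \<noteq> g \<and> L e f \<and> L f g \<and> L e g"
    using efg by blast
qed

text \<open>Follow the path \<open>b c d e f\<close> away from \<open>b\<close> until it meets
  \<open>h\<close>, the other neighbour of \<open>b\<close>, and closes up. Closing after three
  vertices leaves a triangle, after four it would leave one or two vertices, which is
  impossible.\<close>

lemma two_regular_cases: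
  assumes sub: "\<And>u v. u \<in> X \<Longrightarrow> L u v \<Longrightarrow> v \<in> X \<and> v \<noteq> u" and sym: "\<And>u v. L u v \<Longrightarrow> L v u"
    and two: "\<And>u. u \<in> X \<Longrightarrow> card {v. L u v} = 2" and X: "finite X" "card X = 5 \<or> card X = 6"
  obtains
    (pentagon) b c d e f where "distinct [b, c, d, e, f]" "X = {b, c, d, e, f}"
      "L b c" "L c d" "L d e" "L e f" "L b f"
  | (hexagon) b c d e f g where "distinct [b, c, d, e, f, g]" "X = {b, c, d, e, f, g}"
      "L b c" "L c d" "L d e" "L e f" "L f g" "L b g"
  | (triangles) b c d e f g where "distinct [b, c, d, e, f, g]" "X = {b, c, d, e, f, g}"
      "L b c" "L c d" "L b d" "L e f" "L f g" "L e g"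
proof -
  have rem1: "3 \<le> card (X - Y)" if "\<forall>u\<in>Y. \<forall>v. L u v \<longrightarrow> v \<in> Y" "Y \<subseteq> X" "X \<noteq> Y" for Y
    by (rule two_regular_remainder(1)[of X L]) (use sub sym two X(1) that in auto)
  have rem2: "\<exists>e f g. X - Y = {e, f, g} \<and> e \<noteq> f \<and> f \<noteq> g \<and> e \<noteq> g \<and> L e f \<and> L f g \<and> L e g"
    if "\<forall>u\<in>Y. \<forall>v. L u v \<longrightarrow> v \<in> Y" "Y \<subseteq> X" "X \<noteq> Y" "card (X - Y) = 3" for Y
    by (rule two_regular_remainder(2)[of X L]) (use sub sym two X(1) that in auto)
  obtain b where b: "b \<in> X" using X(2) by fastforce
  then have "{v. L b v} \<noteq> {}" using two[OF b] by (metis card.empty zero_neq_numeral)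
  then obtain c where bc: "L b c" by blast
  obtain h where h: "h \<noteq> c" "\<And>v. L b v \<longleftrightarrow> v = c \<or> v = h"
    using two_regular_next[where L = L, OF two[OF b] bc] by blast
  have c: "c \<in> X" "c \<noteq> b" and hX: "h \<in> X" "h \<noteq> b" using sub[OF b, of c] sub[OF b, of h] h(2) by auto
  obtain d where d: "d \<noteq> b" "\<And>v. L c v \<longleftrightarrow> v = b \<or> v = d"
    using two_regular_next[where L = L, OF two[OF c(1)] sym[OF bc]] by blast
  have dX: "d \<in> X" "d \<noteq> c" using sub[OF c(1), of d] d(2) by auto
  have bh: "L b h" "L h b" using h(2) sym by blast+
  have cd: "L c d" "L d c" using d(2) sym by blast+
  show thesis
  proof (cases "d = h")
    case True
    have dd: "L d v \<longleftrightarrow> v = b \<or> v = c" for v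
    proof -
      obtain q where "\<And>v. L d v \<longleftrightarrow> v = b \<or> v = q"
        using two_regular_next[where L = L, OF two[OF dX(1)]] bh True by metis
      then show ?thesis using cd(2) c(2) by metis
    qed
    let ?Y = "{b, c, d}"
    have "card ?Y \<noteq> card X" using X(2) c(2) d(1) dX(2) by auto
    then have Y: "?Y \<subseteq> X" "X \<noteq> ?Y" using b c dX by blast+
    have cl: "\<forall>u\<in>?Y. \<forall>v. L u v \<longrightarrow> v \<in> ?Y" using h(2) d(2) dd True by auto
    have "card (X - ?Y) = card X - 3" using Y(1) c(2) d(1) dX(2) by (subst card_Diff_subset) auto
    then have "card X = 6" "card (X - ?Y) = 3" using rem1[OF cl Y] X(2) by auto
    then obtain e f g where efg: "X - ?Y = {e, f, g}" "e \<noteq> f" "f \<noteq> g" "e \<noteq> g" "L e f" "L f g" "L e g"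
      using rem2[OF cl Y] by blast
    have "X = {b, c, d, e, f, g}" using efg(1) Y(1) by blast
    moreover have "e \<notin> ?Y" "f \<notin> ?Y" "g \<notin> ?Y" using efg(1) by blast+
    then have "distinct [b, c, d, e, f, g]" using efg c(2) d(1) dX(2) by auto
    ultimately show thesis using triangles[of b c d e f g] bc cd bh True efg by blast
  next
    case dh: False
    obtain e where e: "e \<noteq> c" "\<And>v. L d v \<longleftrightarrow> v = c \<or> v = e"
      using two_regular_next[where L = L, OF two[OF dX(1)] cd(2)] by blast
    have eX: "e \<in> X" "e \<noteq> d" using sub[OF dX(1), of e] e(2) by auto
    have de: "L d e" "L e d" using e(2) sym by blast+
    have eb: "e \<noteq> b" using de h(2)[of d] dh dX(2) by auto
    show thesis
    proof (cases "e = h")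
      case True
      have ee: "L e v \<longleftrightarrow> v = d \<or> v = b" for v
      proof -
        obtain q where "\<And>v. L e v \<longleftrightarrow> v = d \<or> v = q"
          using two_regular_next[where L = L, OF two[OF eX(1)] de(2)] by blast
        then show ?thesis using bh True d(1) by metis
      qed
      let ?Y = "{b, c, d, e}"
      have "card ?Y \<noteq> card X" using X(2) c(2) d(1) dX(2) e(1) eX(2) eb by auto
      then have Y: "?Y \<subseteq> X" "X \<noteq> ?Y" using b c dX eX by blast+
      have cl: "\<forall>u\<in>?Y. \<forall>v. L u v \<longrightarrow> v \<in> ?Y" using h(2) d(2) e(2) ee True by auto
      have "card (X - ?Y) = card X - 4" using Y(1) c(2) d(1) dX(2) e(1) eX(2) eb by (subst card_Diff_subset) auto
      then show thesis using rem1[OF cl Y] X(2) by auto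
    next
      case eh: False
      obtain f where f: "f \<noteq> d" "\<And>v. L e v \<longleftrightarrow> v = d \<or> v = f"
        using two_regular_next[where L = L, OF two[OF eX(1)] de(2)] by blast
      have fX: "f \<in> X" "f \<noteq> e" using sub[OF eX(1), of f] f(2) by auto
      have ef: "L e f" "L f e" using f(2) sym by blast+
      have fb: "f \<noteq> b" using ef h(2)[of e] eh e(1) by auto
      have fc: "f \<noteq> c" using ef d(2)[of e] eb eX(2) by auto
      show thesis
      proof (cases "f = h")
        case True
        have ff: "L f v \<longleftrightarrow> v = e \<or> v = b" for v
        proof -
          obtain q where "\<And>v. L f v \<longleftrightarrow> v = e \<or> v = q"
            using two_regular_next[where L = L, OF two[OF fX(1)] ef(2)] by blast
          then show ?thesis using bh True eb by metis
        qed
        let ?Y = "{b, c, d, e, f}"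
        have Y: "?Y \<subseteq> X" using b c dX eX fX by auto
        have dist: "distinct [b, c, d, e, f]" using c(2) d(1) dX(2) e(1) eX(2) eb f(1) fX(2) fb fc by auto
        have cl: "\<forall>u\<in>?Y. \<forall>v. L u v \<longrightarrow> v \<in> ?Y" using h(2) d(2) e(2) f(2) ff True by auto
        have "card (X - ?Y) = card X - 5" using Y dist by (subst card_Diff_subset) auto
        have "X = ?Y"
        proof (rule ccontr)
          assume "X \<noteq> ?Y"
          from rem1[OF cl Y this] show False using \<open>card (X - ?Y) = card X - 5\<close> X(2) by linarith
        qed
        then show thesis using pentagon[of b c d e f] dist bc cd de ef bh True by blast
      next
        case fh: False
        have dist: "distinct [b, c, d, e, f, h]"
          using c(2) d(1) dX(2) e(1) eX(2) eb f(1) fX(2) fb fc h(1) hX(2) dh eh fh by auto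
        have Y: "{b, c, d, e, f, h} \<subseteq> X" using b c dX eX fX hX by auto
        have "card {b, c, d, e, f, h} = 6" using dist by simp
        then have XY: "{b, c, d, e, f, h} = X"
          using card_mono[OF X(1) Y] X by (intro card_subset_eq Y) auto
        obtain g where g: "g \<noteq> e" "\<And>v. L f v \<longleftrightarrow> v = e \<or> v = g"
          using two_regular_next[where L = L, OF two[OF fX(1)] ef(2)] by blast
        have "L f g" "L g f" using g(2) sym by blast+
        then have "g \<in> X" "g \<noteq> f" using sub[OF fX(1), of g] by auto
        moreover have "g \<noteq> b" using \<open>L g f\<close> h(2)[of f] fc fh by auto
        moreover have "g \<noteq> c" using \<open>L g f\<close> d(2)[of f] fb f(1) by auto
        moreover have "g \<noteq> d" using \<open>L g f\<close> e(2)[of f] fc fX(2) by auto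
        ultimately have "g = h" using g(1) XY by blast
        then show thesis using hexagon[of b c d e f h] dist XY bc cd de ef bh \<open>L f g\<close> by blast
      qed
    qed
  qed
qed

text \<open>One step of a unary counter, with the bounds \<open>s \<ge> j\<close> and
  \<open>n \<ge> j\<close> as atoms for \<open>sat\<close>. Bounds up to 4 suffice since the total
  defect is at most 3, and \<open>n\<close> stops at 3 because a pair lies in at most five
  triples.\<close>

lemma counter_step:
  fixes s s' n :: nat
  assumes "s' = s + n"
  shows "(s \<ge> 1 \<longrightarrow> s' \<ge> 1) \<and> (s \<ge> 2 \<longrightarrow> s' \<ge> 2) \<and> (s \<ge> 3 \<longrightarrow> s' \<ge> 3) \<and> (s \<ge> 4 \<longrightarrow> s' \<ge> 4) \<and>
    (n \<ge> 1 \<longrightarrow> s' \<ge> 1) \<and> (s \<ge> 1 \<and> n \<ge> 1 \<longrightarrow> s' \<ge> 2) \<and> (s \<ge> 2 \<and> n \<ge> 1 \<longrightarrow> s' \<ge> 3) \<and> (s \<ge> 3 \<and> n \<ge> 1 \<longrightarrow> s' \<ge> 4) \<and>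
    (n \<ge> 2 \<longrightarrow> s' \<ge> 2) \<and> (s \<ge> 1 \<and> n \<ge> 2 \<longrightarrow> s' \<ge> 3) \<and> (s \<ge> 2 \<and> n \<ge> 2 \<longrightarrow> s' \<ge> 4) \<and>
    (n \<ge> 3 \<longrightarrow> s' \<ge> 3) \<and> (s \<ge> 1 \<and> n \<ge> 3 \<longrightarrow> s' \<ge> 4)"
  using assms by auto

lemma two_of_four:
  assumes "of_bool p1 + of_bool p2 + of_bool p3 + of_bool p4 = (2 :: nat)"
  shows "(p1 \<or> p2 \<or> p3) \<and> (p1 \<or> p2 \<or> p4) \<and> (p1 \<or> p3 \<or> p4) \<and> (p2 \<or> p3 \<or> p4) \<and>
    \<not> (p1 \<and> p2 \<and> p3) \<and> \<not> (p1 \<and> p2 \<and> p4) \<and> \<not> (p1 \<and> p3 \<and> p4) \<and> \<not> (p2 \<and> p3 \<and> p4)"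
  using assms by (cases p1; cases p2; cases p3; cases p4) simp_all

section \<open>Exhaustive search over the three shapes of the link\<close>

context triple_core
begin

lemma hexagon_rotate: "hexagon a b c d e f g \<Longrightarrow> hexagon a c d e f g b"
  by (auto simp: hexagon_def insert_commute)

lemma hexagon_reflect: "hexagon a b c d e f g \<Longrightarrow> hexagon a b g f e d c"
  by (auto simp: hexagon_def insert_commute)

lemma two_triangles_rotate: "two_triangles a b c d e f g \<Longrightarrow> two_triangles a c d b e f g"
  by (auto simp: two_triangles_def insert_commute)

lemma two_triangles_reflect: "two_triangles a b c d e f g \<Longrightarrow> two_triangles a c b d e f g"
  by (auto simp: two_triangles_def insert_commute)

lemma two_triangles_swap: "two_triangles a b c d e f g \<Longrightarrow> two_triangles a e f g b c d"
  by (auto simp: two_triangles_def insert_commute)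

text \<open>Clausal form of what \<open>cnt {x, y} \<noteq> 1\<close> and the value of \<open>defect {x, y}\<close> say about the five
  triples through the pair; the method \<open>sat\<close> treats the bounds on the defect as atoms.\<close>

definition pair_ok :: "'v \<Rightarrow> 'v \<Rightarrow> 'v \<Rightarrow> 'v \<Rightarrow> 'v \<Rightarrow> 'v \<Rightarrow> 'v \<Rightarrow> bool" where
  "pair_ok x y z1 z2 z3 z4 z5 \<longleftrightarrow>
     (let p1 = {x, y, z1} \<in> S; p2 = {x, y, z2} \<in> S; p3 = {x, y, z3} \<in> S; p4 = {x, y, z4} \<in> S;
        p5 = {x, y, z5} \<in> S; n = defect {x, y}
      in (p1 \<longrightarrow> p2 \<or> p3 \<or> p4 \<or> p5) \<and> (p2 \<longrightarrow> p1 \<or> p3 \<or> p4 \<or> p5) \<and> (p3 \<longrightarrow> p1 \<or> p2 \<or> p4 \<or> p5) \<and>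
        (p4 \<longrightarrow> p1 \<or> p2 \<or> p3 \<or> p5) \<and> (p5 \<longrightarrow> p1 \<or> p2 \<or> p3 \<or> p4) \<and>
        (p1 \<or> p2 \<or> p3 \<or> p4 \<or> p5 \<or> n \<ge> 1) \<and>
        (p1 \<and> p2 \<and> p3 \<longrightarrow> n \<ge> 1) \<and> (p1 \<and> p2 \<and> p4 \<longrightarrow> n \<ge> 1) \<and> (p1 \<and> p2 \<and> p5 \<longrightarrow> n \<ge> 1) \<and>
        (p1 \<and> p3 \<and> p4 \<longrightarrow> n \<ge> 1) \<and> (p1 \<and> p3 \<and> p5 \<longrightarrow> n \<ge> 1) \<and> (p1 \<and> p4 \<and> p5 \<longrightarrow> n \<ge> 1) \<and>
        (p2 \<and> p3 \<and> p4 \<longrightarrow> n \<ge> 1) \<and> (p2 \<and> p3 \<and> p5 \<longrightarrow> n \<ge> 1) \<and> (p2 \<and> p4 \<and> p5 \<longrightarrow> n \<ge> 1) \<and>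
        (p3 \<and> p4 \<and> p5 \<longrightarrow> n \<ge> 1) \<and>
        (p1 \<and> p2 \<and> p3 \<and> p4 \<longrightarrow> n \<ge> 2) \<and> (p1 \<and> p2 \<and> p3 \<and> p5 \<longrightarrow> n \<ge> 2) \<and>
        (p1 \<and> p2 \<and> p4 \<and> p5 \<longrightarrow> n \<ge> 2) \<and> (p1 \<and> p3 \<and> p4 \<and> p5 \<longrightarrow> n \<ge> 2) \<and>
        (p2 \<and> p3 \<and> p4 \<and> p5 \<longrightarrow> n \<ge> 2) \<and> (p1 \<and> p2 \<and> p3 \<and> p4 \<and> p5 \<longrightarrow> n \<ge> 3))"

lemma pair_okI:
  assumes dist: "distinct [x, y, z1, z2, z3, z4, z5]" and U: "U = {x, y, z1, z2, z3, z4, z5}"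
  shows "pair_ok x y z1 z2 z3 z4 z5"
proof -
  have ne: "x \<noteq> y" using dist by simp
  have "cnt {x, y} = (\<Sum>z\<in>{z1, z2, z3, z4, z5}. of_bool ({x, y, z} \<in> S))"
    using dist U by (intro cnt_sum) auto
  then have c: "cnt {x, y} = of_bool ({x, y, z1} \<in> S) + (of_bool ({x, y, z2} \<in> S) +
    (of_bool ({x, y, z3} \<in> S) + (of_bool ({x, y, z4} \<in> S) + of_bool ({x, y, z5} \<in> S))))"
    using dist by simp
  have one: "cnt {x, y} \<noteq> 1" using cover[OF ne] by (simp add: cnt_def)
  show ?thesis
    using one unfolding pair_ok_def Let_def defect_def c
    by (cases "{x, y, z1} \<in> S"; cases "{x, y, z2} \<in> S"; cases "{x, y, z3} \<in> S"; cases "{x, y, z4} \<in> S";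
        cases "{x, y, z5} \<in> S") simp_all
qed

lemma link_only:
  assumes "cnt {a, x} = 2" "a \<noteq> x" "{a, x, y} \<in> S" "{a, x, z} \<in> S" "y \<noteq> z" "w \<noteq> y" "w \<noteq> z"
  shows "{a, x, w} \<notin> S"
proof
  assume "{a, x, w} \<in> S"
  then have "{y, z, w} \<subseteq> {v. {a, x, v} \<in> S}" using assms by blast
  moreover have "finite {v. {a, x, v} \<in> S}" using assms(1) cnt_card[OF assms(2)]
    by (metis card.infinite zero_neq_numeral)
  ultimately have "card {y, z, w} \<le> 2" using assms(1,2) cnt_card card_mono by metis
  then show False using assms(5-7) by simp
qed

text \<open>Makes the unknown position of \<open>C\<close> a finite disjunction of atoms, each of
  which implies membership in \<open>S\<close>.\<close>

lemma max_triple_cases: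
  assumes "U \<subseteq> set xs" "distinct xs"
  shows "\<exists>t\<in>set (filter (\<lambda>l. length l = 3) (subseqs xs)). C = set t"
    "\<forall>t\<in>set (filter (\<lambda>l. length l = 3) (subseqs xs)). C = set t \<longrightarrow> set t \<in> S"
proof -
  have "C \<in> Pow (set xs)" using C_in assms by (auto simp: U_def)
  then have "C \<in> set ` set (subseqs xs)" by (simp add: subseqs_powset)
  then obtain l where l: "l \<in> set (subseqs xs)" "C = set l" by blast
  then have "length l = 3"
    using S_3[OF C_in] distinct_card[OF subseqs_distinctD[OF l(1) assms(2)]] by simp
  then show "\<exists>t\<in>set (filter (\<lambda>l. length l = 3) (subseqs xs)). C = set t" using l by auto
  show "\<forall>t\<in>set (filter (\<lambda>l. length l = 3) (subseqs xs)). C = set t \<longrightarrow> set t \<in> S" using C_in by blast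
qed

lemma pair_constraints:
  assumes dist: "distinct [a, b, c, d, e, f, g]" and U: "U = {a, b, c, d, e, f, g}"
  shows "pair_ok b c a d e f g" "pair_ok b d a c e f g" "pair_ok b e a c d f g"
    "pair_ok b f a c d e g" "pair_ok b g a c d e f" "pair_ok c d a b e f g"
    "pair_ok c e a b d f g" "pair_ok c f a b d e g" "pair_ok c g a b d e f"
    "pair_ok d e a b c f g" "pair_ok d f a b c e g" "pair_ok d g a b c e f"
    "pair_ok e f a b c d g" "pair_ok e g a b c d f" "pair_ok f g a b c d e"
  by (rule pair_okI, (use dist in force), (use U in force))+

text \<open>Prefix sums over the fifteen pairs that avoid \<open>a\<close>, the successive states of
  the counter in \<open>counter_step\<close>.\<close>

definition partial_defect :: "'v \<Rightarrow> 'v \<Rightarrow> 'v \<Rightarrow> 'v \<Rightarrow> 'v \<Rightarrow> 'v \<Rightarrow> nat \<Rightarrow> nat" where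
  "partial_defect b c d e f g k = (\<Sum>p\<leftarrow>take k
     [{b, c}, {b, d}, {b, e}, {b, f}, {b, g},
      {c, d}, {c, e}, {c, f}, {c, g}, {d, e}, {d, f}, {d, g},
      {e, f}, {e, g}, {f, g}]. defect p)"

lemma partial_defect_steps:
  fixes b c d e f g :: 'v
  defines "s \<equiv> partial_defect b c d e f g"
  shows "s 1 = s 0 + defect {b, c}" "s 2 = s 1 + defect {b, d}"
    "s 3 = s 2 + defect {b, e}" "s 4 = s 3 + defect {b, f}"
    "s 5 = s 4 + defect {b, g}" "s 6 = s 5 + defect {c, d}"
    "s 7 = s 6 + defect {c, e}" "s 8 = s 7 + defect {c, f}"
    "s 9 = s 8 + defect {c, g}" "s 10 = s 9 + defect {d, e}"
    "s 11 = s 10 + defect {d, f}" "s 12 = s 11 + defect {d, g}"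
    "s 13 = s 12 + defect {e, f}" "s 14 = s 13 + defect {e, g}"
    "s 15 = s 14 + defect {f, g}"
  by (simp_all add: s_def partial_defect_def)

lemma partial_defect_bounds:
  assumes dist: "distinct [a, b, c, d, e, f, g]" and U: "U = {a, b, c, d, e, f, g}"
    and le: "(\<Sum>e\<in>pairs U. defect e) \<le> 3"
  shows "\<not> partial_defect b c d e f g 0 \<ge> 1" "\<not> partial_defect b c d e f g 15 \<ge> 4"
proof -
  define es where "es = [{b, c}, {b, d}, {b, e}, {b, f}, {b, g},
      {c, d}, {c, e}, {c, f}, {c, g}, {d, e}, {d, f}, {d, g},
      {e, f}, {e, g}, {f, g}]"
  have "distinct es" using dist by (simp add: es_def doubleton_eq_iff)
  moreover have "set es \<subseteq> pairs U" using dist by (simp add: es_def U pairs_def)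
  ultimately have "(\<Sum>e\<leftarrow>es. defect e) \<le> (\<Sum>e\<in>pairs U. defect e)"
    using finite_U by (simp add: sum_list_distinct_conv_sum_set sum_mono2)
  then show "\<not> partial_defect b c d e f g 15 \<ge> 4" using le by (simp add: es_def partial_defect_def)
qed (simp add: partial_defect_def)

lemma no_hexagon:
  assumes hub: "hexagon a b c d e f g" and U: "U = {a, b, c, d, e, f, g}"
    and two: "\<forall>u\<in>U - {a}. cnt {a, u} = 2" and le: "(\<Sum>e\<in>pairs U. defect e) \<le> 3"
  shows False
proof -
  have dist: "distinct [a, b, c, d, e, f, g]" 
    and links: "{a, b, c} \<in> S" "{a, c, d} \<in> S" "{a, d, e} \<in> S" "{a, e, f} \<in> S" "{a, f, g} \<in> S" "{a, b, g} \<in> S"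
    using hub by (auto simp: hexagon_def)
  have nonlinks: "{a, b, d} \<notin> S" "{a, b, e} \<notin> S" "{a, b, f} \<notin> S" "{a, c, e} \<notin> S" "{a, c, f} \<notin> S"
    "{a, c, g} \<notin> S" "{a, d, f} \<notin> S" "{a, d, g} \<notin> S" "{a, e, g} \<notin> S"
    by (rule link_only[of a b c g] link_only[of a c b d] link_only[of a d c e] link_only[of a e d f];
        use two dist links in \<open>auto simp: U insert_commute\<close>)+
  have cases: "\<exists>t\<in>set (filter (\<lambda>l. length l = 3) (subseqs [a, b, c, d, e, f, g])). C = set t"
    "\<forall>t\<in>set (filter (\<lambda>l. length l = 3) (subseqs [a, b, c, d, e, f, g])). C = set t \<longrightarrow> set t \<in> S"
    by (rule max_triple_cases; use dist in \<open>simp add: U\<close>)+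
  \<comment> \<open>The twelve symmetries of the hexagon: every excluded configuration is used in
    each of its images.\<close>
  note r1 = hub hub[THEN hexagon_rotate]
  note r2 = r1 r1[THEN hexagon_rotate, THEN hexagon_rotate]
    r1[THEN hexagon_rotate, THEN hexagon_rotate, THEN hexagon_rotate, THEN hexagon_rotate]
  note hubs = r2 r2[THEN hexagon_reflect]
  note kills = hubs[THEN hexagon_1] hubs[THEN hexagon_2] hubs[THEN hexagon_3] hubs[THEN hexagon_4]
    hubs[THEN hexagon_5] hubs[THEN hexagon_6] hubs[THEN hexagon_7] hubs[THEN hexagon_8]
    hubs[THEN hexagon_9] hubs[THEN hexagon_10] hubs[THEN hexagon_11] hubs[THEN hexagon_12]
    hubs[THEN hexagon_13]
  show False
    using links nonlinks pair_constraints[OF dist U, unfolded pair_ok_def Let_def]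
      partial_defect_steps[of b c d e f g, THEN counter_step] partial_defect_bounds[OF dist U le] cases[simplified] kills
    \<comment> \<open>Ordered rewriting gives each triple one normal form, so that
      \<open>sat\<close> sees a single atom for it.\<close>
    apply (simp (no_asm_use) only: insert_commute)
    by sat
qed

lemma no_two_triangles:
  assumes hub: "two_triangles a b c d e f g" and U: "U = {a, b, c, d, e, f, g}"
    and two: "\<forall>u\<in>U - {a}. cnt {a, u} = 2" and le: "(\<Sum>e\<in>pairs U. defect e) \<le> 3"
  shows False
proof -
  have dist: "distinct [a, b, c, d, e, f, g]" 
    and links: "{a, b, c} \<in> S" "{a, c, d} \<in> S" "{a, b, d} \<in> S" "{a, e, f} \<in> S" "{a, f, g} \<in> S" "{a, e, g} \<in> S"
    using hub by (auto simp: two_triangles_def)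
  have nonlinks: "{a, b, e} \<notin> S" "{a, b, f} \<notin> S" "{a, b, g} \<notin> S" "{a, c, e} \<notin> S" "{a, c, f} \<notin> S"
    "{a, c, g} \<notin> S" "{a, d, e} \<notin> S" "{a, d, f} \<notin> S" "{a, d, g} \<notin> S"
    by (rule link_only[of a b c d] link_only[of a c b d] link_only[of a d c b];
        use two dist links in \<open>auto simp: U insert_commute\<close>)+
  have cases: "\<exists>t\<in>set (filter (\<lambda>l. length l = 3) (subseqs [a, b, c, d, e, f, g])). C = set t"
    "\<forall>t\<in>set (filter (\<lambda>l. length l = 3) (subseqs [a, b, c, d, e, f, g])). C = set t \<longrightarrow> set t \<in> S"
    by (rule max_triple_cases; use dist in \<open>simp add: U\<close>)+
  \<comment> \<open>The 72 symmetries: permutations of either triangle, and exchange of the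
    two.\<close>
  note r1 = hub hub[THEN two_triangles_rotate] hub[THEN two_triangles_rotate, THEN two_triangles_rotate]
  note r2 = r1 r1[THEN two_triangles_reflect]
  note r3 = r2[THEN two_triangles_swap]
  note r4 = r3 r3[THEN two_triangles_rotate] r3[THEN two_triangles_rotate, THEN two_triangles_rotate]
  note r5 = r4 r4[THEN two_triangles_reflect]
  note hubs = r5 r5[THEN two_triangles_swap]
  note kills = hubs[THEN two_triangles_1] hubs[THEN two_triangles_2] hubs[THEN two_triangles_3] hubs[THEN two_triangles_4]
  show False
    using links nonlinks pair_constraints[OF dist U, unfolded pair_ok_def Let_def]
      partial_defect_steps[of b c d e f g, THEN counter_step] partial_defect_bounds[OF dist U le] cases[simplified] kills
    apply (simp (no_asm_use) only: insert_commute)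
    by sat
qed

text \<open>With every pair in exactly two triples the link determines the five remaining ones, so a
  single configuration, without symmetric images, is enough.\<close>

lemma no_pentagon:
  assumes hub: "pentagon a b c d e f" and U: "U = {a, b, c, d, e, f}"
    and two: "\<And>x y. x \<in> U \<Longrightarrow> y \<in> U \<Longrightarrow> x \<noteq> y \<Longrightarrow> cnt {x, y} = 2"
  shows False
proof -
  have dist: "distinct [a, b, c, d, e, f]" 
    and links: "{a, b, c} \<in> S" "{a, c, d} \<in> S" "{a, d, e} \<in> S" "{a, e, f} \<in> S" "{a, b, f} \<in> S"
    using hub by (auto simp: pentagon_def)
  have pair: "of_bool ({x, y, z1} \<in> S) + of_bool ({x, y, z2} \<in> S) + of_bool ({x, y, z3} \<in> S) + of_bool ({x, y, z4} \<in> S)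
      = (2 :: nat)"
    if "U = {x, y, z1, z2, z3, z4}" "distinct [x, y, z1, z2, z3, z4]" for x y z1 z2 z3 z4
  proof -
    have "cnt {x, y} = (\<Sum>z\<in>{z1, z2, z3, z4}. of_bool ({x, y, z} \<in> S))"
      using that by (intro cnt_sum) auto
    also have "\<dots> = of_bool ({x, y, z1} \<in> S) + of_bool ({x, y, z2} \<in> S) + of_bool ({x, y, z3} \<in> S)
      + of_bool ({x, y, z4} \<in> S)"
      using that(2) by simp
    finally show ?thesis using two[of x y] that by simp
  qed
  have pairs: "of_bool ({a, b, c} \<in> S) + of_bool ({a, b, d} \<in> S) + of_bool ({a, b, e} \<in> S) + of_bool ({a, b, f} \<in> S) = (2 :: nat)"
    "of_bool ({a, c, b} \<in> S) + of_bool ({a, c, d} \<in> S) + of_bool ({a, c, e} \<in> S) + of_bool ({a, c, f} \<in> S) = (2 :: nat)"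
    "of_bool ({a, d, b} \<in> S) + of_bool ({a, d, c} \<in> S) + of_bool ({a, d, e} \<in> S) + of_bool ({a, d, f} \<in> S) = (2 :: nat)"
    "of_bool ({a, e, b} \<in> S) + of_bool ({a, e, c} \<in> S) + of_bool ({a, e, d} \<in> S) + of_bool ({a, e, f} \<in> S) = (2 :: nat)"
    "of_bool ({a, f, b} \<in> S) + of_bool ({a, f, c} \<in> S) + of_bool ({a, f, d} \<in> S) + of_bool ({a, f, e} \<in> S) = (2 :: nat)"
    "of_bool ({b, c, a} \<in> S) + of_bool ({b, c, d} \<in> S) + of_bool ({b, c, e} \<in> S) + of_bool ({b, c, f} \<in> S) = (2 :: nat)"
    "of_bool ({b, d, a} \<in> S) + of_bool ({b, d, c} \<in> S) + of_bool ({b, d, e} \<in> S) + of_bool ({b, d, f} \<in> S) = (2 :: nat)"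
    "of_bool ({b, e, a} \<in> S) + of_bool ({b, e, c} \<in> S) + of_bool ({b, e, d} \<in> S) + of_bool ({b, e, f} \<in> S) = (2 :: nat)"
    "of_bool ({b, f, a} \<in> S) + of_bool ({b, f, c} \<in> S) + of_bool ({b, f, d} \<in> S) + of_bool ({b, f, e} \<in> S) = (2 :: nat)"
    "of_bool ({c, d, a} \<in> S) + of_bool ({c, d, b} \<in> S) + of_bool ({c, d, e} \<in> S) + of_bool ({c, d, f} \<in> S) = (2 :: nat)"
    "of_bool ({c, e, a} \<in> S) + of_bool ({c, e, b} \<in> S) + of_bool ({c, e, d} \<in> S) + of_bool ({c, e, f} \<in> S) = (2 :: nat)"
    "of_bool ({c, f, a} \<in> S) + of_bool ({c, f, b} \<in> S) + of_bool ({c, f, d} \<in> S) + of_bool ({c, f, e} \<in> S) = (2 :: nat)"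
    "of_bool ({d, e, a} \<in> S) + of_bool ({d, e, b} \<in> S) + of_bool ({d, e, c} \<in> S) + of_bool ({d, e, f} \<in> S) = (2 :: nat)"
    "of_bool ({d, f, a} \<in> S) + of_bool ({d, f, b} \<in> S) + of_bool ({d, f, c} \<in> S) + of_bool ({d, f, e} \<in> S) = (2 :: nat)"
    "of_bool ({e, f, a} \<in> S) + of_bool ({e, f, b} \<in> S) + of_bool ({e, f, c} \<in> S) + of_bool ({e, f, d} \<in> S) = (2 :: nat)"
    by (rule pair, (use U in force), (use dist in force))+
  have cases: "\<exists>t\<in>set (filter (\<lambda>l. length l = 3) (subseqs [a, b, c, d, e, f])). C = set t"
    "\<forall>t\<in>set (filter (\<lambda>l. length l = 3) (subseqs [a, b, c, d, e, f])). C = set t \<longrightarrow> set t \<in> S"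
    by (rule max_triple_cases; use dist in \<open>simp add: U\<close>)+
  show False
    using links pairs[THEN two_of_four] cases[simplified] pentagon_1[OF hub]
    apply (simp (no_asm_use) only: insert_commute)
    by sat
qed

text \<open>So a family satisfying the other assumptions of the locale violates \<open>cover\<close>: some pair lies
  in exactly one of its triples.\<close>

theorem core_contradiction: False
proof -
  obtain a where a: "a \<in> U" "\<forall>u\<in>U - {a}. cnt {a, u} = 2" using regular_vertex by blast
  define L where "L u v \<longleftrightarrow> {a, u, v} \<in> S" for u v
  have L_iff: "L u v \<longleftrightarrow> {a, u, v} \<in> S" for u v by (simp add: L_def)
  have sub: "v \<in> U - {a} \<and> v \<noteq> u" if "L u v" for u v
  proof -
    have "v \<in> U" using that unfolding L_def U_def by blast
    then show ?thesis using S_triple[of a u v] that by (auto simp: L_def)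
  qed
  have sym: "L v u" if "L u v" for u v using that by (simp add: L_def insert_commute)
  have two: "card {v. L u v} = 2" if "u \<in> U - {a}" for u
    using a(2) that cnt_card[of a u] by (auto simp: L_def)
  have card: "card (U - {a}) = 5 \<or> card (U - {a}) = 6" using card_U_cases a(1) finite_U by auto
  have le: "(\<Sum>e\<in>pairs U. defect e) \<le> 3" using card_U_cases by auto
  have U_eq: "U = insert a X" if "U - {a} = X" for X using a(1) that by blast
  have notin: "a \<notin> X" if "U - {a} = X" for X using that by blast
  have fin: "finite (U - {a})" using finite_U by simp
  show False
  proof (rule two_regular_cases[of "U - {a}" L, OF _ sym two fin card])
    show "v \<in> U - {a} \<and> v \<noteq> u" if "u \<in> U - {a}" "L u v" for u v using sub that by blast
  next
    fix b c d e f
    assume *: "distinct [b, c, d, e, f]" "U - {a} = {b, c, d, e, f}" "L b c" "L c d" "L d e" "L e f" "L b f"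
    have hub: "pentagon a b c d e f"
      using *(1,3-) notin[OF *(2)] by (auto simp: pentagon_def L_iff)
    have "card (U - {a}) = 5" unfolding *(2) using *(1) by simp
    then have "(\<Sum>e\<in>pairs U. defect e) = 0" using card_U_cases a(1) finite_U by auto
    then have "defect e = 0" if "e \<in> pairs U" for e using that finite_U by simp
    note no_defect = this
    have "cnt {x, y} = 2" if "x \<in> U" "y \<in> U" "x \<noteq> y" for x y
    proof -
      have e: "{x, y} \<in> pairs U" using that by (simp add: pairs_def)
      have "cnt {x, y} \<noteq> 0" "cnt {x, y} - 2 = 0"
        using no_defect[OF e] by (auto simp: defect_def split: if_splits)
      then show ?thesis using cnt_ge_2[OF e] by linarith
    qed
    then show False by (rule no_pentagon[OF hub U_eq[OF *(2)]])
  next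
    fix b c d e f g
    assume *: "distinct [b, c, d, e, f, g]" "U - {a} = {b, c, d, e, f, g}"
      "L b c" "L c d" "L d e" "L e f" "L f g" "L b g"
    have "hexagon a b c d e f g"
      using *(1,3-) notin[OF *(2)] by (auto simp: hexagon_def L_iff)
    then show False by (rule no_hexagon[OF _ U_eq[OF *(2)] a(2) le])
  next
    fix b c d e f g
    assume *: "distinct [b, c, d, e, f, g]" "U - {a} = {b, c, d, e, f, g}"
      "L b c" "L c d" "L b d" "L e f" "L f g" "L e g"
    have "two_triangles a b c d e f g"
      using *(1,3-) notin[OF *(2)] by (auto simp: two_triangles_def L_iff)
    then show False by (rule no_two_triangles[OF _ U_eq[OF *(2)] a(2) le])
  qed
qed

end

section \<open>Saturation for triples below a threshold\<close>

context edge_vectors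
begin

text \<open>By \<open>collapsible_saturated\<close> only parts of the greedy basis without a pair
  seen exactly once are in the way, and such a part with its heaviest member would satisfy
  \<open>triple_core\<close>. Since \<open>d\<close> may have ties, the greedy basis is taken for a
  perturbed weight.\<close>

lemma triples_saturated:
  assumes card_V: "card V \<le> 7" and d: "\<And>e. e \<in> pairs V \<Longrightarrow> 0 \<le> d e"
    and y: "y \<in> vec.span (tri ` {t\<in>triples. pair_weight d t < M})" "\<And>e. y e \<in> \<int>"
  shows "y \<in> zspan (tri ` {t\<in>triples. pair_weight d t < M})"
proof -
  let ?T = "{t\<in>triples. pair_weight d t < M}"
  have fin_pairs: "finite (pairs V)" using finV by simp
  obtain w :: "'v set \<Rightarrow> real" where "(\<forall>e\<in>pairs V. 0 < w e) \<and>
    (\<forall>A\<subseteq>pairs V. \<forall>B\<subseteq>pairs V. sum d A < sum d B \<longrightarrow> sum w A < sum w B) \<and>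
    (\<forall>A\<subseteq>pairs V. \<forall>B\<subseteq>pairs V. sum w A = sum w B \<longrightarrow> A = B)"
    using perturbation[OF fin_pairs d] by (rule exE)
  then have w: "\<And>A B. A \<subseteq> pairs V \<Longrightarrow> B \<subseteq> pairs V \<Longrightarrow> sum d A < sum d B \<Longrightarrow> sum w A < sum w B"
    "\<And>A B. A \<subseteq> pairs V \<Longrightarrow> B \<subseteq> pairs V \<Longrightarrow> sum w A = sum w B \<Longrightarrow> A = B" by simp_all
  let ?W = "pair_weight w"
  have sub: "pairs t \<subseteq> pairs V" if "t \<in> triples" for t
    using that by (auto simp: triples_def pairs_def)
  have W_inj: "inj_on ?W triples"
  proof (rule inj_onI)
    fix s t assume *: "s \<in> triples" "t \<in> triples" "?W s = ?W t"
    then have "pairs s = pairs t" using w(2)[OF sub sub] by (simp add: pair_weight_def)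
    moreover have "\<Union> (pairs u) = u" if u: "u \<in> triples" for u
    proof -
      obtain x y z where "u = {x, y, z}" "x \<noteq> y" "y \<noteq> z" "x \<noteq> z"
        using u unfolding triples_def card_3_iff by blast
      then show ?thesis by (auto simp: pairs_triple)
    qed
    ultimately show "s = t" using * by metis
  qed
  \<comment> \<open>The family below \<open>M\<close> is a lower set for the perturbed weight too,
    so rejection within \<open>?T\<close> agrees with the condition \<open>C_new\<close>, which
    speaks about all triples.\<close>
  have down: "t \<in> ?T" if "t \<in> triples" "s \<in> ?T" "?W t < ?W s" for s t
  proof -
    have "\<not> pair_weight d s < pair_weight d t"
      using w(1)[OF sub sub, of s t] that by (auto simp: pair_weight_def)
    then show ?thesis using that by auto
  qed
  define B where "B = {t\<in>?T. tri t \<notin> vec.span (tri ` {s\<in>?T. ?W s < ?W t})}"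
  have finT: "finite ?T" using finite_triples by simp
  have "?T \<subseteq> triples" by blast
  note greedy = greedy_basis[where v = tri, OF finT inj_on_subset[OF W_inj this], folded B_def]
  have inj: "inj_on tri B" and indep: "vec.independent (tri ` B)" using greedy(1,2) by auto
  have BT: "B \<subseteq> ?T" by (auto simp: B_def)
  have "tri ` ?T \<subseteq> vec.span (tri ` B)"
  proof
    fix x assume "x \<in> tri ` ?T"
    then obtain t where "t \<in> ?T" "x = tri t" by blast
    then have "x \<in> vec.span (tri ` {b\<in>B. ?W b \<le> ?W t})" using greedy(3) by auto
    moreover have "tri ` {b\<in>B. ?W b \<le> ?W t} \<subseteq> tri ` B" by blast
    ultimately show "x \<in> vec.span (tri ` B)" using vec.span_mono by blast
  qed
  then have y_span: "y \<in> vec.span (tri ` B)"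
    using y(1) vec.span_minimal[OF _ vec.subspace_span] by blast
  have "y \<in> zspan (tri ` B)"
  proof (rule collapsible_saturated)
    show "finite (tri ` B)" using finite_subset[OF BT finT] by simp
    show "b e \<in> \<int>" if "b \<in> tri ` B" for b e using that BT tri_Ints by blast
    fix S' assume S': "S' \<subseteq> tri ` B" "S' \<noteq> {}"
    define S where "S = {t\<in>B. tri t \<in> S'}"
    have SB: "S \<subseteq> B" and S'_eq: "S' = tri ` S" using S'(1) by (auto simp: S_def)
    have St: "S \<subseteq> triples" using SB BT by blast
    have finS: "finite S" using finite_subset[OF St finite_triples] .
    have "\<exists>x y. x \<noteq> y \<and> card {t\<in>S. {x, y} \<subseteq> t} = 1"
    proof (rule ccontr)
      assume "\<not> ?thesis"
      then have cover: "\<And>x y. x \<noteq> y \<Longrightarrow> card {t\<in>S. {x, y} \<subseteq> t} \<noteq> 1" by blast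
      have "S \<noteq> {}" using S'(2) S'_eq by blast
      then obtain C where C: "C \<in> S" "\<And>s. s \<in> S \<Longrightarrow> ?W s \<le> ?W C" using ex_max_on[OF finS] by blast
      have "{t\<in>triples. ?W t < ?W C} = {t\<in>?T. ?W t < ?W C}"
        using down[of _ C] C(1) SB BT by blast
      then have new: "tri C \<notin> vec.span (tri ` {t\<in>triples. ?W t < ?W C})"
        using C(1) SB by (auto simp: B_def)
      have "triple_core V ev S w C"
        by unfold_locales
          (use card_V St cover W_inj C new vec.independent_mono[OF indep image_mono[OF SB]]
            inj_on_subset[OF inj SB] in auto)
      then show False by (rule triple_core.core_contradiction)
    qed
    then obtain x y where xy: "x \<noteq> y" "card {t\<in>S. {x, y} \<subseteq> t} = 1" by blast
    then obtain t where t: "{t\<in>S. {x, y} \<subseteq> t} = {t}" by (auto simp: card_1_singleton_iff)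
    then have tS: "t \<in> S" "x \<in> t" "y \<in> t" by auto
    have "card t = 3" "t \<subseteq> V" using tS(1) St by (auto simp: triples_def)
    then obtain z where z: "t = {x, y, z}" "z \<noteq> x" "z \<noteq> y" using card_3E tS(2,3) xy(1) by metis
    have "\<bar>tri t {x, y}\<bar> = 1"
      using tri_apply[of x y z] z xy(1) \<open>t \<subseteq> V\<close> by auto
    moreover have "b {x, y} = 0" if b: "b \<in> S' - {tri t}" for b
    proof -
      obtain s where s: "s \<in> S" "b = tri s" "s \<noteq> t" using b S'_eq by blast
      then have "\<not> {x, y} \<subseteq> s" using t by blast
      then show ?thesis using tri_eq_0 s St by blast
    qed
    ultimately show "\<exists>e. \<exists>b\<in>S'. \<bar>b e\<bar> = 1 \<and> (\<forall>b'\<in>S' - {b}. b' e = 0)"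
      using tS(1) S'_eq by blast
  qed (use y_span y in auto)
  then show ?thesis using zspan_mono[OF image_mono[OF BT]] by blast
qed

end

subsection \<open>Walks in complete graphs\<close>

text \<open>The signed unit vector of a step from \<open>u\<close> to \<open>v\<close>. It is zero
  for \<open>u = v\<close>, so that walks may contain constant steps.\<close>

definition arc_flow :: "('v, 'v set) pre_digraph \<Rightarrow> 'v \<Rightarrow> 'v \<Rightarrow> 'v set \<Rightarrow> real" where
  "arc_flow D u v e = (if u \<noteq> v \<and> e = {u, v}
     then if tail D e = u then 1 else if tail D e = v then - 1 else 0 else 0)"

text \<open>Polymorphic, so that the same splitting lemmas apply to the length of a walk and to its
  flow vector.\<close>

fun wsum :: "('v \<Rightarrow> 'v \<Rightarrow> 'a :: comm_monoid_add) \<Rightarrow> 'v list \<Rightarrow> 'a" where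
  "wsum f (x # y # zs) = f x y + wsum f (y # zs)"
| "wsum f _ = 0"

lemma wsum_append: "wsum f (xs @ y # ys) = wsum f (xs @ [y]) + wsum f (y # ys)"
proof (induction xs)
  case (Cons x xs)
  then show ?case by (cases xs) (simp_all add: add.assoc)
qed simp

lemma wsum_conv_sum: "wsum f xs = (\<Sum>i<length xs - 1. f (xs ! i) (xs ! Suc i))"
proof (induction f xs rule: wsum.induct)
  case (1 f x y zs)
  then show ?case by (simp add: sum.lessThan_Suc_shift del: sum.lessThan_Suc)
qed auto

lemma wsum_closed_conv_sum:
  assumes "vs \<noteq> []"
  shows "wsum f (vs @ [hd vs]) = (\<Sum>i<length vs. f (vs ! i) (vs ! (Suc i mod length vs)))"
proof -
  have "(vs @ [hd vs]) ! i = vs ! i \<and> (vs @ [hd vs]) ! Suc i = vs ! (Suc i mod length vs)"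
    if "i < length vs" for i
  proof (cases "Suc i = length vs")
    case True
    then show ?thesis using that assms by (simp add: nth_append hd_conv_nth)
  next
    case False
    then show ?thesis using that by (simp add: nth_append)
  qed
  then show ?thesis by (simp add: wsum_conv_sum)
qed

lemma wsum_rev:
  assumes "\<And>u v. f v u = g u v"
  shows "wsum f (rev xs) = wsum g xs"
proof (induction xs)
  case (Cons x xs)
  then show ?case
  proof (cases xs)
    case (Cons y ys)
    then show ?thesis using Cons.IH wsum_append[of f "rev ys" y "[x]"] assms[of y x] by (simp add: add.commute)
  qed simp
qed simp

lemma wsum_neg: "wsum (\<lambda>u v. - f u v :: 'a :: ab_group_add) xs = - wsum f xs"
  by (induction f xs rule: wsum.induct) auto

lemma wsum_split:
  fixes f :: "'v \<Rightarrow> 'v \<Rightarrow> 'a :: comm_monoid_add"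
  shows "wsum f (p @ y # q @ y # r) = wsum f (p @ y # r) + wsum f (y # q @ [y])"
proof -
  have "wsum f (p @ y # q @ y # r) = wsum f (p @ [y]) + (wsum f ((y # q) @ [y]) + wsum f (y # r))"
    using wsum_append[of f p y "q @ y # r"] wsum_append[of f "y # q" y r] by simp
  then show ?thesis using wsum_append[of f p y r] by (simp add: add.assoc add.commute add.left_commute)
qed

locale complete_digraph =
  fixes V :: "'v set" and D :: "('v, 'v set) pre_digraph"
  assumes finV: "finite V" and verts_D: "verts D = V" and arcs_D: "arcs D = pairs V"
    and ends: "\<And>e. e \<in> pairs V \<Longrightarrow> {tail D e, head D e} = e"
begin

abbreviation a :: "'v \<Rightarrow> 'v \<Rightarrow> 'v set \<Rightarrow> real" where "a \<equiv> arc_flow D"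

lemma a_anti: "a v u = - a u v"
proof
  fix e
  show "a v u e = (- a u v) e"
    by (simp add: arc_flow_def insert_commute)
qed

lemma pair_in: "u \<in> V \<Longrightarrow> v \<in> V \<Longrightarrow> u \<noteq> v \<Longrightarrow> {u, v} \<in> pairs V"
  by (simp add: pairs_def)

lemma a_unit: assumes "u \<in> V" "v \<in> V" "u \<noteq> v" shows "\<bar>a u v {u, v}\<bar> = 1"
proof -
  have "tail D {u, v} \<in> {u, v}" using ends[OF pair_in[OF assms]] by blast
  then show ?thesis using assms(3) by (auto simp: arc_flow_def)
qed

lemma edge_vectors: "edge_vectors V a"
proof
  show "a v u = - a u v" for u v by (rule a_anti)
  show "a u v e = 0" if "e \<noteq> {u, v}" for u v e using that by (simp add: arc_flow_def)
qed (rule finV, rule a_unit)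

sublocale edge_vectors V a by (rule edge_vectors)

lemma ends_V: assumes "e \<in> pairs V"
  shows "tail D e \<in> V" "head D e \<in> V" "tail D e \<noteq> head D e"
proof -
  have *: "{tail D e, head D e} = e" "e \<subseteq> V" "card e = 2" using assms ends by (auto simp: pairs_def)
  then show "tail D e \<in> V" "head D e \<in> V" by blast+
  show "tail D e \<noteq> head D e" 
  proof
    assume "tail D e = head D e"
    then have "e = {head D e}" using *(1) by simp
    then have "card e = 1" by (metis card_1_singleton_iff One_nat_def)
    then show False using *(3) by simp
  qed
qed

lemma a_ends: assumes "e \<in> pairs V" shows "a (tail D e) (head D e) e' = (if e' = e then 1 else 0)"
  using ends[OF assms] ends_V(3)[OF assms] by (auto simp: arc_flow_def)

lemma a_Ints: "a u v e \<in> \<int>"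
  by (simp add: arc_flow_def)

lemma finite_pairs_V: "finite (pairs V)" using finV by simp

subsection \<open>Cycles as vertex lists\<close>

definition cycle_list :: "'v list \<Rightarrow> bool" where
  "cycle_list vs \<longleftrightarrow> distinct vs \<and> 3 \<le> length vs \<and> set vs \<subseteq> V"

definition nxt :: "'v list \<Rightarrow> nat \<Rightarrow> 'v" where
  "nxt vs i = vs ! (Suc i mod length vs)"

lemma cycle_list_edge:
  assumes "cycle_list vs" "i < length vs"
  shows "vs ! i \<in> V" "nxt vs i \<in> V" "vs ! i \<noteq> nxt vs i"
proof -
  have l: "length vs \<ge> 3" "distinct vs" "set vs \<subseteq> V" using assms(1) by (auto simp: cycle_list_def)
  have i': "Suc i mod length vs < length vs" using l(1) by (intro mod_less_divisor) linarith
  show "vs ! i \<in> V" "nxt vs i \<in> V" using l assms(2) i' by (auto simp: nxt_def)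
  have "Suc i mod length vs \<noteq> i"
    using assms(2) l(1) by (cases "Suc i = length vs") auto
  then show "vs ! i \<noteq> nxt vs i" using l(2) assms(2) i' by (simp add: nxt_def nth_eq_iff_index_eq)
qed

text \<open>Two different positions could share an edge only crosswise, each being the successor of
  the other, which is impossible on a cycle of length at least three.\<close>

lemma cycle_list_edges_inj:
  assumes "cycle_list vs" "i < length vs" "j < length vs" "{vs ! i, nxt vs i} = {vs ! j, nxt vs j}"
  shows "i = j"
proof (rule ccontr)
  let ?k = "length vs"
  assume "i \<noteq> j"
  have l: "?k \<ge> 3" "distinct vs" using assms(1) by (auto simp: cycle_list_def)
  have m: "Suc x mod ?k < ?k" for x using l(1) by (intro mod_less_divisor) linarith
  have "vs ! i \<noteq> vs ! j" using \<open>i \<noteq> j\<close> assms(2,3) l(2) by (simp add: nth_eq_iff_index_eq)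
  then have "vs ! i = nxt vs j" "vs ! j = nxt vs i" using assms(4) by (auto simp: doubleton_eq_iff)
  then have "i = Suc j mod ?k" "j = Suc i mod ?k"
    using assms(2,3) l(2) m by (simp_all add: nxt_def nth_eq_iff_index_eq)
  moreover have "Suc x mod ?k = Suc x \<and> Suc x < ?k \<or> Suc x mod ?k = 0 \<and> Suc x = ?k" if "x < ?k" for x
    using that by (cases "Suc x = ?k") simp_all
  ultimately have "i = Suc j \<or> i = 0 \<and> Suc j = ?k" "j = Suc i \<or> j = 0 \<and> Suc i = ?k"
    using assms(2,3) by metis+
  then show False using l(1) by arith
qed

definition cvec :: "'v list \<Rightarrow> 'v set \<Rightarrow> real" where
  "cvec vs = wsum a (vs @ [hd vs])"

lemma cvec_sum: "vs \<noteq> [] \<Longrightarrow> cvec vs = (\<Sum>i<length vs. a (vs ! i) (nxt vs i))"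
  by (simp add: cvec_def wsum_closed_conv_sum nxt_def)

lemma cvec_edge:
  assumes "cycle_list vs" "i < length vs"
  shows "cvec vs {vs ! i, nxt vs i} = a (vs ! i) (nxt vs i) {vs ! i, nxt vs i}"
proof -
  have "vs \<noteq> []" using assms(2) by auto
  then have "cvec vs {vs ! i, nxt vs i} = (\<Sum>j<length vs. a (vs ! j) (nxt vs j) {vs ! i, nxt vs i})"
    by (simp add: cvec_sum sum_fun_apply)
  also have "\<dots> = (\<Sum>j\<in>{i}. a (vs ! j) (nxt vs j) {vs ! i, nxt vs i})"
  proof (rule sum.mono_neutral_right)
    show "\<forall>j\<in>{..<length vs} - {i}. a (vs ! j) (nxt vs j) {vs ! i, nxt vs i} = 0"
    proof
      fix j assume j: "j \<in> {..<length vs} - {i}"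
      then have "{vs ! i, nxt vs i} \<noteq> {vs ! j, nxt vs j}" using cycle_list_edges_inj[OF assms(1), of i j] assms(2) by auto
      then show "a (vs ! j) (nxt vs j) {vs ! i, nxt vs i} = 0" by (rule ev_supp)
    qed
  qed (use assms in auto)
  finally show ?thesis by simp
qed

lemma cvec_support:
  assumes "cycle_list vs"
  shows "{e. cvec vs e \<noteq> 0} = (\<lambda>i. {vs ! i, nxt vs i}) ` {..<length vs}"
proof (intro equalityI subsetI)
  fix e assume "e \<in> {e. cvec vs e \<noteq> 0}"
  moreover have "vs \<noteq> []" using assms by (auto simp: cycle_list_def)
  ultimately have "(\<Sum>i<length vs. a (vs ! i) (nxt vs i) e) \<noteq> 0" by (simp add: cvec_sum sum_fun_apply)
  then obtain i where "i < length vs" "a (vs ! i) (nxt vs i) e \<noteq> 0"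
    by (meson lessThan_iff sum.neutral)
  then have "e = {vs ! i, nxt vs i}" using ev_supp[of e "vs ! i" "nxt vs i"] by blast
  then show "e \<in> (\<lambda>i. {vs ! i, nxt vs i}) ` {..<length vs}" using \<open>i < length vs\<close> by blast
next
  fix e assume "e \<in> (\<lambda>i. {vs ! i, nxt vs i}) ` {..<length vs}"
  then obtain i where i: "i < length vs" "e = {vs ! i, nxt vs i}" by blast
  then have "\<bar>cvec vs e\<bar> = 1"
    using cvec_edge[OF assms i(1)] a_unit cycle_list_edge[OF assms i(1)] by simp
  then show "e \<in> {e. cvec vs e \<noteq> 0}" by auto
qed

lemma cvec_weight:
  assumes "cycle_list vs"
  shows "cycle_weight D w (cvec vs) = wsum (\<lambda>u v. w {u, v}) (vs @ [hd vs])"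
proof -
  have ne: "vs \<noteq> []" using assms by (auto simp: cycle_list_def)
  have "{e \<in> arcs D. cvec vs e \<noteq> 0} = (\<lambda>i. {vs ! i, nxt vs i}) ` {..<length vs}"
    using cvec_support[OF assms] cycle_list_edge[OF assms] pair_in by (auto simp: arcs_D)
  moreover have "inj_on (\<lambda>i. {vs ! i, nxt vs i}) {..<length vs}"
    using cycle_list_edges_inj[OF assms] by (auto intro!: inj_onI)
  ultimately show ?thesis
    using ne by (simp add: cycle_weight_def sum.reindex wsum_closed_conv_sum nxt_def)
qed

lemma step_ends: assumes "fst s \<in> pairs V"
  shows "step_start D s \<in> V" "step_end D s \<in> V" "step_start D s \<noteq> step_end D s"
    "fst s = {step_start D s, step_end D s}"
    "a (step_start D s) (step_end D s) e = (if e = fst s then if snd s then 1 else - 1 else 0)"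
proof -
  note E = ends[OF assms] ends_V[OF assms]
  show "step_start D s \<in> V" "step_end D s \<in> V" "step_start D s \<noteq> step_end D s"
    using E by (auto simp: step_start_def step_end_def)
  show "fst s = {step_start D s, step_end D s}"
    using E by (auto simp: step_start_def step_end_def insert_commute)
  have "a (head D (fst s)) (tail D (fst s)) e = - (if e = fst s then 1 else 0)"
    using a_anti[of "head D (fst s)" "tail D (fst s)"] a_ends[OF assms, of e] by simp
  then show "a (step_start D s) (step_end D s) e = (if e = fst s then if snd s then 1 else - 1 else 0)"
    using a_ends[OF assms, of e] by (auto simp: step_start_def step_end_def split: if_splits)
qed

text \<open>A cycle of length one would be a loop, and one of length two would repeat its arc; all
  others are determined by their vertices.\<close>

lemma is_cycle_cvec:
  assumes "is_cycle D c"
  shows "cycle_list (map (step_start D) c)" "incidence_vector c = cvec (map (step_start D) c)"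
proof -
  let ?vs = "map (step_start D) c" and ?k = "length c"
  have c: "c \<noteq> []" "fst ` set c \<subseteq> pairs V" "distinct (map fst c)" "distinct ?vs"
    "\<And>i. i < ?k \<Longrightarrow> step_end D (c ! i) = step_start D (c ! (Suc i mod ?k))"
    using assms by (auto simp: is_cycle_def arcs_D)
  have P: "fst (c ! i) \<in> pairs V" if "i < ?k" for i using c(2) that by auto
  have m: "Suc i mod ?k < ?k" for i using c(1) by simp
  have nxt: "nxt ?vs i = step_end D (c ! i)" if "i < ?k" for i
    using c(5)[OF that] m by (simp add: nxt_def)
  have "?k \<noteq> 1"
  proof
    assume "?k = 1"
    then show False using c(5)[of 0] step_ends(3)[OF P[of 0]] by simp
  qed
  moreover have "?k \<noteq> 2"
  proof
    assume k: "?k = 2"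
    then have "step_end D (c ! 0) = step_start D (c ! 1)" "step_end D (c ! 1) = step_start D (c ! 0)"
      using c(5)[of 0] c(5)[of 1] by simp_all
    then have "fst (c ! 0) = fst (c ! 1)"
      using step_ends(4)[OF P[of 0]] step_ends(4)[OF P[of 1]] k by (simp add: insert_commute)
    then have "map fst c ! 0 = map fst c ! 1" using k by simp
    then show False using c(3) k nth_eq_iff_index_eq[OF c(3), of 0 1] by simp
  qed
  moreover have "?k \<noteq> 0" using c(1) by simp
  ultimately have "3 \<le> ?k" by arith
  moreover have "set ?vs \<subseteq> V" using c(2) step_ends(1) by auto
  ultimately show "cycle_list ?vs" using c(4) by (simp add: cycle_list_def)
  show "incidence_vector c = cvec ?vs"
  proof
    fix e
    have "cvec ?vs e = (\<Sum>i<?k. a (?vs ! i) (nxt ?vs i) e)" using c(1) by (simp add: cvec_sum sum_fun_apply)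
    also have "\<dots> = (\<Sum>i<?k. if e = fst (c ! i) then if snd (c ! i) then 1 else - 1 else 0)"
      using step_ends(5)[OF P] nxt by (intro sum.cong) auto
    finally have sum: "cvec ?vs e = \<dots>" .
    show "incidence_vector c e = cvec ?vs e"
    proof (cases "\<exists>i<?k. fst (c ! i) = e")
      case True
      then obtain i where i: "i < ?k" "fst (c ! i) = e" by blast
      have uniq: "j = i" if "j < ?k" "fst (c ! j) = e" for j
        using nth_eq_iff_index_eq[OF c(3), of j i] i that by simp
      have "cvec ?vs e = (\<Sum>j<?k. if j = i then if snd (c ! i) then 1 else - 1 else 0)"
        unfolding sum
      proof (rule sum.cong[OF refl])
        fix j assume "j \<in> {..<?k}"
        then show "(if e = fst (c ! j) then if snd (c ! j) then 1 else - 1 else 0)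
            = (if j = i then if snd (c ! i) then 1 else - 1 else (0 :: real))"
          using uniq[of j] i(2) by (cases "j = i") auto
      qed
      then have val: "cvec ?vs e = (if snd (c ! i) then 1 else - 1)" using i(1) by simp
      have ci: "c ! i = (e, snd (c ! i))" "c ! i \<in> set c" using i by (auto simp: prod_eq_iff)
      have only: "b = snd (c ! i)" if "(e, b) \<in> set c" for b
        using that uniq by (metis fst_conv in_set_conv_nth snd_conv)
      have "(e, True) \<in> set c \<longleftrightarrow> snd (c ! i)" "(e, False) \<in> set c \<longleftrightarrow> \<not> snd (c ! i)"
        using only[of True] only[of False] ci by (cases "snd (c ! i)"; auto)+
      then show ?thesis using val by (simp add: incidence_vector_def)
    next
      case False
      then have "(e, b) \<notin> set c" for b by (metis fst_conv in_set_conv_nth)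
      moreover have "cvec ?vs e = 0" unfolding sum using False by (intro sum.neutral) auto
      ultimately show ?thesis by (simp add: incidence_vector_def)
    qed
  qed
qed

lemma cvec_is_cycle:
  assumes "cycle_list vs"
  shows "\<exists>c. is_cycle D c \<and> incidence_vector c = cvec vs"
proof -
  let ?k = "length vs"
  define e where "e i = {vs ! i, nxt vs i}" for i
  define c where "c = map (\<lambda>i. (e i, tail D (e i) = vs ! i)) [0..<?k]"
  have vs: "3 \<le> ?k" "distinct vs" "set vs \<subseteq> V" using assms by (auto simp: cycle_list_def)
  have eP: "e i \<in> pairs V" if "i < ?k" for i
    using cycle_list_edge[OF assms that] by (simp add: e_def pair_in)
  have start: "step_start D (c ! i) = vs ! i" "step_end D (c ! i) = nxt vs i" if "i < ?k" for i
    using ends[OF eP[OF that]] cycle_list_edge(3)[OF assms that] that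
    by (auto simp: c_def step_start_def step_end_def e_def doubleton_eq_iff)
  have starts: "map (step_start D) c = vs"
    using start by (intro nth_equalityI) (auto simp: c_def)
  have "inj_on e {0..<?k}" using cycle_list_edges_inj[OF assms] by (auto simp: e_def intro!: inj_onI)
  then have "distinct (map fst c)" by (simp add: c_def o_def distinct_map)
  moreover have "fst ` set c \<subseteq> arcs D" using eP by (auto simp: c_def arcs_D)
  moreover have "step_end D (c ! i) = step_start D (c ! (Suc i mod length c))" if "i < length c" for i
  proof -
    have "i < ?k" "length c = ?k" using that by (simp_all add: c_def)
    moreover have "Suc i mod ?k < ?k" using vs(1) by (intro mod_less_divisor) linarith
    ultimately show ?thesis using start by (simp add: nxt_def)
  qed
  moreover have "c \<noteq> []" using vs(1) by (auto simp: c_def)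
  ultimately have "is_cycle D c" using starts vs(2) by (simp add: is_cycle_def)
  then show ?thesis using is_cycle_cvec(2) starts by metis
qed

lemma cycle_vectors_eq: "cycle_vectors D = cvec ` {vs. cycle_list vs}"
proof -
  have "incidence_vector ` {c. is_cycle D c} \<subseteq> cvec ` {vs. cycle_list vs}"
    using is_cycle_cvec by (metis (mono_tags, lifting) image_subsetI mem_Collect_eq rev_image_eqI)
  moreover have "cvec ` {vs. cycle_list vs} \<subseteq> incidence_vector ` {c. is_cycle D c}"
    using cvec_is_cycle by (metis (mono_tags, lifting) image_subsetI mem_Collect_eq rev_image_eqI)
  ultimately show ?thesis by (simp add: cycle_vectors_def)
qed

lemma finite_cycle_vectors: "finite (cycle_vectors D)"
proof -
  have "{vs. cycle_list vs} \<subseteq> {vs. set vs \<subseteq> V \<and> distinct vs}" by (auto simp: cycle_list_def)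
  then show ?thesis
    unfolding cycle_vectors_eq using finite_subset_distinct[OF finV] finite_subset by blast
qed

lemma cvec_Ints: "cvec vs e \<in> \<int>"
proof -
  have "wsum a xs e \<in> \<int>" for xs
    by (induction a xs rule: wsum.induct) (auto simp: a_Ints intro: Ints_add)
  then show ?thesis by (simp add: cvec_def)
qed

subsection \<open>The cycle space\<close>

text \<open>The net outflow at \<open>v\<close>, indexed by neighbours so that the signs come from
  \<open>a\<close>.\<close>

definition bdry :: "('v set \<Rightarrow> real) \<Rightarrow> 'v \<Rightarrow> real" where
  "bdry x v = (\<Sum>u\<in>V - {v}. a v u {v, u} * x {v, u})"

lemma bdry_out_in:
  assumes v: "v \<in> V"
  shows "bdry x v = (\<Sum>e\<in>out_arcs D v. x e) - (\<Sum>e\<in>in_arcs D v. x e)"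
proof -
  have inj: "inj_on (\<lambda>u. {v, u}) (V - {v})" by (auto intro!: inj_onI simp: doubleton_eq_iff)
  have "bdry x v = (\<Sum>u\<in>V - {v}. (if tail D {v, u} = v then x {v, u} else 0) - (if head D {v, u} = v then x {v, u} else 0))"
    unfolding bdry_def
  proof (rule sum.cong[OF refl])
    fix u assume u: "u \<in> V - {v}"
    then have "{tail D {v, u}, head D {v, u}} = {v, u}" using ends[OF pair_in[of v u]] v by blast
    then show "a v u {v, u} * x {v, u} = (if tail D {v, u} = v then x {v, u} else 0) - (if head D {v, u} = v then x {v, u} else 0)"
      using u by (auto simp: arc_flow_def doubleton_eq_iff)
  qed
  also have "\<dots> = (\<Sum>e\<in>(\<lambda>u. {v, u}) ` (V - {v}). (if tail D e = v then x e else 0) - (if head D e = v then x e else 0))"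
    by (simp add: sum.reindex[OF inj])
  also have "(\<lambda>u. {v, u}) ` (V - {v}) = {e\<in>pairs V. v \<in> e}"
  proof (intro equalityI subsetI)
    fix e assume "e \<in> {e\<in>pairs V. v \<in> e}"
    then have e: "e \<subseteq> V" "card e = 2" "v \<in> e" by (auto simp: pairs_def)
    then obtain u where "e = {v, u}" "u \<noteq> v" by (auto simp: card_2_iff doubleton_eq_iff)
    then show "e \<in> (\<lambda>u. {v, u}) ` (V - {v})" using e(1) by blast
  qed (use v in \<open>auto simp: pairs_def\<close>)
  finally have "bdry x v = (\<Sum>e | e \<in> pairs V \<and> v \<in> e. if tail D e = v then x e else 0)
    - (\<Sum>e | e \<in> pairs V \<and> v \<in> e. if head D e = v then x e else 0)"
    by (simp add: sum_subtractf)
  moreover have "(\<Sum>e | e \<in> pairs V \<and> v \<in> e. if tail D e = v then x e else 0) = (\<Sum>e\<in>out_arcs D v. x e)"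
    using finite_pairs_V ends by (auto simp: out_arcs_def arcs_D sum.If_cases intro!: sum.cong)
  moreover have "(\<Sum>e | e \<in> pairs V \<and> v \<in> e. if head D e = v then x e else 0) = (\<Sum>e\<in>in_arcs D v. x e)"
    using finite_pairs_V ends by (auto simp: in_arcs_def arcs_D sum.If_cases intro!: sum.cong)
  ultimately show ?thesis by simp
qed

lemma cycle_space_eq: "cycle_space D = {x. (\<forall>e. e \<notin> pairs V \<longrightarrow> x e = 0) \<and> (\<forall>v\<in>V. bdry x v = 0)}"
  using bdry_out_in by (auto simp: cycle_space_def arcs_D verts_D)

lemma bdry_add: "bdry (x + y) v = bdry x v + bdry y v"
  by (simp add: bdry_def sum.distrib algebra_simps)

lemma bdry_scale: "bdry (vec_scale c x) v = c * bdry x v"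
  by (simp add: bdry_def vec_scale_apply sum_distrib_left algebra_simps)

lemma subspace_cycle_space: "vec.subspace (cycle_space D)"
  by (rule vec.subspaceI) (auto simp: cycle_space_eq bdry_add bdry_scale vec_scale_apply, simp add: bdry_def)

lemma bdry_a:
  assumes "p \<in> V" "q \<in> V" "p \<noteq> q" "v \<in> V"
  shows "bdry (a p q) v = of_bool (v = p) - of_bool (v = q)"
proof -
  have *: "a v u {v, u} * a p q {v, u} = (if u = q \<and> v = p then 1 else 0) - (if u = p \<and> v = q then 1 else 0)"
    if "u \<in> V - {v}" for u
  proof (cases "{v, u} = {p, q}")
    case True
    have 1: "a p q {p, q} * a p q {p, q} = 1"
      using a_unit[OF assms(1-3)] by (metis abs_mult_self_eq mult_1)
    have 2: "a q p {q, p} * a p q {q, p} = - 1"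
      using 1 a_anti[of q p] by (simp add: insert_commute)
    show ?thesis using True 1 2 assms(3) by (auto simp: doubleton_eq_iff)
  next
    case False
    have zero: "a p q {v, u} = 0" by (rule ev_supp[OF False])
    have n1: "\<not> (u = q \<and> v = p)" using False by (rule contrapos_nn) simp
    have n2: "\<not> (u = p \<and> v = q)" using False by (rule contrapos_nn) (simp add: insert_commute)
    show ?thesis unfolding if_not_P[OF n1] if_not_P[OF n2] zero by simp
  qed
  have "bdry (a p q) v = (\<Sum>u\<in>V - {v}. (if u = q \<and> v = p then 1 else 0) - (if u = p \<and> v = q then 1 else 0))"
    unfolding bdry_def by (rule sum.cong[OF refl]) (rule *)
  also have "\<dots> = (\<Sum>u\<in>V - {v}. if u = q then of_bool (v = p) else 0) - (\<Sum>u\<in>V - {v}. if u = p then of_bool (v = q) else 0)"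
    unfolding sum_subtractf[symmetric] by (intro sum.cong) auto
  also have "\<dots> = of_bool (v = p) - of_bool (v = q)"
    using assms finV by auto
  finally show ?thesis .
qed

lemma bdry_wsum:
  assumes "xs \<noteq> []" "set xs \<subseteq> V" "v \<in> V"
  shows "bdry (wsum a xs) v = of_bool (v = hd xs) - of_bool (v = last xs)"
  using assms
proof (induction xs)
  case (Cons x xs)
  show ?case
  proof (cases xs)
    case Nil
    then show ?thesis by (simp add: bdry_def)
  next
    case (Cons y ys)
    have "bdry (wsum a xs) v = of_bool (v = y) - of_bool (v = last xs)"
      using Cons.IH Cons.prems Cons by simp
    moreover have "bdry (a x y) v = of_bool (v = x) - of_bool (v = y)"
      using bdry_a[of x y v] Cons.prems Cons by (cases "x = y") (auto simp: bdry_def)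
    moreover have "wsum a (x # xs) = a x y + wsum a xs" using Cons by simp
    moreover have "hd (x # xs) = x" "last (x # xs) = last xs" using Cons by simp_all
    ultimately show ?thesis unfolding bdry_add by (simp only: bdry_add)
  qed
qed simp

lemma wsum_a_outside: "set xs \<subseteq> V \<Longrightarrow> e \<notin> pairs V \<Longrightarrow> wsum a xs e = 0"
proof (induction a xs rule: wsum.induct)
  case (1 x y zs)
  then have "a x y e = 0" using pair_in[of x y] ev_supp[of e x y] by (cases "x = y") auto
  then show ?case using 1 by simp
qed auto

lemma wsum_closed_in_cycle_space:
  assumes "xs \<noteq> []" "set xs \<subseteq> V" "hd xs = last xs"
  shows "wsum a xs \<in> cycle_space D"
  using assms bdry_wsum wsum_a_outside by (simp add: cycle_space_eq)

lemma cvec_in_cycle_space: "cycle_list vs \<Longrightarrow> cvec vs \<in> cycle_space D"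
  unfolding cvec_def
  by (rule wsum_closed_in_cycle_space; cases vs) (auto simp: cycle_list_def)

lemma sum_flow: assumes "\<And>e. e \<notin> pairs V \<Longrightarrow> x e = 0"
  shows "x = (\<Sum>e\<in>pairs V. vec_scale (x e) (a (tail D e) (head D e)))"
proof
  fix e
  have "(\<Sum>e'\<in>pairs V. x e' * a (tail D e') (head D e') e) = (\<Sum>e'\<in>pairs V. if e' = e then x e else 0)"
    using a_ends by (intro sum.cong) auto
  also have "\<dots> = x e" using assms finite_pairs_V by simp
  finally show "x e = (\<Sum>e\<in>pairs V. vec_scale (x e) (a (tail D e) (head D e))) e"
    by (simp add: sum_fun_apply vec_scale_apply)
qed

text \<open>Subtract from a circulation \<open>x\<close>, for every arc, the triangle through a root
  \<open>r\<close> with the coefficient of that arc. The rest lives on the star of \<open>r\<close>,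
  where conservation at each leaf makes it vanish.\<close>

lemma span_cycle_vectors: "vec.span (cycle_vectors D) = cycle_space D"
proof
  show sub: "vec.span (cycle_vectors D) \<subseteq> cycle_space D"
    by (rule vec.span_minimal[OF _ subspace_cycle_space]) (auto simp: cycle_vectors_eq cvec_in_cycle_space)
  show "cycle_space D \<subseteq> vec.span (cycle_vectors D)"
  proof
    fix x assume x: "x \<in> cycle_space D"
    show "x \<in> vec.span (cycle_vectors D)"
    proof (cases "V = {}")
      case True
      then have "pairs V = {}" by (auto simp: pairs_def)
      then have "x = 0" using x by (auto simp: cycle_space_eq fun_eq_iff)
      then show ?thesis by (simp add: vec.span_zero)
    next
      case False
      then obtain r where r: "r \<in> V" by blast
      define c where "c e = circ a r (tail D e) (head D e)" for e
      define z where "z = (\<Sum>e\<in>pairs V. vec_scale (x e) (c e))"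
      have c_cycle: "c e \<in> vec.span (cycle_vectors D)" if "e \<in> pairs V" for e
      proof (cases "r \<in> e")
        case True
        then have "r = tail D e \<or> r = head D e" using ends[OF that] by blast
        then have "c e = 0" using a_anti[of "tail D e" "head D e"] by (auto simp: c_def circ_def)
        then show ?thesis by (simp add: vec.span_zero)
      next
        case False
        then have "r \<noteq> tail D e" "r \<noteq> head D e" using ends[OF that] by blast+
        then have "cycle_list [r, tail D e, head D e]"
          using r ends_V[OF that] by (simp add: cycle_list_def)
        moreover have "cvec [r, tail D e, head D e] = c e" by (simp add: cvec_def c_def circ_def add.assoc)
        ultimately show ?thesis by (intro vec.span_base) (force simp: cycle_vectors_eq)
      qed
      then have z_span: "z \<in> vec.span (cycle_vectors D)"
        unfolding z_def by (intro vec.span_sum vec.span_scale)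
      have zc: "z \<in> cycle_space D" using z_span sub by blast
      define y where "y = x - z"
      have y: "y \<in> cycle_space D"
        unfolding y_def using x zc subspace_cycle_space vec.subspace_diff by blast
      have y_star: "y e = 0" if "r \<notin> e" for e
      proof -
        have "c e' e = (if e' = e then 1 else 0)" if "e' \<in> pairs V" for e'
        proof -
          have "a r (tail D e') e = 0" "a (head D e') r e = 0"
            using \<open>r \<notin> e\<close> ev_supp[of e r "tail D e'"] ev_supp[of e "head D e'" r] by blast+
          then show ?thesis using a_ends[OF that, of e] by (simp add: c_def circ_def)
        qed
        then have "z e = (\<Sum>e'\<in>pairs V. if e' = e then x e else 0)"
          unfolding z_def by (auto simp: sum_fun_apply vec_scale_apply intro!: sum.cong)
        also have "\<dots> = x e" using x finite_pairs_V by (simp add: cycle_space_eq)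
        finally show ?thesis by (simp add: y_def)
      qed
      have "y e = 0" for e
      proof (cases "e \<in> pairs V \<and> r \<in> e")
        case True
        then have e: "e \<subseteq> V" "card e = 2" "r \<in> e" by (auto simp: pairs_def)
        then obtain u where u: "e = {u, r}" "u \<noteq> r" by (auto simp: card_2_iff doubleton_eq_iff)
        then have uV: "u \<in> V" using e(1) by blast
        have "bdry y u = (\<Sum>v\<in>{r}. a u v {u, v} * y {u, v})"
          unfolding bdry_def using finV r u(2) y_star by (intro sum.mono_neutral_right) auto
        then have "a u r {u, r} * y {u, r} = 0" using y uV by (simp add: cycle_space_eq)
        then show ?thesis using a_unit[OF uV r u(2)] u(1) by auto
      next
        case False
        then show ?thesis using y_star y by (auto simp: cycle_space_eq)
      qed
      then have "x = z" by (auto simp: y_def fun_eq_iff)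
      then show ?thesis using z_span by simp
    qed
  qed
qed

end

lemma wsum_mem:
  assumes "0 \<in> X" "\<And>x y. x \<in> X \<Longrightarrow> y \<in> X \<Longrightarrow> x + y \<in> X"
    and "\<And>p u v r. xs = p @ u # v # r \<Longrightarrow> f u v \<in> X"
  shows "wsum f xs \<in> X"
  using assms(3)
proof (induction xs)
  case (Cons x xs)
  show ?case
  proof (cases xs)
    case (Cons y zs)
    have "wsum f xs \<in> X"
    proof (rule Cons.IH)
      fix p u v r assume "xs = p @ u # v # r"
      then show "f u v \<in> X" using Cons.prems[of "x # p" u v r] by simp
    qed
    moreover have "f x y \<in> X" using Cons.prems[of "[]" x y zs] Cons by simp
    ultimately show ?thesis using assms(2) Cons by simp
  qed (use assms(1) in simp)
qed (use assms(1) in simp)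

lemma wsum_join:
  assumes "xs \<noteq> []" "ys \<noteq> []" "last xs = hd ys"
  shows "wsum f (xs @ tl ys) = wsum f xs + wsum f ys"
    "hd (xs @ tl ys) = hd xs" "last (xs @ tl ys) = last ys"
proof -
  obtain zs y where xs: "xs = zs @ [y]" using assms(1) by (metis rev_exhaust)
  then obtain ys' where ys: "ys = y # ys'" using assms(2,3) by (cases ys) auto
  show "wsum f (xs @ tl ys) = wsum f xs + wsum f ys"
    using wsum_append[of f zs y ys'] by (simp add: xs ys)
  show "hd (xs @ tl ys) = hd xs" using assms(1) by simp
  show "last (xs @ tl ys) = last ys" by (simp add: xs ys)
qed

section \<open>Cycles are determined by their edges up to sign\<close>

context complete_digraph
begin

lemma nxt_inj:
  assumes "cycle_list vs" "i < length vs" "j < length vs" "nxt vs i = nxt vs j"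
  shows "i = j"
proof -
  let ?k = "length vs"
  have l: "?k \<ge> 3" "distinct vs" using assms(1) by (auto simp: cycle_list_def)
  have m: "Suc x mod ?k < ?k" for x using l(1) by (intro mod_less_divisor) linarith
  have "Suc i mod ?k = Suc j mod ?k"
    using assms(4) l(2) m by (simp add: nxt_def nth_eq_iff_index_eq)
  moreover have "Suc x mod ?k = Suc x \<or> Suc x mod ?k = 0 \<and> Suc x = ?k" if "x < ?k" for x
    using that by (cases "Suc x = ?k") simp_all
  ultimately show ?thesis using assms(2,3) by (metis Suc_inject nat.distinct(1))
qed

text \<open>Only two edges of the support candidates meet at a vertex of the cycle, so conservation
  carries the value zero from each edge to the next.\<close>

lemma circulation_on_cycle:
  assumes cyc: "cycle_list vs" and z: "z \<in> cycle_space D"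
    and supp: "\<And>e. z e \<noteq> 0 \<Longrightarrow> e \<in> (\<lambda>i. {vs ! i, nxt vs i}) ` {..<length vs}"
    and zero: "z {vs ! 0, nxt vs 0} = 0"
  shows "z = 0"
proof -
  have *: "z {vs ! i, nxt vs i} = 0" if "i < length vs" for i
    using that
  proof (induction i)
    case 0
    then show ?case using zero by simp
  next
    case (Suc i)
    let ?v = "vs ! Suc i" and ?t = "nxt vs (Suc i)"
    have v: "nxt vs i = ?v" using Suc.prems by (simp add: nxt_def)
    note E = cycle_list_edge[OF cyc Suc.prems]
    have "bdry z ?v = (\<Sum>u\<in>{?t}. a ?v u {?v, u} * z {?v, u})"
      unfolding bdry_def
    proof (rule sum.mono_neutral_right)
      show "\<forall>u\<in>V - {?v} - {?t}. a ?v u {?v, u} * z {?v, u} = 0"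
      proof
        fix u assume u: "u \<in> V - {?v} - {?t}"
        have "z {?v, u} = 0"
        proof (rule ccontr)
          assume "z {?v, u} \<noteq> 0"
          then obtain j where j: "j < length vs" "{?v, u} = {vs ! j, nxt vs j}" using supp by blast
          then have "vs ! j = ?v \<and> nxt vs j = u \<or> nxt vs j = ?v \<and> vs ! j = u"
            by (auto simp: doubleton_eq_iff)
          then show False
          proof
            assume "vs ! j = ?v \<and> nxt vs j = u"
            moreover from this have "j = Suc i"
              using cyc j(1) Suc.prems by (simp add: cycle_list_def nth_eq_iff_index_eq)
            ultimately show False using u by simp
          next
            assume h: "nxt vs j = ?v \<and> vs ! j = u"
            then have "j = i" using nxt_inj[OF cyc j(1), of i] Suc.prems v by simp
            then have "z {?v, u} = 0" using Suc.IH Suc.prems v h by (simp add: insert_commute)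
            then show False using \<open>z {?v, u} \<noteq> 0\<close> by simp
          qed
        qed
        then show "a ?v u {?v, u} * z {?v, u} = 0" by simp
      qed
    qed (use finV E in auto)
    then have "a ?v ?t {?v, ?t} * z {?v, ?t} = 0" using z E(1) by (simp add: cycle_space_eq)
    then show ?case using a_unit[OF E] by auto
  qed
  show ?thesis
  proof
    fix e show "z e = 0 e" using supp[of e] * by auto
  qed
qed

lemma cvec_values: assumes "cycle_list vs" shows "cvec vs e = 0 \<or> cvec vs e = 1 \<or> cvec vs e = - 1"
proof (cases "cvec vs e = 0")
  case False
  then obtain i where i: "i < length vs" "e = {vs ! i, nxt vs i}" using cvec_support[OF assms] by blast
  then have "\<bar>cvec vs e\<bar> = 1"
    using cvec_edge[OF assms i(1)] a_unit cycle_list_edge[OF assms i(1)] by simp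
  then show ?thesis by linarith
qed simp

text \<open>At one chosen edge both vectors have entries 1 or -1, so their difference or their sum
  vanishes there and hence everywhere.\<close>

lemma same_support:
  assumes "x \<in> cycle_vectors D" "y \<in> cycle_vectors D" "{e. x e \<noteq> 0} = {e. y e \<noteq> 0}"
  shows "y = x \<or> y = - x"
proof -
  obtain vs us where vs: "cycle_list vs" "x = cvec vs" and us: "cycle_list us" "y = cvec us"
    using assms(1,2) by (auto simp: cycle_vectors_eq)
  let ?e = "{vs ! 0, nxt vs 0}"
  have "0 < length vs" using vs(1) by (auto simp: cycle_list_def)
  then have "?e \<in> {e. x e \<noteq> 0}" unfolding vs(2) cvec_support[OF vs(1)] by blast
  then have ne: "x ?e \<noteq> 0" "y ?e \<noteq> 0" using assms(3) by auto
  have xy: "x \<in> cycle_space D" "y \<in> cycle_space D"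
    using vs us cvec_in_cycle_space by auto
  have supp: "e \<in> (\<lambda>i. {vs ! i, nxt vs i}) ` {..<length vs}" if "x e \<noteq> 0 \<or> y e \<noteq> 0" for e
    using that assms(3) unfolding cvec_support[OF vs(1), symmetric] vs(2) by blast
  show ?thesis
  proof (cases "y ?e = x ?e")
    case True
    have "y - x = 0"
      by (rule circulation_on_cycle[OF vs(1)])
        (use xy subspace_cycle_space vec.subspace_diff supp True in auto)
    then show ?thesis by simp
  next
    case False
    then have "y ?e + x ?e = 0"
      using cvec_values[OF vs(1), of ?e] cvec_values[OF us(1), of ?e] ne vs(2) us(2) by auto
    then have "y + x = 0"
      by (intro circulation_on_cycle[OF vs(1)])
        (use xy subspace_cycle_space vec.subspace_add supp in auto)
    then show ?thesis by (simp add: eq_neg_iff_add_eq_0)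
  qed
qed

end

subsection \<open>Light cycles and shortest walks\<close>

locale weighted_complete_digraph = complete_digraph V D
  for V :: "'v set" and D :: "('v, 'v set) pre_digraph" +
  fixes w :: "'v set \<Rightarrow> real"
  assumes w_nonneg: "\<And>e. e \<in> pairs V \<Longrightarrow> 0 \<le> w e"
begin

definition len :: "'v \<Rightarrow> 'v \<Rightarrow> real" where
  "len u v = (if u = v then 0 else w {u, v})"

lemma len_sym: "len v u = len u v"
  by (simp add: len_def insert_commute)

lemma wsum_len_nonneg: "set xs \<subseteq> V \<Longrightarrow> 0 \<le> wsum len xs"
proof (induction len xs rule: wsum.induct)
  case (1 x y zs)
  then have "0 \<le> len x y" using w_nonneg[OF pair_in[of x y]] by (auto simp: len_def)
  then show ?case using 1 by simp
qed auto

lemma cycle_weight_cvec: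
  assumes "cycle_list vs"
  shows "cycle_weight D w (cvec vs) = wsum len (vs @ [hd vs])"
proof -
  have "vs \<noteq> []" using assms by (auto simp: cycle_list_def)
  moreover have "(\<Sum>i<length vs. w {vs ! i, nxt vs i}) = (\<Sum>i<length vs. len (vs ! i) (nxt vs i))"
    using cycle_list_edge(3)[OF assms] by (intro sum.cong) (auto simp: len_def)
  ultimately show ?thesis
    by (simp add: cvec_weight[OF assms] wsum_closed_conv_sum nxt_def)
qed

text \<open>Cutting at a repeated vertex yields two shorter closed walks, neither of larger weight
  because weights are nonnegative. A walk back and forth along one edge contributes zero.\<close>

lemma closed_walk_zspan:
  assumes "xs \<noteq> []" "hd xs = last xs" "set xs \<subseteq> V"
  shows "wsum a xs \<in> zspan {z \<in> cycle_vectors D. cycle_weight D w z \<le> wsum len xs}"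
  using assms
proof (induction "length xs" arbitrary: xs rule: less_induct)
  case less
  let ?L = "\<lambda>xs. {z \<in> cycle_vectors D. cycle_weight D w z \<le> wsum len xs}"
  define vs where "vs = butlast xs"
  have xs: "xs = vs @ [last xs]" using less.prems(1) by (simp add: vs_def)
  show ?case
  proof (cases "vs = []")
    case True
    then have "wsum a xs = 0" by (subst xs) simp
    then show ?thesis by (simp add: zspan_0)
  next
    case False
    then have "last xs = hd vs" using less.prems(2) xs by (metis hd_append2)
    then have xs': "xs = vs @ [hd vs]" using xs by simp
    show ?thesis
    proof (cases "distinct vs")
      case True
      consider "length vs = 1" | "length vs = 2" | "3 \<le> length vs" using False by (cases "length vs"; force)
      then show ?thesis
      proof cases
        case 1
        then obtain x where "vs = [x]" by (cases vs) auto
        then have "wsum a xs = 0" by (simp add: xs')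
        then show ?thesis by (simp add: zspan_0)
      next
        case 2
        then obtain x y where "vs = [x, y]" by (auto simp: length_Suc_conv numeral_2_eq_2)
        then have "wsum a xs = 0" using a_anti[of x y] by (simp add: xs')
        then show ?thesis by (simp add: zspan_0)
      next
        case 3
        then have c: "cycle_list vs" using True less.prems(3) xs' by (simp add: cycle_list_def)
        then have "cvec vs \<in> ?L xs" using cycle_weight_cvec[OF c] by (auto simp: cycle_vectors_eq xs')
        moreover have "wsum a xs = cvec vs" by (simp add: cvec_def xs')
        ultimately show ?thesis by (simp only: zspan_base)
      qed
    next
      case nd: False
      obtain p y q r where vs: "vs = p @ [y] @ q @ [y] @ r" using not_distinct_decomp[OF nd] by blast
      let ?r = "r @ [hd vs]"
      have split: "wsum f xs = wsum f (p @ y # ?r) + wsum f (y # q @ [y])" for f :: "'v \<Rightarrow> 'v \<Rightarrow> 'c :: comm_monoid_add"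
        using wsum_split[of f p y q ?r] by (subst xs') (simp add: vs)
      have sub: "set (p @ y # ?r) \<subseteq> V" "set (y # q @ [y]) \<subseteq> V"
        using less.prems(3) by (auto simp: xs' vs)
      have "wsum a (p @ y # ?r) \<in> zspan (?L (p @ y # ?r))"
        by (rule less.hyps) (use sub in \<open>auto simp: xs' vs hd_append\<close>)
      moreover have "zspan (?L (p @ y # ?r)) \<subseteq> zspan (?L xs)"
        using wsum_len_nonneg[OF sub(2)] split[of len] by (intro zspan_mono) auto
      moreover have "wsum a (y # q @ [y]) \<in> zspan (?L (y # q @ [y]))"
        by (rule less.hyps) (use sub in \<open>auto simp: xs' vs\<close>)
      moreover have "zspan (?L (y # q @ [y])) \<subseteq> zspan (?L xs)"
        using wsum_len_nonneg[OF sub(1)] split[of len] by (intro zspan_mono) auto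
      ultimately show ?thesis unfolding split[of a] by (meson subsetD zspan_add)
    qed
  qed
qed

lemma walk_shorten:
  assumes "xs \<noteq> []" "set xs \<subseteq> V"
  shows "\<exists>ys. distinct ys \<and> ys \<noteq> [] \<and> set ys \<subseteq> V \<and> hd ys = hd xs \<and> last ys = last xs \<and> wsum len ys \<le> wsum len xs"
  using assms
proof (induction "length xs" arbitrary: xs rule: less_induct)
  case less
  show ?case
  proof (cases "distinct xs")
    case False
    obtain p y q r where xs: "xs = p @ [y] @ q @ [y] @ r" using not_distinct_decomp[OF False] by blast
    have split: "wsum len xs = wsum len (p @ y # r) + wsum len (y # q @ [y])"
      using wsum_split[of len p y q r] by (simp add: xs)
    have sub: "set (p @ y # r) \<subseteq> V" "set (y # q @ [y]) \<subseteq> V" using less.prems(2) by (auto simp: xs)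
    have "\<exists>ys. distinct ys \<and> ys \<noteq> [] \<and> set ys \<subseteq> V \<and> hd ys = hd (p @ y # r) \<and> last ys = last (p @ y # r)
        \<and> wsum len ys \<le> wsum len (p @ y # r)"
      by (rule less.hyps) (use sub in \<open>auto simp: xs\<close>)
    moreover have "hd (p @ y # r) = hd xs" by (cases p) (simp_all add: xs)
    moreover have "last (p @ y # r) = last xs" by (simp add: xs)
    moreover have "wsum len (p @ y # r) \<le> wsum len xs" using split wsum_len_nonneg[OF sub(2)] by simp
    ultimately show ?thesis by (metis order_trans)
  qed (use less.prems in blast)
qed

definition simple_walks :: "'v \<Rightarrow> 'v \<Rightarrow> 'v list set" where
  "simple_walks u v = {xs. distinct xs \<and> xs \<noteq> [] \<and> set xs \<subseteq> V \<and> hd xs = u \<and> last xs = v}"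

definition shortest :: "'v set \<Rightarrow> 'v list" where
  "shortest e = arg_min_on (wsum len) (simple_walks (tail D e) (head D e))"

definition dist_w :: "'v set \<Rightarrow> real" where
  "dist_w e = wsum len (shortest e)"

definition dist_v :: "'v \<Rightarrow> 'v \<Rightarrow> real" where
  "dist_v u v = (if u = v then 0 else dist_w {u, v})"

text \<open>Only one shortest walk per pair is chosen, from tail to head; the sign in front makes it
  serve both directions antisymmetrically.\<close>

definition geo :: "'v \<Rightarrow> 'v \<Rightarrow> 'v set \<Rightarrow> real" where
  "geo u v = (if u = v then 0 else vec_scale (a u v {u, v}) (wsum a (shortest {u, v})))"

lemma finite_simple_walks: "finite (simple_walks u v)"
proof -
  have "simple_walks u v \<subseteq> {xs. set xs \<subseteq> V \<and> distinct xs}" by (auto simp: simple_walks_def)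
  then show ?thesis using finite_subset_distinct[OF finV] finite_subset by blast
qed

lemma shortest:
  assumes "e \<in> pairs V"
  shows "shortest e \<in> simple_walks (tail D e) (head D e)"
    "\<And>xs. xs \<in> simple_walks (tail D e) (head D e) \<Longrightarrow> dist_w e \<le> wsum len xs"
proof -
  have "[tail D e, head D e] \<in> simple_walks (tail D e) (head D e)"
    using ends_V[OF assms] by (simp add: simple_walks_def)
  then have ne: "simple_walks (tail D e) (head D e) \<noteq> {}" by blast
  show "shortest e \<in> simple_walks (tail D e) (head D e)"
    unfolding shortest_def by (rule arg_min_if_finite(1)[OF finite_simple_walks ne])
  show "dist_w e \<le> wsum len xs" if "xs \<in> simple_walks (tail D e) (head D e)" for xs
    unfolding dist_w_def shortest_def by (rule arg_min_least[OF finite_simple_walks ne that])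
qed

lemma dist_w_nonneg: assumes "e \<in> pairs V" shows "0 \<le> dist_w e"
  using shortest(1)[OF assms] wsum_len_nonneg by (auto simp: dist_w_def simple_walks_def)

lemma tail_cases:
  assumes "u \<in> V" "v \<in> V" "u \<noteq> v"
  obtains "tail D {u, v} = u" "head D {u, v} = v" | "tail D {u, v} = v" "head D {u, v} = u"
proof -
  have "{tail D {u, v}, head D {u, v}} = {u, v}" using ends[OF pair_in[OF assms]] .
  then show thesis using that by (auto simp: doubleton_eq_iff)
qed

lemma dist_v_le:
  assumes "xs \<noteq> []" "set xs \<subseteq> V" "hd xs = u" "last xs = v"
  shows "dist_v u v \<le> wsum len xs"
proof (cases "u = v")
  case True
  then show ?thesis using wsum_len_nonneg[OF assms(2)] by (simp add: dist_v_def)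
next
  case False
  have uv: "u \<in> V" "v \<in> V" using assms hd_in_set[of xs] last_in_set[of xs] by auto
  obtain ys where ys: "distinct ys" "ys \<noteq> []" "set ys \<subseteq> V" "hd ys = u" "last ys = v" "wsum len ys \<le> wsum len xs"
    using walk_shorten[OF assms(1,2)] assms(3,4) by blast
  have rev: "wsum len (rev ys) = wsum len ys" by (rule wsum_rev) (rule len_sym)
  have "ys \<in> simple_walks u v" "rev ys \<in> simple_walks v u"
    using ys by (simp_all add: simple_walks_def hd_rev last_rev)
  then have "dist_w {u, v} \<le> wsum len ys"
    using shortest(2)[OF pair_in[OF uv False], of ys] shortest(2)[OF pair_in[OF uv False], of "rev ys"] rev
    by (cases rule: tail_cases[OF uv False]) auto
  then show ?thesis using ys(6) False by (simp add: dist_v_def)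
qed

lemma geo_walk:
  assumes "u \<in> V" "v \<in> V"
  obtains xs where "xs \<noteq> []" "set xs \<subseteq> V" "hd xs = u" "last xs = v" "wsum len xs = dist_v u v" "wsum a xs = geo u v"
proof (cases "u = v")
  case True
  then show thesis using that[of "[u]"] assms by (simp add: dist_v_def geo_def)
next
  case False
  let ?P = "shortest {u, v}"
  have P: "?P \<noteq> []" "set ?P \<subseteq> V" "hd ?P = tail D {u, v}" "last ?P = head D {u, v}"
    using shortest(1)[OF pair_in[OF assms False]] by (auto simp: simple_walks_def)
  show thesis
  proof (cases rule: tail_cases[OF assms False])
    case 1
    have "a u v {u, v} = 1" using 1 False by (simp add: arc_flow_def)
    then have "wsum a ?P = geo u v" using False by (auto simp: geo_def vec_scale_def)
    then show thesis using that[of ?P] P 1 False by (simp add: dist_v_def dist_w_def)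
  next
    case 2
    have "a u v {u, v} = - 1" using 2 False by (auto simp: arc_flow_def)
    moreover have "wsum a (rev ?P) = wsum (\<lambda>u v. - a u v) ?P" by (rule wsum_rev) (rule a_anti)
    then have neg: "wsum a (rev ?P) = - wsum a ?P" by (simp only: wsum_neg)
    ultimately have "wsum a (rev ?P) = geo u v"
      using False by (auto simp: geo_def vec_scale_def fun_eq_iff)
    moreover have "wsum len (rev ?P) = wsum len ?P" by (rule wsum_rev) (rule len_sym)
    ultimately show thesis
      using that[of "rev ?P"] P 2 False by (simp add: dist_v_def dist_w_def hd_rev last_rev)
  qed
qed

lemma dist_v_sym: "dist_v v u = dist_v u v"
  by (simp add: dist_v_def insert_commute)

context
  fixes M :: real
begin

definition light :: "('v set \<Rightarrow> real) set" where
  "light = {z \<in> cycle_vectors D. cycle_weight D w z < M}"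

text \<open>Perimeters are measured by distances, not by edge weights. Degenerate triangles are
  included and have boundary zero.\<close>

definition short_triangles :: "('v set \<Rightarrow> real) set" where
  "short_triangles = {circ a x y z | x y z. x \<in> V \<and> y \<in> V \<and> z \<in> V \<and> dist_v x y + dist_v y z + dist_v z x < M}"

lemma closed_walk_light:
  assumes "xs \<noteq> []" "hd xs = last xs" "set xs \<subseteq> V" "wsum len xs < M"
  shows "wsum a xs \<in> zspan light"
proof -
  have "zspan {z \<in> cycle_vectors D. cycle_weight D w z \<le> wsum len xs} \<subseteq> zspan light"
    using assms(4) by (intro zspan_mono) (auto simp: light_def)
  then show ?thesis using closed_walk_zspan[OF assms(1-3)] by blast
qed

lemma lightE:
  assumes "z \<in> light"
  obtains xs where "xs \<noteq> []" "hd xs = last xs" "set xs \<subseteq> V" "wsum len xs < M" "z = wsum a xs"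
proof -
  obtain vs where vs: "cycle_list vs" "z = cvec vs" using assms by (auto simp: light_def cycle_vectors_eq)
  then have "vs \<noteq> []" by (auto simp: cycle_list_def)
  moreover have "wsum len (vs @ [hd vs]) < M" using assms vs cycle_weight_cvec by (simp add: light_def)
  moreover have "set (vs @ [hd vs]) \<subseteq> V"
    using vs(1) hd_in_set[OF \<open>vs \<noteq> []\<close>] by (auto simp: cycle_list_def)
  ultimately show thesis
    using that[of "vs @ [hd vs]"] vs(2) by (simp add: cvec_def)
qed

text \<open>Cone the closed walk from its first vertex. The cone triangles add up to the walk, and
  the perimeter of each is at most the length of the walk, since the two parts of the walk next to
  its step bound the distances to the apex.\<close>

lemma light_short_triangles: "light \<subseteq> vec.span short_triangles"
proof
  fix z assume "z \<in> light"
  then obtain xs where xs: "xs \<noteq> []" "hd xs = last xs" "set xs \<subseteq> V" "wsum len xs < M" "z = wsum a xs"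
    by (rule lightE)
  let ?h = "\<lambda>u v. circ a (hd xs) u v"
  have tele: "wsum (\<lambda>u v. circ a c u v) ys = wsum a ys + a c (hd ys) - a c (last ys)" if "ys \<noteq> []" for c ys
    using that
  proof (induction ys)
    case (Cons y ys)
    then show ?case using a_anti[of "hd ys" c] by (cases ys) (auto simp: circ_def)
  qed simp
  have "wsum ?h xs \<in> vec.span short_triangles"
  proof (rule wsum_mem)
    fix p u v r assume split: "xs = p @ u # v # r"
    have "wsum len xs = wsum len (p @ [u]) + (len u v + wsum len (v # r))"
      using wsum_append[of len p u "v # r"] by (simp add: split)
    moreover have "dist_v (hd xs) u \<le> wsum len (p @ [u])"
      by (rule dist_v_le) (use xs(3) in \<open>auto simp: split hd_append\<close>)
    moreover have "dist_v u v \<le> wsum len [u, v]"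
      by (rule dist_v_le) (use xs(3) in \<open>auto simp: split\<close>)
    moreover have "dist_v v (hd xs) \<le> wsum len (v # r)"
      by (rule dist_v_le) (use xs(2,3) in \<open>auto simp: split\<close>)
    ultimately have "dist_v (hd xs) u + dist_v u v + dist_v v (hd xs) < M" using xs(4) by simp
    moreover have "hd xs \<in> V" using hd_in_set[OF xs(1)] xs(3) by blast
    moreover have "u \<in> V" "v \<in> V" using xs(3) by (auto simp: split)
    ultimately show "?h u v \<in> vec.span short_triangles"
      by (intro vec.span_base) (auto simp: short_triangles_def)
  qed (auto intro: vec.span_zero vec.span_add)
  then show "z \<in> vec.span short_triangles" using tele[OF xs(1)] xs(2,5) by simp
qed

lemma short_triangles_saturated:
  assumes "card V \<le> 7" "x \<in> vec.span short_triangles" "\<And>e. x e \<in> \<int>"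
  shows "x \<in> zspan short_triangles"
proof -
  let ?T = "{t\<in>triples. pair_weight dist_w t < M}"
  have weight: "pair_weight dist_w {x, y, z} = dist_v x y + dist_v y z + dist_v z x"
    if "x \<noteq> y" "y \<noteq> z" "x \<noteq> z" for x y z
    using that dist_v_sym[of z x] by (simp add: pair_weight_triple dist_v_def)
  have "short_triangles \<subseteq> vec.span (tri ` ?T)"
  proof
    fix c assume "c \<in> short_triangles"
    then obtain x y z where c: "c = circ a x y z" "x \<in> V" "y \<in> V" "z \<in> V"
      "dist_v x y + dist_v y z + dist_v z x < M" by (auto simp: short_triangles_def)
    show "c \<in> vec.span (tri ` ?T)"
    proof (cases "x \<noteq> y \<and> y \<noteq> z \<and> x \<noteq> z")
      case True
      then have "tri {x, y, z} \<in> vec.span (tri ` ?T)"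
        using c weight by (intro vec.span_base) (auto simp: triples_def)
      then show ?thesis using tri_cases[of x y z] True c(1) vec.span_neg[of "tri {x, y, z}"] by auto
    next
      case False
      have "a u v + a v u = 0" for u v by (subst a_anti[of v u]) simp
      then have "c = 0" using False c(1) by (auto simp: circ_def)
      then show ?thesis by (simp add: vec.span_zero)
    qed
  qed
  then have "x \<in> vec.span (tri ` ?T)"
    using assms(2) vec.span_minimal[OF _ vec.subspace_span] by blast
  then have x: "x \<in> zspan (tri ` ?T)"
    using triples_saturated[OF assms(1), of dist_w] dist_w_nonneg assms(3) by blast
  have "tri ` ?T \<subseteq> zspan short_triangles"
  proof
    fix c assume "c \<in> tri ` ?T"
    then obtain t where t: "t \<in> ?T" "c = tri t" by blast
    then obtain x y z where xyz: "t = {x, y, z}" "x \<noteq> y" "y \<noteq> z" "x \<noteq> z"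
      unfolding triples_def card_3_iff by blast
    have "circ a x y z \<in> short_triangles"
      using t xyz weight by (auto simp: short_triangles_def triples_def)
    then show "c \<in> zspan short_triangles"
      using tri_cases[OF xyz(2-4)] t(2) xyz(1) zspan_base zspan_neg by metis
  qed
  then show ?thesis using x zspan_subset_zspan by blast
qed

lemma edge_diff_light:
  assumes "e \<in> pairs V" "w e + dist_w e < M"
  shows "a (tail D e) (head D e) - wsum a (shortest e) \<in> zspan light"
proof -
  let ?P = "shortest e"
  have P: "?P \<noteq> []" "set ?P \<subseteq> V" "hd ?P = tail D e" "last ?P = head D e"
    using shortest(1)[OF assms(1)] by (auto simp: simple_walks_def)
  let ?xs = "?P @ tl [head D e, tail D e]"
  note E = ends_V[OF assms(1)] ends[OF assms(1)]
  have "wsum a ?xs = wsum a ?P + a (head D e) (tail D e)"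
    using wsum_join(1)[of ?P "[head D e, tail D e]" a] P by simp
  then have eq: "a (tail D e) (head D e) - wsum a ?P = - wsum a ?xs"
    using a_anti[of "head D e" "tail D e"] by simp
  have "len (head D e) (tail D e) = w e" using E by (simp add: len_def insert_commute)
  then have "wsum len ?xs = dist_w e + w e"
    using wsum_join(1)[of ?P "[head D e, tail D e]" len] P by (simp add: dist_w_def)
  then have "wsum a ?xs \<in> zspan light"
    using P E assms(2) by (intro closed_walk_light) auto
  then show ?thesis unfolding eq by (rule zspan_neg)
qed

text \<open>A light closed walk through \<open>e\<close> must return between the ends of
  \<open>e\<close>, which takes at least their distance. So edges violating the bound vanish on all
  light cycles.\<close>

lemma light_support:
  assumes "x \<in> vec.span light" "e \<in> pairs V" "x e \<noteq> 0"
  shows "w e + dist_w e < M"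
proof (rule ccontr)
  assume neg: "\<not> ?thesis"
  have "z e = 0" if "z \<in> light" for z
  proof -
    from that obtain xs where xs: "xs \<noteq> []" "hd xs = last xs" "set xs \<subseteq> V" "wsum len xs < M" "z = wsum a xs"
      by (rule lightE)
    have "wsum a xs \<in> {y. y e = 0}"
    proof (rule wsum_mem)
      fix p u v r assume split: "xs = p @ u # v # r"
      have "a u v e = 0"
      proof (rule ccontr)
        assume "a u v e \<noteq> 0"
        then have e: "e = {u, v}" "u \<noteq> v" using ev_supp[of e u v] by auto
        let ?q = "(v # r) @ tl (p @ [u])"
        have hd: "last (v # r) = hd (p @ [u])" using xs(2) by (cases p) (auto simp: split)
        have q: "wsum len ?q = wsum len (v # r) + wsum len (p @ [u])" "hd ?q = v" "last ?q = u"
          using wsum_join[of "v # r" "p @ [u]"] hd by simp_all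
        have "dist_v v u \<le> wsum len ?q"
        proof (rule dist_v_le)
          show "set ?q \<subseteq> V" using xs(3) by (cases p) (auto simp: split)
        qed (use q(2,3) in simp_all)
        moreover have "wsum len xs = wsum len (p @ [u]) + (len u v + wsum len (v # r))"
          using wsum_append[of len p u "v # r"] by (simp add: split)
        moreover have "dist_v v u = dist_w e" "len u v = w e"
          using e by (auto simp: dist_v_def len_def insert_commute)
        ultimately show False using neg xs(4) q(1) by simp
      qed
      then show "a u v \<in> {y. y e = 0}" by simp
    qed auto
    then show ?thesis using xs(5) by simp
  qed
  then have "light \<subseteq> {y. y e = 0}" by blast
  moreover have "vec.subspace {y :: 'v set \<Rightarrow> real. y e = 0}"
    by (rule vec.subspaceI) (auto simp: vec_scale_apply)
  ultimately have "vec.span light \<subseteq> {y. y e = 0}" by (rule vec.span_minimal)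
  then show False using assms(1,3) by blast
qed

definition geo_map :: "('v set \<Rightarrow> real) \<Rightarrow> 'v set \<Rightarrow> real" where
  "geo_map x = (\<Sum>e\<in>pairs V. vec_scale (x e) (wsum a (shortest e)))"

lemma geo_map_add: "geo_map (x + y) = geo_map x + geo_map y"
  by (auto simp: geo_map_def fun_eq_iff sum_fun_apply vec_scale_apply sum.distrib algebra_simps)

lemma geo_map_neg: "geo_map (- x) = - geo_map x"
  by (auto simp: geo_map_def fun_eq_iff sum_fun_apply vec_scale_apply sum_negf)

lemma geo_map_a:
  assumes "u \<in> V" "v \<in> V"
  shows "geo_map (a u v) = geo u v"
proof (cases "u = v")
  case True
  then show ?thesis by (auto simp: geo_map_def geo_def fun_eq_iff sum_fun_apply vec_scale_apply)
next
  case False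
  have "geo_map (a u v) = (\<Sum>e\<in>{{u, v}}. vec_scale (a u v e) (wsum a (shortest e)))"
    unfolding geo_map_def
  proof (rule sum.mono_neutral_right)
    show "\<forall>e\<in>pairs V - {{u, v}}. vec_scale (a u v e) (wsum a (shortest e)) = 0"
      using ev_supp by (auto simp: vec_scale_def fun_eq_iff)
  qed (use finite_pairs_V pair_in[OF assms False] in auto)
  then show ?thesis using False by (simp add: geo_def)
qed

text \<open>The shortest walks along the three sides join to a closed walk whose length is the
  perimeter.\<close>

lemma geo_map_short_triangle:
  assumes "c \<in> short_triangles"
  shows "geo_map c \<in> zspan light"
proof -
  obtain x y z where c: "c = circ a x y z" "x \<in> V" "y \<in> V" "z \<in> V"
    "dist_v x y + dist_v y z + dist_v z x < M" using assms by (auto simp: short_triangles_def)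
  obtain P where P: "P \<noteq> []" "set P \<subseteq> V" "hd P = x" "last P = y" "wsum len P = dist_v x y" "wsum a P = geo x y"
    using geo_walk[OF c(2,3)] .
  obtain Q where Q: "Q \<noteq> []" "set Q \<subseteq> V" "hd Q = y" "last Q = z" "wsum len Q = dist_v y z" "wsum a Q = geo y z"
    using geo_walk[OF c(3,4)] .
  obtain R where R: "R \<noteq> []" "set R \<subseteq> V" "hd R = z" "last R = x" "wsum len R = dist_v z x" "wsum a R = geo z x"
    using geo_walk[OF c(4,2)] .
  let ?PQ = "P @ tl Q"
  have PQ: "wsum f ?PQ = wsum f P + wsum f Q" "hd ?PQ = x" "last ?PQ = z" for f :: "'v \<Rightarrow> 'v \<Rightarrow> 'c :: comm_monoid_add"
    using wsum_join[of P Q] P Q by simp_all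
  have PQR: "wsum f (?PQ @ tl R) = wsum f ?PQ + wsum f R" "hd (?PQ @ tl R) = x" "last (?PQ @ tl R) = x"
    for f :: "'v \<Rightarrow> 'v \<Rightarrow> 'c :: comm_monoid_add"
    using wsum_join[of ?PQ R] P R PQ(2,3) by simp_all
  have "set (tl xs) \<subseteq> set xs" for xs :: "'v list" by (cases xs) auto
  then have "set (tl Q) \<subseteq> V" "set (tl R) \<subseteq> V" using Q(2) R(2) by blast+
  then have "set (?PQ @ tl R) \<subseteq> V" using P(2) by simp
  moreover have "wsum len (?PQ @ tl R) < M" using PQR(1)[of len] PQ(1)[of len] P(5) Q(5) R(5) c(5) by simp
  moreover have "?PQ @ tl R \<noteq> []" using P(1) by simp
  moreover have "hd (?PQ @ tl R) = last (?PQ @ tl R)" using PQR(2,3) by simp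
  ultimately have "wsum a (?PQ @ tl R) \<in> zspan light" by (intro closed_walk_light)
  moreover have "wsum a (?PQ @ tl R) = geo_map c"
    using c(1-4) PQR(1)[of a] PQ(1)[of a] P(6) Q(6) R(6) by (simp add: circ_def geo_map_add geo_map_a)
  ultimately show ?thesis by simp
qed

text \<open>Split \<open>x\<close> into \<open>geo_map x\<close> and the difference. The first is an
  integer combination of images of short triangles, which are light closed walks. The second
  combines, with integer coefficients, edges closed up by a shortest walk, and
  \<open>light_support\<close> makes those that occur light.\<close>

theorem light_saturated:
  assumes "card V \<le> 7" "x \<in> vec.span light" "\<And>e. x e \<in> \<int>"
  shows "x \<in> zspan light"
proof -
  have "vec.span light \<subseteq> vec.span short_triangles"
    using vec.span_minimal[OF light_short_triangles vec.subspace_span] .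
  then have "x \<in> zspan short_triangles" using short_triangles_saturated assms by blast
  then have geo: "geo_map x \<in> zspan light"
  proof induction
    case zspan_0
    have "geo_map 0 = 0" by (auto simp: geo_map_def fun_eq_iff sum_fun_apply vec_scale_apply)
    then show ?case by (simp only: zspan.zspan_0)
  next
    case (zspan_base c)
    then show ?case by (rule geo_map_short_triangle)
  next
    case (zspan_add y z)
    then show ?case by (simp only: geo_map_add zspan.zspan_add)
  next
    case (zspan_neg y)
    then show ?case by (simp only: geo_map_neg zspan.zspan_neg)
  qed
  have "light \<subseteq> cycle_space D"
    by (auto simp: light_def cycle_vectors_eq cvec_in_cycle_space)
  then have "x \<in> cycle_space D" using assms(2) vec.span_minimal[OF _ subspace_cycle_space] by blast
  then have "x e = 0" if "e \<notin> pairs V" for e using that by (simp add: cycle_space_eq)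
  then have x: "x = (\<Sum>e\<in>pairs V. vec_scale (x e) (a (tail D e) (head D e)))" by (rule sum_flow)
  have "x - geo_map x = (\<Sum>e\<in>pairs V. vec_scale (x e) (a (tail D e) (head D e) - wsum a (shortest e)))"
  proof -
    have "(\<Sum>e\<in>pairs V. vec_scale (x e) (a (tail D e) (head D e) - wsum a (shortest e)))
      = (\<Sum>e\<in>pairs V. vec_scale (x e) (a (tail D e) (head D e))) - geo_map x"
      by (auto simp: geo_map_def fun_eq_iff sum_fun_apply vec_scale_apply sum_subtractf algebra_simps)
    then show ?thesis using x by argo
  qed
  also have "\<dots> \<in> zspan light"
  proof (rule zspan_sum)
    fix e assume e: "e \<in> pairs V"
    show "vec_scale (x e) (a (tail D e) (head D e) - wsum a (shortest e)) \<in> zspan light"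
    proof (cases "x e = 0")
      case True
      then have "vec_scale (x e) (a (tail D e) (head D e) - wsum a (shortest e)) = 0"
        by (auto simp: vec_scale_def fun_eq_iff)
      then show ?thesis by (simp only: zspan.zspan_0)
    next
      case False
      then show ?thesis
        using edge_diff_light[OF e light_support[OF assms(2) e]] assms(3) by (intro zspan_scale) auto
    qed
  qed
  finally have "x - geo_map x + geo_map x \<in> zspan light" using geo zspan_add by blast
  then show ?thesis by simp
qed

end

end

subsection \<open>At most seven vertices\<close>

context complete_digraph
begin

lemma cycle_vector_outside: "x \<in> cycle_vectors D \<Longrightarrow> e \<notin> arcs D \<Longrightarrow> x e = 0"
  using cvec_in_cycle_space by (auto simp: cycle_vectors_eq cycle_space_eq arcs_D)

lemma cycle_vector_Ints: "x \<in> cycle_vectors D \<Longrightarrow> x e \<in> \<int>"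
  using cvec_Ints by (auto simp: cycle_vectors_eq)

lemma cycle_weight_neg: "cycle_weight D w (- x) = cycle_weight D w x"
  by (simp add: cycle_weight_def)

theorem opt_in_small:
  assumes card_V: "card V \<le> 7"
  shows "opt_in D"
  unfolding opt_in_def
proof (intro allI impI)
  fix w :: "'v set \<Rightarrow> real"
  assume "\<forall>e\<in>arcs D. 0 \<le> w e"
  then have w_pos: "\<And>e. e \<in> arcs D \<Longrightarrow> 0 \<le> w e" by blast
  have fin_arcs: "finite (arcs D)" using finite_pairs_V by (simp add: arcs_D)
  obtain w' :: "'v set \<Rightarrow> real" where "(\<forall>e\<in>arcs D. 0 < w' e) \<and>
    (\<forall>A\<subseteq>arcs D. \<forall>B\<subseteq>arcs D. sum w A < sum w B \<longrightarrow> sum w' A < sum w' B) \<and>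
    (\<forall>A\<subseteq>arcs D. \<forall>B\<subseteq>arcs D. sum w' A = sum w' B \<longrightarrow> A = B)"
    using perturbation[OF fin_arcs w_pos] by (rule exE)
  then have w': "\<And>e. e \<in> arcs D \<Longrightarrow> 0 < w' e"
    "\<And>A B. A \<subseteq> arcs D \<Longrightarrow> B \<subseteq> arcs D \<Longrightarrow> sum w A < sum w B \<Longrightarrow> sum w' A < sum w' B"
    "\<And>A B. A \<subseteq> arcs D \<Longrightarrow> B \<subseteq> arcs D \<Longrightarrow> sum w' A = sum w' B \<Longrightarrow> A = B" by simp_all
  interpret W': weighted_complete_digraph V D w'
    by unfold_locales (use w'(1) in \<open>auto simp: arcs_D less_imp_le\<close>)
  let ?Z = "cycle_vectors D" and ?\<omega> = "cycle_weight D w" and ?\<omega>' = "cycle_weight D w'"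
  have refine: "?\<omega> b \<le> ?\<omega> z" if "?\<omega>' b \<le> ?\<omega>' z" for b z
  proof (rule ccontr)
    assume "\<not> ?thesis"
    then have "sum w' {e \<in> arcs D. z e \<noteq> 0} < sum w' {e \<in> arcs D. b e \<noteq> 0}"
      by (intro w'(2)) (auto simp: cycle_weight_def)
    then show False using that by (simp add: cycle_weight_def)
  qed
  \<comment> \<open>One of the two vectors with the support of \<open>z\<close>: a cycle and its
    negative have equal weight, so only representatives have distinct weights.\<close>
  define rep where "rep z = (SOME y. y \<in> ?Z \<and> {e. y e \<noteq> 0} = {e. z e \<noteq> 0})" for z :: "'v set \<Rightarrow> real"
  have rep: "rep z \<in> ?Z" "{e. rep z e \<noteq> 0} = {e. z e \<noteq> 0}" if "z \<in> ?Z" for z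
    using someI[of "\<lambda>y. y \<in> ?Z \<and> {e. y e \<noteq> 0} = {e. z e \<noteq> 0}" z] that by (auto simp: rep_def)
  have rep_cong: "rep x = rep y" if "{e. x e \<noteq> 0} = {e. y e \<noteq> 0}" for x y
    by (simp only: rep_def that)
  define I where "I = rep ` ?Z"
  have IZ: "I \<subseteq> ?Z" using rep(1) by (auto simp: I_def)
  have finI: "finite I" using finite_cycle_vectors by (simp add: I_def)
  have supp_arcs: "{e \<in> arcs D. x e \<noteq> 0} = {e. x e \<noteq> 0}" if "x \<in> ?Z" for x
    using cycle_vector_outside[OF that] by blast
  have inj: "inj_on ?\<omega>' I"
  proof (rule inj_onI)
    fix i j assume *: "i \<in> I" "j \<in> I" "?\<omega>' i = ?\<omega>' j"
    then obtain x y where xy: "x \<in> ?Z" "y \<in> ?Z" "i = rep x" "j = rep y" by (auto simp: I_def)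
    have "{e \<in> arcs D. i e \<noteq> 0} = {e \<in> arcs D. j e \<noteq> 0}"
      using *(3) by (intro w'(3)) (auto simp: cycle_weight_def)
    moreover have "i \<in> ?Z" "j \<in> ?Z" using IZ *(1,2) by blast+
    ultimately have "{e. i e \<noteq> 0} = {e. j e \<noteq> 0}" by (simp only: supp_arcs)
    then have "{e. x e \<noteq> 0} = {e. y e \<noteq> 0}"
      unfolding xy(3,4) rep(2)[OF xy(1)] rep(2)[OF xy(2)] .
    then show "i = j" unfolding xy(3,4) by (rule rep_cong)
  qed
  have rep_sign: "z = rep z \<or> z = - rep z" if "z \<in> ?Z" for z
    using same_support[OF rep(1)[OF that] that rep(2)[OF that]] .
  have rep_weight: "?\<omega>' (rep z) = ?\<omega>' z" if "z \<in> ?Z" for z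
    using rep_sign[OF that] cycle_weight_neg by metis
  define B where "B = {i\<in>I. i \<notin> vec.span ((\<lambda>x. x) ` {j\<in>I. ?\<omega>' j < ?\<omega>' i})}"
  note greedy = greedy_basis[where v = "\<lambda>x. x", OF finI inj, folded B_def]
  have indep: "vec.independent B" using greedy(2) by simp
  have span_I: "i \<in> vec.span {b\<in>B. ?\<omega>' b \<le> ?\<omega>' i}" if "i \<in> I" for i using greedy(3)[OF that] by simp
  have BI: "B \<subseteq> I" by (auto simp: B_def)
  have span_le: "z \<in> vec.span {b\<in>B. ?\<omega>' b \<le> ?\<omega>' z}" if z: "z \<in> ?Z" for z
  proof -
    have "rep z \<in> I" using z by (simp add: I_def)
    then have "rep z \<in> vec.span {b\<in>B. ?\<omega>' b \<le> ?\<omega>' z}" using span_I rep_weight[OF z] by metis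
    then show ?thesis using rep_sign[OF z] vec.span_neg by metis
  qed
  have "?Z \<subseteq> vec.span B"
  proof
    fix z assume "z \<in> ?Z"
    moreover have "vec.span {b\<in>B. ?\<omega>' b \<le> ?\<omega>' z} \<subseteq> vec.span B" by (rule vec.span_mono) blast
    ultimately show "z \<in> vec.span B" using span_le by blast
  qed
  then have "vec.span ?Z \<subseteq> vec.span B" using vec.span_minimal[OF _ vec.subspace_span] by blast
  moreover have "vec.span B \<subseteq> vec.span ?Z" using BI IZ by (intro vec.span_mono) blast
  ultimately have span_B: "vec.span B = cycle_space D" using span_cycle_vectors by blast
  have dcb: "directed_cycle_basis D B"
    using BI IZ indep span_B by (auto simp: directed_cycle_basis_def)
  have finB: "finite B" using finite_subset[OF BI finI] .
  have min: "basis_weight D w B \<le> basis_weight D w B2" if "directed_cycle_basis D B2" for B2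
    unfolding basis_weight_def
  proof (rule basis_weight_le)
    have B2: "B2 \<subseteq> ?Z" "vec.independent B2" "vec.span B2 = cycle_space D"
      using that by (auto simp: directed_cycle_basis_def)
    show "finite B2" using finite_subset[OF B2(1) finite_cycle_vectors] .
    show "vec.independent B2" "vec.span B = vec.span B2" using B2 span_B by auto
    fix z assume "z \<in> B2"
    then have "z \<in> vec.span {b\<in>B. ?\<omega>' b \<le> ?\<omega>' z}" using span_le B2(1) by blast
    moreover have "{b\<in>B. ?\<omega>' b \<le> ?\<omega>' z} \<subseteq> {b\<in>B. ?\<omega> b \<le> ?\<omega> z}" using refine by blast
    ultimately show "z \<in> vec.span {b\<in>B. ?\<omega> b \<le> ?\<omega> z}" using vec.span_mono by blast
  qed (use finB indep in auto)
  \<comment> \<open>Induction on the number of lighter cycles. A rejected cycle is in the real span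
    of cycles lighter than itself, so \<open>light_saturated\<close> applies with its own weight as
    threshold.\<close>
  have zspan_B: "z \<in> zspan B" if "z \<in> ?Z" for z
    using that
  proof (induction "card {y\<in>?Z. ?\<omega>' y < ?\<omega>' z}" arbitrary: z rule: less_induct)
    case less
    have I: "rep z \<in> I" using less.prems by (simp add: I_def)
    have "rep z \<in> zspan B"
    proof (cases "rep z \<in> B")
      case True
      then show ?thesis by (rule zspan_base)
    next
      case False
      let ?M = "?\<omega>' z"
      have "{j\<in>I. ?\<omega>' j < ?\<omega>' (rep z)} \<subseteq> W'.light ?M"
        using IZ rep_weight[OF less.prems] by (auto simp: W'.light_def)
      then have "rep z \<in> vec.span (W'.light ?M)"
        using False I vec.span_mono by (auto simp: B_def)
      then have *: "rep z \<in> zspan (W'.light ?M)"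
        by (rule W'.light_saturated[OF card_V]) (rule cycle_vector_Ints[OF rep(1)[OF less.prems]])
      have "W'.light ?M \<subseteq> zspan B"
      proof
        fix y assume "y \<in> W'.light ?M"
        then have y: "y \<in> ?Z" "?\<omega>' y < ?\<omega>' z" by (auto simp: W'.light_def)
        have "{x\<in>?Z. ?\<omega>' x < ?\<omega>' y} \<subset> {x\<in>?Z. ?\<omega>' x < ?\<omega>' z}" using y by force
        then have "card {x\<in>?Z. ?\<omega>' x < ?\<omega>' y} < card {x\<in>?Z. ?\<omega>' x < ?\<omega>' z}"
          using finite_cycle_vectors by (intro psubset_card_mono) auto
        then show "y \<in> zspan B" using less.hyps y(1) by blast
      qed
      then show ?thesis using * zspan_subset_zspan by blast
    qed
    then show ?case using rep_sign[OF less.prems] zspan_neg by metis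
  qed
  then have icb: "integral_cycle_basis D B"
    using dcb zspan_finite_coeffs[OF _ finB] by (auto simp: integral_cycle_basis_def)
  have "is_arg_min (basis_weight D w) (directed_cycle_basis D) B"
    using dcb min by (auto simp: is_arg_min_def not_less)
  moreover have "is_arg_min (basis_weight D w) (integral_cycle_basis D) B"
    using icb min by (auto simp: is_arg_min_def not_less integral_cycle_basis_def)
  ultimately show "\<exists>B B'. is_arg_min (basis_weight D w) (directed_cycle_basis D) B \<and>
      is_arg_min (basis_weight D w) (integral_cycle_basis D) B' \<and>
      basis_weight D w B = basis_weight D w B'" by blast
qed

end

subsection \<open>At least eight vertices\<close>

text \<open>Pairs that are not listed get weight 19, more than the total weight 18 allowed for a light
  cycle.\<close>

definition weight_table :: "((nat \<times> nat) \<times> nat) list" where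
  "weight_table = [((1, 4), 5), ((1, 5), 3), ((1, 7), 6), ((1, 8), 6), ((2, 3), 7), ((2, 4), 5),
     ((2, 5), 5), ((2, 7), 7), ((2, 8), 5), ((3, 4), 7), ((3, 5), 6), ((3, 6), 6), ((3, 7), 4),
     ((4, 6), 5), ((4, 7), 7), ((5, 6), 6), ((6, 8), 3), ((7, 8), 6)]"

definition table_weight :: "nat \<Rightarrow> nat \<Rightarrow> nat" where
  "table_weight u v = (case map_of weight_table (min u v, max u v) of Some c \<Rightarrow> c | None \<Rightarrow> 19)"

text \<open>The faces of an embedding of the weighted edges in the projective plane, oriented so that
  their boundaries add up to twice the noncontractible cycle \<open>234\<close>.\<close>

definition faces :: "nat list list" where
  "faces = [[7, 4, 1], [8, 7, 1], [2, 3, 5], [2, 3, 7], [2, 7, 8], [3, 4, 6], [3, 4, 7], [6, 5, 3],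
     [1, 5, 6, 8], [5, 1, 4, 2], [6, 4, 2, 8]]"

definition is_face :: "nat list \<Rightarrow> bool" where
  "is_face vs \<longleftrightarrow> list_ex (\<lambda>f. list_ex (\<lambda>k. vs = rotate k f \<or> vs = rotate k (rev f)) [0..<length f]) faces"

text \<open>All but three edges weigh at least 5, so light cycles have at most four edges.\<close>

definition slack :: "nat set \<Rightarrow> nat" where
  "slack e = (if e = {1, 5} then 2 else 0) + (if e = {6, 8} then 2 else 0) + (if e = {3, 7} then 1 else 0)"

lemma table_weight_slack: "5 \<le> table_weight u v + slack {u, v}"
proof (cases "map_of weight_table (min u v, max u v)")
  case None
  then show ?thesis by (simp add: table_weight_def)
next
  case (Some c)
  then have "((min u v, max u v), c) \<in> set weight_table" by (rule map_of_SomeD)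
  moreover have "\<forall>((p, q), c)\<in>set weight_table. 5 \<le> c + slack {p, q}"
    by (simp add: weight_table_def slack_def doubleton_eq_iff)
  moreover have "{u, v} = {min u v, max u v}" by (auto simp: min_def max_def)
  ultimately have "5 \<le> c + slack {u, v}" by auto
  then show ?thesis using Some by (simp add: table_weight_def)
qed

text \<open>The same table as neighbour lists, so that evaluation follows only walks along listed
  edges; \<open>light_neighbour\<close> proves the agreement.\<close>

definition adjacency :: "(nat \<times> (nat \<times> nat) list) list" where
  "adjacency = [(1, [(4, 5), (5, 3), (7, 6), (8, 6)]),
     (2, [(3, 7), (4, 5), (5, 5), (7, 7), (8, 5)]),
     (3, [(2, 7), (4, 7), (5, 6), (6, 6), (7, 4)]),
     (4, [(1, 5), (2, 5), (3, 7), (6, 5), (7, 7)]),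
     (5, [(1, 3), (2, 5), (3, 6), (6, 6)]),
     (6, [(3, 6), (4, 5), (5, 6), (8, 3)]),
     (7, [(1, 6), (2, 7), (3, 4), (4, 7), (8, 6)]),
     (8, [(1, 6), (2, 5), (6, 3), (7, 6)])]"

definition light_neighbours :: "nat \<Rightarrow> (nat \<times> nat) list" where
  "light_neighbours u = (case map_of adjacency u of Some l \<Rightarrow> l | None \<Rightarrow> [])"

lemma list_allD: "list_all P xs \<Longrightarrow> x \<in> set xs \<Longrightarrow> P x"
  by (simp add: list_all_iff)

lemma light_triples:
  "list_all (\<lambda>(x, nx). list_all (\<lambda>(y, c1). list_all (\<lambda>(z, c2).
     case map_of (light_neighbours z) x of None \<Rightarrow> True | Some c3 \<Rightarrow> 18 < c1 + c2 + c3 \<or> is_face [x, y, z])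
     (light_neighbours y)) nx) adjacency"
  by code_simp

lemma light_quadruples:
  "list_all (\<lambda>(x, nx). list_all (\<lambda>(y, c1). list_all (\<lambda>(z, c2). list_all (\<lambda>(t, c3).
     z = x \<or> t = y \<or> 18 < c1 + c2 + c3 \<or>
     (case map_of (light_neighbours t) x of None \<Rightarrow> True | Some c4 \<Rightarrow> 18 < c1 + c2 + c3 + c4 \<or> is_face [x, y, z, t]))
     (light_neighbours z)) (light_neighbours y)) nx) adjacency"
  by code_simp

lemma light_faces:
  "list_all (\<lambda>f. 3 \<le> length f \<and> distinct f \<and> list_all (\<lambda>u. 1 \<le> u \<and> u \<le> 8) f \<and>
     sum_list (map (\<lambda>i. table_weight (f ! i) (f ! (Suc i mod length f))) [0..<length f]) \<le> 18) faces"
  by code_simp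

lemma light_neighbour:
  assumes "table_weight u v \<le> 18"
  shows "(u, light_neighbours u) \<in> set adjacency" "(v, table_weight u v) \<in> set (light_neighbours u)"
    "map_of (light_neighbours u) v = Some (table_weight u v)" "u \<in> {1..8}"
proof -
  obtain c where c: "map_of weight_table (min u v, max u v) = Some c"
    using assms by (auto simp: table_weight_def split: option.splits)
  then have "((min u v, max u v), c) \<in> set weight_table" by (rule map_of_SomeD)
  moreover have "\<forall>((p, q), c)\<in>set weight_table.
      (p, light_neighbours p) \<in> set adjacency \<and> (q, c) \<in> set (light_neighbours p) \<and>
      map_of (light_neighbours p) q = Some c \<and> p \<in> {1..8} \<and>
      (q, light_neighbours q) \<in> set adjacency \<and> (p, c) \<in> set (light_neighbours q) \<and>
      map_of (light_neighbours q) p = Some c \<and> q \<in> {1..8}"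
    by (simp add: weight_table_def light_neighbours_def adjacency_def)
  moreover have "table_weight u v = c" using c by (simp add: table_weight_def)
  moreover have "min u v = u \<and> max u v = v \<or> min u v = v \<and> max u v = u" by (simp add: min_def max_def)
  ultimately show "(u, light_neighbours u) \<in> set adjacency" "(v, table_weight u v) \<in> set (light_neighbours u)"
    "map_of (light_neighbours u) v = Some (table_weight u v)" "u \<in> {1..8}"
    by auto
qed

text \<open>Pairs with a vertex above 8 fall under the default weight 19, so one function handles
  all \<open>n \<ge> 8\<close>.\<close>

definition hard_weight :: "nat set \<Rightarrow> real" where
  "hard_weight e = real (table_weight (Min e) (Max e))"

lemma hard_weight_pair: "u \<noteq> v \<Longrightarrow> hard_weight {u, v} = real (table_weight u v)"
  by (cases "u < v") (simp_all add: hard_weight_def table_weight_def min_def max_def)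

text \<open>Coefficients are indexed by \<open>J\<close> instead of by vectors, so \<open>f\<close>
  need not be injective.\<close>

lemma span_image_sum:
  assumes "finite J" "y \<in> vec.span (f ` J)"
  obtains r where "y = (\<Sum>j\<in>J. vec_scale (r j) (f j))"
proof -
  have "vec.subspace {\<Sum>j\<in>J. vec_scale (r j) (f j) | r. True}"
  proof (rule vec.subspaceI)
    have "0 = (\<Sum>j\<in>J. vec_scale 0 (f j))" by (simp add: vec.scale_zero_left)
    then show "0 \<in> {\<Sum>j\<in>J. vec_scale (r j) (f j) | r. True}"
      by (intro CollectI exI[of _ "\<lambda>_. 0"]) blast
  next
    fix x y assume "x \<in> {\<Sum>j\<in>J. vec_scale (r j) (f j) | r. True}" "y \<in> {\<Sum>j\<in>J. vec_scale (r j) (f j) | r. True}"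
    then obtain r s where "x = (\<Sum>j\<in>J. vec_scale (r j) (f j))" "y = (\<Sum>j\<in>J. vec_scale (s j) (f j))" by blast
    then have "x + y = (\<Sum>j\<in>J. vec_scale (r j + s j) (f j))" by (simp add: vec.scale_left_distrib sum.distrib)
    then show "x + y \<in> {\<Sum>j\<in>J. vec_scale (r j) (f j) | r. True}"
      by (intro CollectI exI[of _ "\<lambda>j. r j + s j"]) blast
  next
    fix c x assume "x \<in> {\<Sum>j\<in>J. vec_scale (r j) (f j) | r. True}"
    then obtain r where "x = (\<Sum>j\<in>J. vec_scale (r j) (f j))" by blast
    then have "vec_scale c x = (\<Sum>j\<in>J. vec_scale (c * r j) (f j))" by (simp add: vec.scale_sum_right)
    then show "vec_scale c x \<in> {\<Sum>j\<in>J. vec_scale (r j) (f j) | r. True}"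
      by (intro CollectI exI[of _ "\<lambda>j. c * r j"]) blast
  qed
  moreover have "f ` J \<subseteq> {\<Sum>j\<in>J. vec_scale (r j) (f j) | r. True}"
  proof
    fix x assume "x \<in> f ` J"
    then obtain i where i: "i \<in> J" "x = f i" by blast
    have "(\<Sum>j\<in>J. vec_scale (of_bool (j = i)) (f j)) = (\<Sum>j\<in>{i}. vec_scale (of_bool (j = i)) (f j))"
      using assms(1) i(1) by (intro sum.mono_neutral_right) (auto simp: vec.scale_zero_left)
    then have "x = (\<Sum>j\<in>J. vec_scale (of_bool (j = i)) (f j))" using i(2) by (simp add: vec.scale_one)
    then show "x \<in> {\<Sum>j\<in>J. vec_scale (r j) (f j) | r. True}"
      by (intro CollectI exI[of _ "\<lambda>j. of_bool (j = i)"]) blast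
  qed
  ultimately have "vec.span (f ` J) \<subseteq> {\<Sum>j\<in>J. vec_scale (r j) (f j) | r. True}"
    by (rule vec.span_minimal[rotated])
  then show thesis using assms(2) that by blast
qed

context complete_digraph
begin

lemma cvec_rotate: "cvec (rotate k vs) = cvec vs"
proof (induction k)
  case (Suc k)
  have "cvec (rotate1 us) = cvec us" for us
  proof (cases us)
    case (Cons x ys)
    show ?thesis
    proof (cases ys)
      case (Cons y zs)
      then show ?thesis using \<open>us = x # ys\<close> wsum_append[of a "y # zs" x "[y]"]
        by (simp add: cvec_def add.commute)
    qed (simp add: \<open>us = x # ys\<close>)
  qed simp
  then show ?case using Suc by (simp add: rotate_def)
qed simp

lemma cvec_rev: assumes "vs \<noteq> []" shows "cvec (rev vs) = - cvec vs"
proof -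
  obtain x ys where vs: "vs = x # ys" using assms by (cases vs) auto
  have "cvec (rev vs) = cvec (rotate 1 (x # rev ys))" by (simp add: vs)
  also have "\<dots> = cvec (x # rev ys)" by (rule cvec_rotate)
  also have "\<dots> = wsum a (rev (x # ys @ [x]))" by (simp add: cvec_def)
  also have "\<dots> = wsum (\<lambda>u v. - a u v) (x # ys @ [x])" by (rule wsum_rev) (rule a_anti)
  also have "\<dots> = - cvec vs" by (simp only: wsum_neg) (simp add: cvec_def vs)
  finally show ?thesis .
qed

text \<open>The entry at \<open>uv\<close> read in the direction from \<open>u\<close> to
  \<open>v\<close>, which makes the coordinates of the faces the same for every orientation
  \<open>D\<close>.\<close>

definition coord :: "'v \<Rightarrow> 'v \<Rightarrow> ('v set \<Rightarrow> real) \<Rightarrow> real" where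
  "coord u v x = a u v {u, v} * x {u, v}"

lemma coord_linear:
  "coord u v (x + y) = coord u v x + coord u v y" "coord u v (vec_scale c x) = c * coord u v x" "coord u v 0 = 0"
  by (simp_all add: coord_def vec_scale_apply algebra_simps)

lemma coord_a:
  assumes "u \<in> V" "v \<in> V" "u \<noteq> v"
  shows "coord u v (a p q) = (if p = u \<and> q = v then 1 else if p = v \<and> q = u then - 1 else 0)"
proof -
  have one: "a u v {u, v} * a u v {u, v} = 1"
    using a_unit[OF assms] by (metis abs_mult_self_eq mult_1)
  consider "p = u \<and> q = v" | "p = v \<and> q = u" "\<not> (p = u \<and> q = v)" | "\<not> (p = u \<and> q = v)" "\<not> (p = v \<and> q = u)" by blast
  then show ?thesis
  proof cases
    case 1
    then show ?thesis using one by (simp add: coord_def)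
  next
    case 2
    have "a v u {u, v} = - a u v {u, v}" by (subst a_anti) simp
    then show ?thesis using 2 one by (simp add: coord_def)
  next
    case 3
    then have "{u, v} \<noteq> {p, q}" by (auto simp: doubleton_eq_iff)
    then have "a p q {u, v} = 0" by (rule ev_supp)
    then show ?thesis using 3 unfolding coord_def by auto
  qed
qed

lemma sum_nxt:
  "(\<Sum>i<length [x, y, z]. f ([x, y, z] ! i) (nxt [x, y, z] i)) = f x y + f y z + (f z x :: nat)"
  "(\<Sum>i<length [x, y, z, t]. f ([x, y, z, t] ! i) (nxt [x, y, z, t] i)) = f x y + f y z + f z t + (f t x :: nat)"
  by (simp_all add: nxt_def lessThan_nat_numeral)

end

lemma length_3_cases:
  assumes "length vs = 3"
  obtains x y z where "vs = [x, y, z]"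
  using assms by (auto simp: numeral_eq_Suc length_Suc_conv)

lemma length_4_cases:
  assumes "length vs = 4"
  obtains x y z t where "vs = [x, y, z, t]"
  using assms by (auto simp: numeral_eq_Suc length_Suc_conv)

lemma functional_sum:
  assumes "\<And>y z. f (y + z) = f y + f z" "\<And>c y. f (vec_scale c y) = c * (f y :: real)"
  shows "f (\<Sum>i\<in>I. vec_scale (c i) (g i)) = (\<Sum>i\<in>I. c i * f (g i))"
proof -
  have "f 0 = 0" using assms(1)[of 0 0] by simp
  then show ?thesis by (induction I rule: infinite_finite_induct) (simp_all add: assms)
qed

theorem not_opt_in_large:
  fixes D :: "(nat, nat set) pre_digraph"
  assumes D: "complete_digraph {1..n} D" and n: "8 \<le> n"
  shows "\<not> opt_in D"
proof
  assume opt: "opt_in D"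
  interpret complete_digraph "{1..n}" D by (rule D)
  note [simp del] = One_nat_def
  let ?Z = "cycle_vectors D" and ?\<omega> = "cycle_weight D hard_weight"
  define fv where "fv i = cvec (faces ! i)" for i
  have [simp]: "{..<1::nat} = {0}" by auto
  have in_V: "u \<in> {1..n}" if "u \<in> {1..8}" for u using that n by auto
  have table_sum: "?\<omega> (cvec vs) = real (\<Sum>i<length vs. table_weight (vs ! i) (nxt vs i))" if "cycle_list vs" for vs
  proof -
    have "vs \<noteq> []" using that unfolding cycle_list_def by auto
    then have "?\<omega> (cvec vs) = (\<Sum>i<length vs. hard_weight {vs ! i, nxt vs i})"
      by (simp add: cvec_weight[OF that] wsum_closed_conv_sum nxt_def)
    also have "\<dots> = (\<Sum>i<length vs. real (table_weight (vs ! i) (nxt vs i)))"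
      using cycle_list_edge(3)[OF that] by (intro sum.cong) (auto simp: hard_weight_pair)
    finally show ?thesis by simp
  qed
  have light_face: "is_face vs" if vs: "cycle_list vs" "?\<omega> (cvec vs) \<le> 18" for vs
  proof -
    let ?k = "length vs" and ?e = "\<lambda>i. {vs ! i, nxt vs i}"
    have le: "(\<Sum>i<?k. table_weight (vs ! i) (nxt vs i)) \<le> 18"
      by (rule of_nat_le_iff[where 'a = real, THEN iffD1]) (use vs(2) table_sum[OF vs(1)] in simp)
    have inj: "inj_on ?e {..<?k}" using cycle_list_edges_inj[OF vs(1)] by (auto intro!: inj_onI)
    have "(\<Sum>i<?k. slack (?e i)) = (\<Sum>e\<in>?e ` {..<?k}. slack e)" by (simp add: sum.reindex[OF inj])
    also have "\<dots> \<le> 5" by (simp add: slack_def sum.distrib)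
    finally have slack: "(\<Sum>i<?k. slack (?e i)) \<le> 5" .
    have "5 * ?k = (\<Sum>i<?k. 5)" by simp
    also have "\<dots> \<le> (\<Sum>i<?k. table_weight (vs ! i) (nxt vs i) + slack (?e i))"
      by (rule sum_mono) (rule table_weight_slack)
    \<comment> \<open>Five times the length is at most 18 + 5.\<close>
    finally have "?k \<le> 4" using le slack by (simp add: sum.distrib)
    moreover have "3 \<le> ?k" using vs(1) by (simp add: cycle_list_def)
    ultimately have "?k = 3 \<or> ?k = 4" by arith
    then consider "?k = 3" | "?k = 4" by blast
    then show ?thesis
    proof cases
      case 1
      then obtain x y z where xyz: "vs = [x, y, z]" by (rule length_3_cases)
      have sum: "table_weight x y + table_weight y z + table_weight z x \<le> 18"
        using le unfolding xyz sum_nxt .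
      then have l: "table_weight x y \<le> 18" "table_weight y z \<le> 18" "table_weight z x \<le> 18" by simp_all
      note * = light_triples[THEN list_allD, OF light_neighbour(1)[OF l(1)], unfolded prod.case,
          THEN list_allD, OF light_neighbour(2)[OF l(1)], unfolded prod.case,
          THEN list_allD, OF light_neighbour(2)[OF l(2)], unfolded prod.case]
      show ?thesis using * sum light_neighbour(3)[OF l(3)] xyz by simp
    next
      case 2
      then obtain x y z t where xyz: "vs = [x, y, z, t]" by (rule length_4_cases)
      then have dist: "z \<noteq> x" "t \<noteq> y" using vs(1) by (auto simp: cycle_list_def)
      have sum: "table_weight x y + table_weight y z + table_weight z t + table_weight t x \<le> 18"
        using le unfolding xyz sum_nxt .
      then have l: "table_weight x y \<le> 18" "table_weight y z \<le> 18" "table_weight z t \<le> 18" "table_weight t x \<le> 18"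
        by simp_all
      note * = light_quadruples[THEN list_allD, OF light_neighbour(1)[OF l(1)], unfolded prod.case,
          THEN list_allD, OF light_neighbour(2)[OF l(1)], unfolded prod.case,
          THEN list_allD, OF light_neighbour(2)[OF l(2)], unfolded prod.case,
          THEN list_allD, OF light_neighbour(2)[OF l(3)], unfolded prod.case]
      show ?thesis using * dist sum light_neighbour(3)[OF l(4)] xyz by simp
    qed
  qed
  have is_face_cvec: "\<exists>i<11. cvec vs = fv i \<or> cvec vs = - fv i" if "is_face vs" for vs
  proof -
    obtain f k where f: "f \<in> set faces" "vs = rotate k f \<or> vs = rotate k (rev f)"
      using \<open>is_face vs\<close> unfolding is_face_def list_ex_iff by blast
    then obtain i where "i < length faces" "f = faces ! i" by (metis in_set_conv_nth)
    moreover have "length faces = 11" by (simp add: faces_def)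
    moreover have "f \<noteq> []" using f(1) by (auto simp: faces_def)
    then have "cvec vs = cvec f \<or> cvec vs = - cvec f"
      using f(2) cvec_rotate cvec_rev by metis
    ultimately show ?thesis unfolding fv_def by auto
  qed
  have light_fv: "\<exists>i<11. z = fv i \<or> z = - fv i" if "z \<in> ?Z" "?\<omega> z \<le> 18" for z
  proof -
    obtain vs where "cycle_list vs" "z = cvec vs" using \<open>z \<in> ?Z\<close> by (auto simp: cycle_vectors_eq)
    then show ?thesis using light_face is_face_cvec that(2) by blast
  qed
  have face_cycles: "\<forall>f\<in>set faces. cycle_list f \<and> (\<Sum>i<length f. table_weight (f ! i) (nxt f i)) \<le> 18"
  proof
    fix f assume "f \<in> set faces"
    note * = light_faces[THEN list_allD, OF this]
    have "set f \<subseteq> {1..n}" using * n by (auto simp: list_all_iff)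
    then show "cycle_list f \<and> (\<Sum>i<length f. table_weight (f ! i) (nxt f i)) \<le> 18"
      using * by (simp add: cycle_list_def nxt_def sum_list_sum_nth atLeast0LessThan)
  qed
  have fv: "fv i \<in> ?Z" "?\<omega> (fv i) \<le> 18" if "i < 11" for i
  proof -
    have "faces ! i \<in> set faces" by (rule nth_mem) (use that in \<open>simp add: faces_def\<close>)
    then have c: "cycle_list (faces ! i)"
      and le: "(\<Sum>j<length (faces ! i). table_weight (faces ! i ! j) (nxt (faces ! i) j)) \<le> 18"
      using face_cycles by blast+
    show "fv i \<in> ?Z" unfolding fv_def cycle_vectors_eq using c by blast
    show "?\<omega> (fv i) \<le> 18"
      unfolding fv_def table_sum[OF c] using of_nat_mono[OF le, where 'a = real] by simp
  qed
  have indep: "r i = 0" if zero: "(\<Sum>i<11. vec_scale (r i) (fv i)) = 0" and i: "i < 11" for r i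
  proof -
    have c: "(\<Sum>i<11. r i * coord u v (fv i)) = 0" for u v
      using functional_sum[of "coord u v" r fv "{..<11}"] coord_linear zero by metis
    have coords: "coord u v (a p q) = (if p = u \<and> q = v then 1 else if p = v \<and> q = u then - 1 else 0)"
      if "u \<in> {1..8}" "v \<in> {1..8}" "u \<noteq> v" for u v p q
      by (rule coord_a) (use in_V that in auto)
    \<comment> \<open>Each of the 18 listed edges lies on exactly two faces. They traverse it in
      opposite directions, except on 23, 34 and 24. The other fifteen equations make all
      coefficients equal, and these three then force them to be zero.\<close>
    have "r 0 = 0 \<and> r 1 = 0 \<and> r 2 = 0 \<and> r 3 = 0 \<and> r 4 = 0 \<and> r 5 = 0 \<and> r 6 = 0 \<and> r 7 = 0 \<and> r 8 = 0 \<and> r 9 = 0 \<and> r 10 = 0"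
      using c[of 1 4] c[of 1 5] c[of 1 7] c[of 1 8] c[of 2 3] c[of 2 4] c[of 2 5] c[of 2 7] c[of 2 8]
        c[of 3 4] c[of 3 5] c[of 3 6] c[of 3 7] c[of 4 6] c[of 4 7] c[of 5 6] c[of 6 8] c[of 7 8]
      by (simp add: fv_def faces_def cvec_def coord_linear coords lessThan_nat_numeral)
    moreover have "i = 0 \<or> i = 1 \<or> i = 2 \<or> i = 3 \<or> i = 4 \<or> i = 5 \<or> i = 6 \<or> i = 7 \<or> i = 8 \<or> i = 9 \<or> i = 10"
      using i by arith
    ultimately show ?thesis by auto
  qed
  have fv_notin: "fv i \<notin> vec.span (fv ` ({..<11} - {i}))" if i: "i < 11" for i
  proof
    assume "fv i \<in> vec.span (fv ` ({..<11} - {i}))"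
    from span_image_sum[OF finite_Diff[OF finite_lessThan] this]
    obtain r where r: "fv i = (\<Sum>j\<in>{..<11} - {i}. vec_scale (r j) (fv j))" by blast
    let ?r = "\<lambda>j. if j = i then - 1 else r j"
    have "(\<Sum>j<11. vec_scale (?r j) (fv j)) = vec_scale (?r i) (fv i) + (\<Sum>j\<in>{..<11} - {i}. vec_scale (?r j) (fv j))"
      using i by (intro sum.remove) auto
    also have "(\<Sum>j\<in>{..<11} - {i}. vec_scale (?r j) (fv j)) = fv i"
      unfolding r by (intro sum.cong) auto
    also have "vec_scale (?r i) (fv i) = - fv i" by (auto simp: fun_eq_iff vec_scale_apply)
    also have "- fv i + fv i = 0" by (rule left_minus)
    finally have "?r i = 0" by (rule indep[of ?r, OF _ i])
    then show False by simp
  qed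
  have "\<forall>e\<in>arcs D. 0 \<le> hard_weight e" by (simp add: hard_weight_def)
  then obtain B B' where B: "is_arg_min (basis_weight D hard_weight) (directed_cycle_basis D) B"
      "is_arg_min (basis_weight D hard_weight) (integral_cycle_basis D) B'"
      "basis_weight D hard_weight B = basis_weight D hard_weight B'"
    using opt unfolding opt_in_def by blast
  have icb: "integral_cycle_basis D B'" using B(2) by (simp add: is_arg_min_def)
  then have dcb: "B' \<subseteq> ?Z" "vec.independent B'" "vec.span B' = cycle_space D"
    by (auto simp: integral_cycle_basis_def directed_cycle_basis_def)
  have finB': "finite B'" using finite_subset[OF dcb(1) finite_cycle_vectors] .
  \<comment> \<open>This is where \<open>opt_in\<close> is used: the integral basis
    \<open>B'\<close> is minimum among all directed bases.\<close>
  have min: "sum ?\<omega> B' \<le> sum ?\<omega> B2"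
    if "B2 \<subseteq> ?Z" "vec.independent B2" "vec.span B2 = vec.span B'" for B2
  proof -
    have "directed_cycle_basis D B2" using that dcb(3) by (auto simp: directed_cycle_basis_def)
    then have "\<not> basis_weight D hard_weight B2 < basis_weight D hard_weight B"
      using B(1) by (auto simp: is_arg_min_def)
    then show ?thesis using B(3) by (simp add: basis_weight_def)
  qed
  \<comment> \<open>In a minimum basis the face is spanned by members of weight at most 18, which
    are faces up to sign; if it were missing, it would be spanned by the other faces.\<close>
  have face_in: "fv i \<in> B' \<or> - fv i \<in> B'" if i: "i < 11" for i
  proof (rule ccontr)
    assume neg: "\<not> ?thesis"
    let ?S = "vec.span (fv ` ({..<11} - {i}))"
    have "fv i \<in> vec.span B'" 
      unfolding dcb(3) span_cycle_vectors[symmetric] by (rule vec.span_base[OF fv(1)[OF i]])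
    then have "fv i \<in> vec.span {b\<in>B'. ?\<omega> b \<le> ?\<omega> (fv i)}"
      using min_basis_span[OF finB' dcb(1,2) min fv(1)[OF i]] by blast
    moreover have "{b\<in>B'. ?\<omega> b \<le> ?\<omega> (fv i)} \<subseteq> ?S"
    proof
      fix b assume b: "b \<in> {b\<in>B'. ?\<omega> b \<le> ?\<omega> (fv i)}"
      then have "b \<in> ?Z" "?\<omega> b \<le> 18" using dcb(1) fv(2)[OF i] by auto
      then obtain j where j: "j < 11" "b = fv j \<or> b = - fv j" using light_fv by blast
      then have "j \<noteq> i" using neg b by blast
      then have "fv j \<in> ?S" using j(1) by (intro vec.span_base) auto
      then show "b \<in> ?S" using j(2) vec.span_neg by blast
    qed
    then have "vec.span {b\<in>B'. ?\<omega> b \<le> ?\<omega> (fv i)} \<subseteq> ?S"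
      by (rule vec.span_minimal) (rule vec.subspace_span)
    ultimately show False using fv_notin[OF i] by blast
  qed
  \<comment> \<open>The functional dual to \<open>b0\<close> kills all faces but the first. It turns
    the doubled cycle into an odd number, although the cycle itself has an integer value.\<close>
  obtain b0 where b0: "b0 \<in> B'" "b0 = fv 0 \<or> b0 = - fv 0" using face_in[of 0] by auto
  have "b0 \<notin> vec.span (B' - {b0})" using dcb(2) b0(1) by (auto simp: vec.dependent_def)
  then obtain f :: "(nat set \<Rightarrow> real) \<Rightarrow> real" where f: "\<And>y z. f (y + z) = f y + f z" "\<And>c y. f (vec_scale c y) = c * f y"
    "\<And>b. b \<in> B' - {b0} \<Longrightarrow> f b = 0" "f b0 = 1"
    using separating_functional[of b0 "B' - {b0}"] by blast
  have f_neg: "f (- y) = - f y" for y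
  proof -
    have "- y = vec_scale (- 1) y" by (auto simp: fun_eq_iff vec_scale_apply)
    then show ?thesis using f(2)[of "- 1" y] by simp
  qed
  have f_fv: "f (fv j) = 0" if "0 < j" "j < 11" for j
  proof -
    have "fv j \<noteq> b0 \<and> - fv j \<noteq> b0"
    proof (rule ccontr)
      assume "\<not> ?thesis"
      then have "fv j = fv 0 \<or> fv j = - fv 0" using b0(2) by (metis minus_minus)
      moreover have "fv 0 \<in> vec.span (fv ` ({..<11} - {j}))" using that by (intro vec.span_base imageI) auto
      ultimately show False using fv_notin[OF that(2)] vec.span_neg by metis
    qed
    then show ?thesis using face_in[OF that(2)] f(3)[of "fv j"] f(3)[of "- fv j"] f_neg[of "fv j"] by auto
  qed
  have "cycle_list [2, 3, 4]" using n by (simp add: cycle_list_def)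
  then have "cvec [2, 3, 4] \<in> ?Z" by (auto simp: cycle_vectors_eq)
  then obtain k :: "(nat set \<Rightarrow> real) \<Rightarrow> int" where k: "cvec [2, 3, 4] = (\<Sum>b\<in>B'. vec_scale (of_int (k b)) b)"
    using icb by (auto simp: integral_cycle_basis_def)
  have "f (cvec [2, 3, 4]) = (\<Sum>b\<in>B'. of_int (k b) * f b)"
    unfolding k by (rule functional_sum[of f _ "\<lambda>b. b"]) (rule f)+
  also have "\<dots> = (\<Sum>b\<in>{b0}. of_int (k b) * f b)"
    using finB' b0(1) f(3) by (intro sum.mono_neutral_right) auto
  finally have fk: "f (cvec [2, 3, 4]) = of_int (k b0)" using f(4) by simp
  have twice: "vec_scale 2 (cvec [2, 3, 4]) = (\<Sum>i<11. vec_scale 1 (fv i))"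
  proof
    fix e
    \<comment> \<open>As with \<open>skew\<close>, halving writes the antisymmetric entry as a
      difference, and the cancellation becomes linear.\<close>
    define h where "h u v = a u v e / 2" for u v
    have h: "a u v e = h u v - h v u" for u v
      using a_anti[of u v] by (simp add: h_def)
    show "vec_scale 2 (cvec [2, 3, 4]) e = (\<Sum>i<11. vec_scale 1 (fv i)) e"
      by (simp add: vec_scale_apply sum_fun_apply fv_def faces_def cvec_def lessThan_nat_numeral h)
  qed
  have "2 * f (cvec [2, 3, 4]) = f (vec_scale 2 (cvec [2, 3, 4]))" by (rule f(2)[symmetric])
  also have "\<dots> = (\<Sum>i<11. 1 * f (fv i))"
    unfolding twice by (rule functional_sum) (rule f)+
  also have "\<dots> = (\<Sum>i\<in>{0}. f (fv i))"
    unfolding mult_1 using f_fv by (intro sum.mono_neutral_right) auto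
  also have "\<dots> = f (fv 0)" by simp
  finally have "2 * real_of_int (k b0) = f (fv 0)" unfolding fk .
  moreover have "f (fv 0) = 1 \<or> f (fv 0) = - 1" using b0(2) f(4) f_neg[of "fv 0"] by auto
  ultimately have "2 * real_of_int (k b0) = 1 \<or> 2 * real_of_int (k b0) = - 1" by simp
  then have "2 * k b0 = 1 \<or> 2 * k b0 = - 1" by linarith
  then show False by presburger
qed

lemma complete_digraph_orientation:
  assumes "orientation_of D (complete_graph n)"
  shows "complete_digraph {1..n} D"
proof -
  have "pairs {1..n} = {{u, v} | u v. u \<in> {1..n} \<and> v \<in> {1..n} \<and> u \<noteq> v}"
    unfolding pairs_def card_2_iff by blast
  then show ?thesis
    using assms unfolding complete_digraph_def orientation_of_def complete_graph_def by auto
qed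

theorem theorem7p11:
  fixes n :: nat and D :: "(nat, nat set) pre_digraph"
  assumes "n \<ge> 1"
    and "orientation_of D (complete_graph n)"
  shows "opt_in D \<longleftrightarrow> n \<le> 7"
proof -
  have D: "complete_digraph {1..n} D" using assms(2) by (rule complete_digraph_orientation)
  show ?thesis
  proof (cases "n \<le> 7")
    case True
    then have "opt_in D" by (intro complete_digraph.opt_in_small[OF D]) simp
    then show ?thesis using True by simp
  next
    case False
    then have "\<not> opt_in D" by (intro not_opt_in_large[OF D]) simp
    then show ?thesis using False by simp
  qed
qed

end
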